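(* Let $X$ be a $\operatorname{CAT}(0)$ space. Then there exists a constant $C>0$ such that every Lipschitz $2$-sphere $f\colon S^2\to X$ extends to a Lipschitz ball $\bar f\colon B^3\to X$ (with $\bar f|_{S^2}=f$) satisfying $\operatorname{vol}(\bar f)\le C\cdot\operatorname{area}(f)^{3/2}$.
   Context: A $\operatorname{CAT}(0)$ space is a complete geodesic space whose geodesic triangles are no fatter than Euclidean comparison triangles. For a Lipschitz map $f$ from a $k$-dimensional domain into $X$, $\operatorname{vol}_k(f)=\int_X\#f^{-1}(y)\,d\mathcal H^k(y)$ (equivalently the integral of the Jacobian of the metric differential); for $k=2$ this is the area. *)

theory Defs
  imports "HOL-Analysis.Analysis"
begin

definition geodesic_seg :: "(real \<Rightarrow> 'a::metric_space) \<Rightarrow> 'a \<Rightarrow> 'a \<Rightarrow> bool" where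
  "geodesic_seg g a b \<longleftrightarrow> g 0 = a \<and> g 1 = b \<and>
     (\<forall>s\<in>{0..1}. \<forall>t\<in>{0..1}. dist (g s) (g t) = \<bar>s - t\<bar> * dist a b)"

definition CAT0 :: "'a::metric_space itself \<Rightarrow> bool" where
  "CAT0 _ \<longleftrightarrow> complete (UNIV :: 'a set) \<and> (\<forall>a b::'a. \<exists>g. geodesic_seg g a b) \<and>
    (\<forall>(p::'a) q r g1 g2 g3 (p'::real^2) q' r'.
       geodesic_seg g1 p q \<and> geodesic_seg g2 q r \<and> geodesic_seg g3 r p \<and>
       dist p' q' = dist p q \<and> dist q' r' = dist q r \<and> dist r' p' = dist r p \<longrightarrow>
       (let G = (\<lambda>i::nat. if i = 0 then g1 else if i = 1 then g2 else g3);
            c = (\<lambda>i::nat. \<lambda>s::real.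
                  if i = 0 then (1 - s) *\<^sub>R p' + s *\<^sub>R q'
                  else if i = 1 then (1 - s) *\<^sub>R q' + s *\<^sub>R r'
                  else (1 - s) *\<^sub>R r' + s *\<^sub>R p')
        in \<forall>i<3. \<forall>j<3. \<forall>s\<in>{0..1}. \<forall>t\<in>{0..1}.
             dist (G i s) (G j t) \<le> dist (c i s) (c j t)))"

text \<open>Normalising constant omega_k (volume of the Euclidean unit k-ball).\<close>
definition omega :: "nat \<Rightarrow> real" where
  "omega k = pi powr (real k / 2) / Gamma (real k / 2 + 1)"

definition hausdorff_pre :: "nat \<Rightarrow> real \<Rightarrow> 'a::metric_space set \<Rightarrow> ennreal" where
  "hausdorff_pre k \<delta> A = (INF C \<in> {C :: nat \<Rightarrow> 'a set. A \<subseteq> (\<Union>i. C i) \<and>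
        (\<forall>i. bounded (C i) \<and> diameter (C i) \<le> \<delta>)}.
      (\<Sum>i. ennreal (omega k * (diameter (C i) / 2) ^ k)))"

definition hausdorff_outer :: "nat \<Rightarrow> 'a::metric_space set \<Rightarrow> ennreal" where
  "hausdorff_outer k A = (SUP \<delta> \<in> {0<..}. hausdorff_pre k \<delta> A)"

definition hausdorff_measure :: "nat \<Rightarrow> 'a::metric_space measure" where
  "hausdorff_measure k = measure_of UNIV (sets borel) (hausdorff_outer k)"

definition mult :: "('b \<Rightarrow> 'a) \<Rightarrow> 'b set \<Rightarrow> 'a \<Rightarrow> ennreal" where
  "mult f D y = (if finite (D \<inter> f -` {y}) then of_nat (card (D \<inter> f -` {y})) else \<infinity>)"

definition vol :: "nat \<Rightarrow> ('b \<Rightarrow> 'a::metric_space) \<Rightarrow> 'b set \<Rightarrow> ennreal" where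
  "vol k f D = (\<integral>\<^sup>+ y. mult f D y \<partial>(hausdorff_measure k))"

definition lipschitz :: "'b set \<Rightarrow> ('b::metric_space \<Rightarrow> 'a::metric_space) \<Rightarrow> bool" where
  "lipschitz D f \<longleftrightarrow> (\<exists>L. L-lipschitz_on D f)"

end

theory Submission
  imports Defs
begin

text \<open>
  Only coverings are used: if a map stretches sets of small diameter in a controlled way, then coverings of its
  image bound the Hausdorff measure of the image of every piece of the domain, and multiplicities are recovered by
  cutting the domain into small pieces and applying Fatou's lemma. In particular the cone from a point over a
  sphere contained in a ball of radius R has volume at most a constant times R times the area.

  Call a ball of radius \<rho> critical if it carries area about c * \<rho>^2, with c a small universal constant,
  while the concentric balls of radii 2 * \<rho> and 8 * \<rho> carry at most the corresponding amounts. Almost every point of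
  the image is the centre of a critical ball, and by a Vitali argument finitely many disjoint ones carry a fixed
  fraction of the area. Inside a critical ball the pigeonhole principle yields a thin spherical slab of small area in
  which the image splits into clusters of total diameter at most a constant times c * \<rho>. Coning each cluster to a
  point, and then running along a segment to the centre, replaces the map on the ball by one of area at most a constant
  times (c * \<rho>)^2, which is less than half of what was there; the geodesic homotopy between the two maps has
  volume at most a constant times \<rho>^3. Thus one round of such modifications multiplies the area A by a
  factor less than 1 at the cost of volume at most a constant times A powr (3/2). These costs form a convergent geometric
  series, and once the area is tiny compared to the diameter the remaining sphere is coned off.
\<close>

section \<open>Hausdorff measure\<close>

text \<open>The slab width \<delta> has no lower bound in terms of c and \<rho>, so the Lipschitz
  constants of the modified maps are out of control and no estimate may depend on them. What saves
  the argument is that a modification stretches in one direction only, along the distance to the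
  centre of the ball: areas and volumes then grow linearly in 1 / \<delta>, the slab has area of
  order \<delta>, and the two factors cancel. This is why the covering lemmas carry a real function
  \<open>v\<close> that accounts for the stretch, instead of a Lipschitz constant. The space need
  not be locally compact, so area minimisers are not at hand; only finitely many explicit Lipschitz
  modifications are made, and their number depends on the given sphere. Coning off costs the
  remaining area times the radius of a ball containing the image. The initial area does not control
  this radius, but geodesic modifications never leave such a ball, so the radius is the same in all
  rounds while the area decays geometrically.\<close>

definition hausdorff_const :: "nat \<Rightarrow> real" where
  "hausdorff_const k = omega k / 2 ^ k"

lemma hausdorff_const_pos: "0 < hausdorff_const k"
  unfolding hausdorff_const_def omega_def
  by (intro divide_pos_pos) (auto intro!: Gamma_real_pos add_nonneg_pos)

lemma hausdorff_const_eq: "omega k * (d / 2) ^ k = hausdorff_const k * d ^ k"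
  by (simp add: hausdorff_const_def power_divide)

section \<open>Covers and subadditivity\<close>

lemma hausdorff_pre_mono:
  assumes "A \<subseteq> B" shows "hausdorff_pre k \<delta> A \<le> hausdorff_pre k \<delta> B"
  unfolding hausdorff_pre_def using assms by (intro INF_superset_mono) auto

lemma hausdorff_pre_antimono:
  assumes "\<delta> \<le> \<delta>'" shows "hausdorff_pre k \<delta>' A \<le> hausdorff_pre k \<delta> A"
  unfolding hausdorff_pre_def using assms by (intro INF_superset_mono) (auto intro: order_trans)

lemma hausdorff_pre_le_suminf:
  assumes "A \<subseteq> (\<Union>i. C i)" "\<And>i. bounded (C i)" "\<And>i. diameter (C i) \<le> \<delta>"
  shows "hausdorff_pre k \<delta> A \<le> (\<Sum>i. ennreal (hausdorff_const k * diameter (C i) ^ k))"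
  unfolding hausdorff_pre_def hausdorff_const_eq using assms by (intro INF_lower) auto

lemma hausdorff_pre_approx:
  assumes "hausdorff_pre k \<delta> A < b"
  obtains C :: "nat \<Rightarrow> 'a::metric_space set" where "A \<subseteq> (\<Union>i. C i)" "\<And>i. bounded (C i)" "\<And>i. diameter (C i) \<le> \<delta>"
    "(\<Sum>i. ennreal (hausdorff_const k * diameter (C i) ^ k)) < b"
  using assms unfolding hausdorff_pre_def INF_less_iff hausdorff_const_eq by auto

lemma diameter_leI:
  fixes A :: "'a::metric_space set"
  assumes "\<And>x y. x \<in> A \<Longrightarrow> y \<in> A \<Longrightarrow> dist x y \<le> d" "0 \<le> d"
  shows "diameter A \<le> d"
  using assms unfolding diameter_def by (auto intro!: cSUP_least)

text \<open>The cover is the set itself followed by empty sets; \<open>0 < k\<close> makes the empty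
  sets contribute 0 ^ k = 0 rather than 1.\<close>

lemma hausdorff_pre_le_const:
  fixes A :: "'a::metric_space set"
  assumes "\<And>x y. x \<in> A \<Longrightarrow> y \<in> A \<Longrightarrow> dist x y \<le> d" "0 \<le> d" "d \<le> \<delta>" "0 < k"
  shows "hausdorff_pre k \<delta> A \<le> ennreal (hausdorff_const k * d ^ k)"
proof -
  define C where "C = (\<lambda>i::nat. if i = 0 then A else {})"
  have b: "bounded A" using assms(1) bounded_two_points by blast
  have d: "diameter A \<le> d" "0 \<le> diameter A"
    using assms(1,2) by (auto intro!: diameter_leI diameter_ge_0 b)
  have "hausdorff_pre k \<delta> A \<le> (\<Sum>i. ennreal (hausdorff_const k * diameter (C i) ^ k))"
    by (rule hausdorff_pre_le_suminf) (use b d assms in \<open>auto simp: C_def split: if_splits\<close>)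
  also have "\<dots> = ennreal (hausdorff_const k * diameter A ^ k)"
    by (subst suminf_finite[of "{0}"]) (use assms in \<open>auto simp: C_def zero_power\<close>)
  also have "\<dots> \<le> ennreal (hausdorff_const k * d ^ k)"
    using d hausdorff_const_pos[of k] by (intro ennreal_leI mult_left_mono power_mono) auto
  finally show ?thesis .
qed

lemma hausdorff_pre_empty: "0 < k \<Longrightarrow> 0 \<le> \<delta> \<Longrightarrow> hausdorff_pre k \<delta> {} = 0"
  using hausdorff_pre_le_const[of "{}" 0 \<delta> k] by (auto simp: zero_power)

lemma suminf_ennreal_half: "0 \<le> e \<Longrightarrow> (\<Sum>i. ennreal (e * (1/2) ^ Suc i)) = ennreal e"
proof -
  assume "0 \<le> e"
  have "(\<lambda>i. e * (1/2) ^ Suc i) sums (e * 1)" using power_half_series by (rule sums_mult)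
  then show ?thesis using \<open>0 \<le> e\<close> by (intro suminf_ennreal_eq) auto
qed

lemma hausdorff_pre_countable_subadditive:
  "hausdorff_pre k \<delta> (\<Union>i::nat. A i) \<le> (\<Sum>i. hausdorff_pre k \<delta> (A i :: 'a::metric_space set))"
proof (rule ennreal_le_epsilon)
  fix e :: real assume fin: "(\<Sum>i. hausdorff_pre k \<delta> (A i)) < top" and "0 < e"
  have fin': "hausdorff_pre k \<delta> (A i) < top" for i
    using fin by (meson ennreal_suminf_lessD)
  have "\<exists>C :: nat \<Rightarrow> 'a set. A i \<subseteq> (\<Union>j. C j) \<and> (\<forall>j. bounded (C j) \<and> diameter (C j) \<le> \<delta>) \<and>
    (\<Sum>j. ennreal (hausdorff_const k * diameter (C j) ^ k)) \<le> hausdorff_pre k \<delta> (A i) + ennreal (e * (1/2) ^ Suc i)" for i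
  proof -
    have "hausdorff_pre k \<delta> (A i) < hausdorff_pre k \<delta> (A i) + ennreal (e * (1/2) ^ Suc i)"
      using fin'[of i] \<open>0 < e\<close> by (simp add: ennreal_less_zero_iff)
    then show ?thesis by (rule hausdorff_pre_approx) (meson less_imp_le)
  qed
  then obtain C :: "nat \<Rightarrow> nat \<Rightarrow> 'a set" where C: "\<And>i. A i \<subseteq> (\<Union>j. C i j)" "\<And>i j. bounded (C i j)" "\<And>i j. diameter (C i j) \<le> \<delta>"
    "\<And>i. (\<Sum>j. ennreal (hausdorff_const k * diameter (C i j) ^ k)) \<le> hausdorff_pre k \<delta> (A i) + ennreal (e * (1/2) ^ Suc i)"
    by metis
  define D where "D = (\<lambda>(i,j). C i j)"
  have "hausdorff_pre k \<delta> (\<Union>i. A i) \<le> (\<Sum>n. ennreal (hausdorff_const k * diameter (D (prod_decode n)) ^ k))"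
  proof (rule hausdorff_pre_le_suminf)
    show "(\<Union>i. A i) \<subseteq> (\<Union>n. D (prod_decode n))"
    proof
      fix x assume "x \<in> (\<Union>i. A i)"
      then obtain i j where "x \<in> C i j" using C(1) by blast
      then have "x \<in> D (prod_decode (prod_encode (i,j)))" by (simp add: D_def)
      then show "x \<in> (\<Union>n. D (prod_decode n))" by blast
    qed
  qed (use C in \<open>auto simp: D_def split: prod.splits\<close>)
  also have "\<dots> = (\<Sum>i. \<Sum>j. ennreal (hausdorff_const k * diameter (C i j) ^ k))"
    by (rule suminf_ennreal_2dimen[where f = "\<lambda>p. ennreal (hausdorff_const k * diameter (D p) ^ k)"]) (simp add: D_def)
  also have "\<dots> \<le> (\<Sum>i. hausdorff_pre k \<delta> (A i) + ennreal (e * (1/2) ^ Suc i))"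
    by (intro suminf_le C) auto
  also have "\<dots> = (\<Sum>i. hausdorff_pre k \<delta> (A i)) + (\<Sum>i. ennreal (e * (1/2) ^ Suc i))"
    by (subst suminf_add) auto
  also have "(\<Sum>i. ennreal (e * (1/2) ^ Suc i)) = ennreal e" using \<open>0 < e\<close> by (intro suminf_ennreal_half) simp
  finally show "hausdorff_pre k \<delta> (\<Union>i. A i) \<le> (\<Sum>i. hausdorff_pre k \<delta> (A i)) + ennreal e" .
qed

lemma hausdorff_pre_finite_subadditive:
  assumes "finite I" "0 < k" "0 \<le> \<delta>"
  shows "hausdorff_pre k \<delta> (\<Union>i\<in>I. A i) \<le> (\<Sum>i\<in>I. hausdorff_pre k \<delta> (A i :: 'a::metric_space set))"
  using assms(1)
proof (induction I)
  case empty then show ?case using assms by (simp add: hausdorff_pre_empty)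
next
  case (insert a I)
  define B where "B = (\<lambda>n::nat. if n = 0 then A a else if n = 1 then (\<Union>i\<in>I. A i) else {})"
  have "hausdorff_pre k \<delta> (\<Union>i\<in>insert a I. A i) = hausdorff_pre k \<delta> (\<Union>n. B n)"
    by (rule arg_cong[where f = "hausdorff_pre k \<delta>"]) (auto simp: B_def split: if_splits)
  also have "\<dots> \<le> (\<Sum>n. hausdorff_pre k \<delta> (B n))" by (rule hausdorff_pre_countable_subadditive)
  also have "\<dots> = (\<Sum>n\<in>{0,1}. hausdorff_pre k \<delta> (B n))"
    by (rule suminf_finite) (use assms in \<open>auto simp: B_def hausdorff_pre_empty\<close>)
  also have "\<dots> = hausdorff_pre k \<delta> (A a) + hausdorff_pre k \<delta> (\<Union>i\<in>I. A i)" by (simp add: B_def)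
  also have "\<dots> \<le> (\<Sum>i\<in>insert a I. hausdorff_pre k \<delta> (A i))" using insert by (simp add: add_left_mono)
  finally show ?case .
qed

lemma hausdorff_pre_le_outer: "0 < \<delta> \<Longrightarrow> hausdorff_pre k \<delta> A \<le> hausdorff_outer k A"
  unfolding hausdorff_outer_def by (intro SUP_upper) auto

text \<open>\<open>hausdorff_pre\<close> grows as \<delta> shrinks, so the supremum is decided by
  arbitrarily small \<delta>.\<close>

lemma hausdorff_outer_leI:
  assumes "0 < \<delta>0" "\<And>\<delta>. 0 < \<delta> \<Longrightarrow> \<delta> \<le> \<delta>0 \<Longrightarrow> hausdorff_pre k \<delta> A \<le> B"
  shows "hausdorff_outer k A \<le> B"
  unfolding hausdorff_outer_def
proof (rule SUP_least)
  fix \<delta> :: real assume "\<delta> \<in> {0<..}"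
  then have "hausdorff_pre k (min \<delta> \<delta>0) A \<le> B" using assms by auto
  moreover have "hausdorff_pre k \<delta> A \<le> hausdorff_pre k (min \<delta> \<delta>0) A" by (intro hausdorff_pre_antimono) auto
  ultimately show "hausdorff_pre k \<delta> A \<le> B" by (rule order_trans[rotated])
qed

lemma hausdorff_outer_mono: "A \<subseteq> B \<Longrightarrow> hausdorff_outer k A \<le> hausdorff_outer k B"
  unfolding hausdorff_outer_def by (intro SUP_mono) (auto intro: hausdorff_pre_mono)

lemma hausdorff_outer_empty: "0 < k \<Longrightarrow> hausdorff_outer k {} = 0"
  unfolding hausdorff_outer_def by (simp add: hausdorff_pre_empty)

lemma hausdorff_outer_countable_subadditive:
  "hausdorff_outer k (\<Union>i::nat. A i) \<le> (\<Sum>i. hausdorff_outer k (A i :: 'a::metric_space set))"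
proof (rule hausdorff_outer_leI[of 1])
  fix \<delta> :: real assume "0 < \<delta>"
  show "hausdorff_pre k \<delta> (\<Union>i. A i) \<le> (\<Sum>i. hausdorff_outer k (A i))"
    by (rule order_trans[OF hausdorff_pre_countable_subadditive])
      (intro suminf_le hausdorff_pre_le_outer \<open>0 < \<delta>\<close> summableI)
qed simp

lemma hausdorff_outer_finite_subadditive:
  assumes "finite I" "0 < k"
  shows "hausdorff_outer k (\<Union>i\<in>I. A i) \<le> (\<Sum>i\<in>I. hausdorff_outer k (A i :: 'a::metric_space set))"
proof (rule hausdorff_outer_leI[of 1])
  fix \<delta> :: real assume "0 < \<delta>"
  show "hausdorff_pre k \<delta> (\<Union>i\<in>I. A i) \<le> (\<Sum>i\<in>I. hausdorff_outer k (A i))"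
    by (rule order_trans[OF hausdorff_pre_finite_subadditive])
      (use assms \<open>0 < \<delta>\<close> in \<open>auto intro!: sum_mono hausdorff_pre_le_outer\<close>)
qed simp

lemma hausdorff_outer_Un_le:
  "0 < k \<Longrightarrow> hausdorff_outer k (A \<union> B) \<le> hausdorff_outer k A + hausdorff_outer k (B :: 'a::metric_space set)"
  using hausdorff_outer_finite_subadditive[of "{True,False}" k "\<lambda>b. if b then A else B"]
  by (simp add: Un_commute)

section \<open>Caratheodory measurability of Borel sets\<close>

lemma hausdorff_pre_separated:
  fixes A B :: "'a::metric_space set"
  assumes sep: "\<And>x y. x \<in> A \<Longrightarrow> y \<in> B \<Longrightarrow> \<delta> < dist x y"
  shows "0 < k \<Longrightarrow> hausdorff_pre k \<delta> A + hausdorff_pre k \<delta> B \<le> hausdorff_pre k \<delta> (A \<union> B)"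
proof (subst (3) hausdorff_pre_def, rule INF_greatest)
  fix C :: "nat \<Rightarrow> 'a set" assume k: "0 < k"
  assume "C \<in> {C. A \<union> B \<subseteq> (\<Union>i. C i) \<and> (\<forall>i. bounded (C i) \<and> diameter (C i) \<le> \<delta>)}"
  then have C: "A \<union> B \<subseteq> (\<Union>i. C i)" "\<And>i. bounded (C i)" "\<And>i. diameter (C i) \<le> \<delta>" by auto
  have \<delta>: "0 \<le> \<delta>" using diameter_ge_0[OF C(2)] C(3) order_trans by blast
  define C1 where "C1 i = (if C i \<inter> A \<noteq> {} then C i else {})" for i
  define C2 where "C2 i = (if C i \<inter> B \<noteq> {} then C i else {})" for i
  \<comment> \<open>A set of diameter at most \<delta> cannot meet both of two sets that are more
    than \<delta> apart, so a cover of the union splits into a cover of each.\<close>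
  have disj: "C i \<inter> A = {} \<or> C i \<inter> B = {}" for i
  proof (rule ccontr)
    assume "\<not> ?thesis"
    then obtain x y where "x \<in> C i" "x \<in> A" "y \<in> C i" "y \<in> B" by blast
    then have "dist x y \<le> \<delta>" using diameter_bounded_bound[OF C(2)] C(3) order_trans by blast
    then show False using sep \<open>x \<in> A\<close> \<open>y \<in> B\<close> by fastforce
  qed
  have "hausdorff_pre k \<delta> A \<le> (\<Sum>i. ennreal (hausdorff_const k * diameter (C1 i) ^ k))"
    by (rule hausdorff_pre_le_suminf) (use C \<delta> in \<open>auto simp: C1_def split: if_splits\<close>, blast)
  moreover have "hausdorff_pre k \<delta> B \<le> (\<Sum>i. ennreal (hausdorff_const k * diameter (C2 i) ^ k))"
    by (rule hausdorff_pre_le_suminf) (use C \<delta> in \<open>auto simp: C2_def split: if_splits\<close>, blast)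
  ultimately have "hausdorff_pre k \<delta> A + hausdorff_pre k \<delta> B \<le>
    (\<Sum>i. ennreal (hausdorff_const k * diameter (C1 i) ^ k) + ennreal (hausdorff_const k * diameter (C2 i) ^ k))"
    by (subst suminf_add[symmetric]) (auto intro: add_mono)
  also have "\<dots> \<le> (\<Sum>i. ennreal (hausdorff_const k * diameter (C i) ^ k))"
  proof (intro suminf_le summableI)
    fix i show "ennreal (hausdorff_const k * diameter (C1 i) ^ k) + ennreal (hausdorff_const k * diameter (C2 i) ^ k)
      \<le> ennreal (hausdorff_const k * diameter (C i) ^ k)"
      using disj[of i] k by (auto simp: C1_def C2_def zero_power)
  qed
  finally show "hausdorff_pre k \<delta> A + hausdorff_pre k \<delta> B \<le> (\<Sum>i. ennreal (omega k * (diameter (C i) / 2) ^ k))"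
    by (simp add: hausdorff_const_eq)
qed

text \<open>Covers finer than the gap \<eta> split. The scales of the two summands may be chosen
  independently, because both values only increase when passing to a smaller common scale.\<close>

lemma hausdorff_outer_separated:
  fixes A B :: "'a::metric_space set"
  assumes sep: "\<And>x y. x \<in> A \<Longrightarrow> y \<in> B \<Longrightarrow> \<eta> \<le> dist x y" and "0 < \<eta>" "0 < k"
  shows "hausdorff_outer k A + hausdorff_outer k B \<le> hausdorff_outer k (A \<union> B)"
proof -
  have *: "hausdorff_pre k \<delta>1 A + hausdorff_pre k \<delta>2 B \<le> hausdorff_outer k (A \<union> B)" if "0 < \<delta>1" "0 < \<delta>2" for \<delta>1 \<delta>2
  proof -
    define \<delta> where "\<delta> = min (\<eta>/2) (min \<delta>1 \<delta>2)"
    have \<delta>: "0 < \<delta>" "\<delta> < \<eta>" "\<delta> \<le> \<delta>1" "\<delta> \<le> \<delta>2" using that assms by (auto simp: \<delta>_def min_def)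
    have "hausdorff_pre k \<delta>1 A + hausdorff_pre k \<delta>2 B \<le> hausdorff_pre k \<delta> A + hausdorff_pre k \<delta> B"
      by (intro add_mono hausdorff_pre_antimono \<delta>)
    also have "\<dots> \<le> hausdorff_pre k \<delta> (A \<union> B)"
      by (intro hausdorff_pre_separated) (use sep \<delta> assms in force)+
    also have "\<dots> \<le> hausdorff_outer k (A \<union> B)" by (intro hausdorff_pre_le_outer \<delta>)
    finally show ?thesis .
  qed
  have ne: "{0::real<..} \<noteq> {}" by (auto intro: exI[of _ 1])
  show ?thesis
    unfolding hausdorff_outer_def[of k A] hausdorff_outer_def[of k B]
    apply (subst ennreal_SUP_add_left[OF ne, symmetric])
    apply (rule SUP_least)
    apply (subst ennreal_SUP_add_right[OF ne])
    apply (rule SUP_least)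
    using * by auto
qed

text \<open>Caratheodory's argument for metric outer measures. \<open>A - F\<close> is exhausted by
  the sets \<open>B n\<close> at positive distance from \<open>F\<close>. The differences
  \<open>R n\<close> with indices of equal parity are separated from each other, so all their
  measures sum to at most twice that of \<open>A\<close>, and the tail of this convergent series
  bounds what \<open>B n\<close> misses.\<close>

lemma hausdorff_outer_closed_split:
  fixes A F :: "'a::metric_space set"
  assumes "closed F" and k: "0 < k"
  shows "hausdorff_outer k (A \<inter> F) + hausdorff_outer k (A - F) \<le> hausdorff_outer k A"
proof (cases "F = {} \<or> hausdorff_outer k A = top")
  case True
  then show ?thesis using k by (auto simp: hausdorff_outer_empty)
next
  case False
  then have F: "F \<noteq> {}" and fin: "hausdorff_outer k A < top" by (auto simp: less_top)
  define B where "B n = {x \<in> A. 1 / real (Suc n) \<le> infdist x F}" for n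
  define R where "R n = B (Suc n) - B n" for n
  have B: "A - F = (\<Union>n. B n)"
  proof (intro equalityI subsetI)
    fix x assume x: "x \<in> A - F"
    then have "0 < infdist x F" using assms F by (simp add: infdist_pos_not_in_closed)
    then obtain n where "1 / real (Suc n) < infdist x F" using nat_approx_posE by blast
    then show "x \<in> (\<Union>n. B n)" using x by (auto simp: B_def intro!: exI[of _ n])
  next
    fix x assume "x \<in> (\<Union>n. B n)"
    then obtain n where n: "x \<in> A" "1 / real (Suc n) \<le> infdist x F" by (auto simp: B_def)
    have "0 < 1 / real (Suc n)" by simp
    then have "0 < infdist x F" using n by linarith
    then show "x \<in> A - F" using n by (auto dest: infdist_zero)
  qed
  have diffinf: "infdist x F - infdist y F \<le> dist x y" for x y
    using infdist_triangle[of x F y] by linarith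
  \<comment> \<open>Indices of equal parity skip one shell, which leaves a gap equal to a difference
    of consecutive reciprocals. For index 0 the union is empty, and the value 1 below is a dummy
    gap.\<close>
  have sepR: "hausdorff_outer k (\<Union>i<n. R (2 * i + p)) + hausdorff_outer k (R (2 * n + p)) \<le> hausdorff_outer k ((\<Union>i<n. R (2 * i + p)) \<union> R (2 * n + p))"
    if "p \<le> 1" for n p :: nat
  proof (rule hausdorff_outer_separated[OF _ _ k])
    have "0 < 1 / real m - 1 / real (Suc m)" if "m \<noteq> 0" for m :: nat
      using that by (simp add: divide_strict_left_mono)
    then show "0 < (if 2*n+p = 0 then 1 else 1 / (real (2*n+p)) - 1 / real (Suc (2*n+p)))" by (metis zero_less_one)
  next
    fix x y assume "x \<in> (\<Union>i<n. R (2 * i + p))" and y: "y \<in> R (2 * n + p)"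
    then obtain i where i: "i < n" "x \<in> R (2*i+p)" by auto
    then have "1 / real (Suc (Suc (2*i+p))) \<le> infdist x F" by (auto simp: R_def B_def)
    moreover have "1 / real (2*n+p) \<le> 1 / real (Suc (Suc (2*i+p)))" using i by (intro divide_left_mono) auto
    moreover have "infdist y F < 1 / real (Suc (2*n+p))" using y by (auto simp: R_def B_def)
    ultimately show "(if 2*n+p = 0 then 1 else 1 / (real (2*n+p)) - 1 / real (Suc (2*n+p))) \<le> dist x y"
      using diffinf[of x y] i by auto
  qed
  have sumR: "(\<Sum>i<n. hausdorff_outer k (R (2 * i + p))) \<le> hausdorff_outer k (\<Union>i<n. R (2 * i + p))" if "p \<le> 1" for n p
  proof (induction n)
    case 0 then show ?case by (simp add: hausdorff_outer_empty k)
  next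
    case (Suc n)
    have "(\<Sum>i<Suc n. hausdorff_outer k (R (2 * i + p))) \<le> hausdorff_outer k (\<Union>i<n. R (2 * i + p)) + hausdorff_outer k (R (2 * n + p))"
      using Suc by (simp add: add_right_mono)
    also have "\<dots> \<le> hausdorff_outer k ((\<Union>i<n. R (2 * i + p)) \<union> R (2 * n + p))" by (rule sepR[OF that])
    also have "((\<Union>i<n. R (2 * i + p)) \<union> R (2 * n + p)) = (\<Union>i<Suc n. R (2 * i + p))" by (auto simp: lessThan_Suc)
    finally show ?case .
  qed
  have subR: "(\<Union>i<n. R (2 * i + p)) \<subseteq> A" for n p by (auto simp: R_def B_def)
  have sum2: "(\<Sum>i<2*n. hausdorff_outer k (R i)) = (\<Sum>i<n. hausdorff_outer k (R (2*i+0))) + (\<Sum>i<n. hausdorff_outer k (R (2*i+1)))" for n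
    by (induction n) (auto simp: algebra_simps)
  have sumle: "(\<Sum>i<n. hausdorff_outer k (R i)) \<le> hausdorff_outer k A + hausdorff_outer k A" for n
  proof -
    have "(\<Sum>i<n. hausdorff_outer k (R i)) \<le> (\<Sum>i<2*n. hausdorff_outer k (R i))" by (intro sum_mono2) auto
    also have "\<dots> \<le> hausdorff_outer k A + hausdorff_outer k A"
      unfolding sum2 by (intro add_mono order_trans[OF sumR hausdorff_outer_mono[OF subR]]) auto
    finally show ?thesis .
  qed
  define S where "S = (\<Sum>i. hausdorff_outer k (R i))"
  have S: "S < top"
  proof -
    have "S \<le> hausdorff_outer k A + hausdorff_outer k A" unfolding S_def
      using sumle by (intro suminf_le_const summableI)
    also have "\<dots> < top" using fin by simp
    finally show ?thesis .
  qed
  let ?X = "hausdorff_outer k (A \<inter> F) + hausdorff_outer k (A - F)"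
  \<comment> \<open>A partial sum is added on both sides instead of subtracting a tail, since
    \<open>ennreal\<close> subtraction truncates; \<open>S\<close> is cancelled at the end because
    it is finite.\<close>
  have main: "?X + (\<Sum>i<n. hausdorff_outer k (R i)) \<le> hausdorff_outer k A + S" for n
  proof -
    have 1: "hausdorff_outer k (A \<inter> F) + hausdorff_outer k (B n) \<le> hausdorff_outer k A"
    proof -
      have "hausdorff_outer k (B n) + hausdorff_outer k (A \<inter> F) \<le> hausdorff_outer k (B n \<union> (A \<inter> F))"
      proof (rule hausdorff_outer_separated[OF _ _ k, of _ _ "1 / real (Suc n)"])
        fix x y assume "x \<in> B n" "y \<in> A \<inter> F"
        then show "1 / real (Suc n) \<le> dist x y" using infdist_le[of y F x] by (auto simp: B_def)
      qed auto
      also have "\<dots> \<le> hausdorff_outer k A" by (intro hausdorff_outer_mono) (auto simp: B_def)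
      finally show ?thesis by (simp add: add.commute)
    qed
    have "A - F \<subseteq> B n \<union> (\<Union>i. R (i + n))"
    proof
      fix x assume "x \<in> A - F"
      then obtain m where m: "x \<in> B m" using B by blast
      define m0 where "m0 = (LEAST m. x \<in> B m)"
      have m0: "x \<in> B m0" "\<And>j. j < m0 \<Longrightarrow> x \<notin> B j" unfolding m0_def using m by (auto intro: LeastI dest: not_less_Least)
      have Bm: "B i \<subseteq> B j" if "i \<le> j" for i j
      proof -
        have "1 / real (Suc j) \<le> 1 / real (Suc i)" using that by (intro divide_left_mono) auto
        then show ?thesis by (auto simp: B_def)
      qed
      show "x \<in> B n \<union> (\<Union>i. R (i + n))"
      proof (cases "m0 \<le> n")
        case True then show ?thesis using Bm m0 by blast
      next
        case False
        then have "x \<in> R ((m0 - 1 - n) + n)" using m0 by (auto simp: R_def)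
        then show ?thesis by blast
      qed
    qed
    then have "hausdorff_outer k (A - F) \<le> hausdorff_outer k (B n \<union> (\<Union>i. R (i + n)))" by (rule hausdorff_outer_mono)
    also have "\<dots> \<le> hausdorff_outer k (B n) + hausdorff_outer k (\<Union>i. R (i + n))" by (rule hausdorff_outer_Un_le[OF k])
    also have "\<dots> \<le> hausdorff_outer k (B n) + (\<Sum>i. hausdorff_outer k (R (i + n)))"
      by (intro add_left_mono hausdorff_outer_countable_subadditive)
    finally have "?X + (\<Sum>i<n. hausdorff_outer k (R i)) \<le> hausdorff_outer k (A \<inter> F) + (hausdorff_outer k (B n) + (\<Sum>i. hausdorff_outer k (R (i + n)))) + (\<Sum>i<n. hausdorff_outer k (R i))"
      by (intro add_mono) auto
    also have "\<dots> = (hausdorff_outer k (A \<inter> F) + hausdorff_outer k (B n)) + ((\<Sum>i. hausdorff_outer k (R (i + n))) + (\<Sum>i<n. hausdorff_outer k (R i)))"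
      by (simp add: algebra_simps)
    also have "(\<Sum>i. hausdorff_outer k (R (i + n))) + (\<Sum>i<n. hausdorff_outer k (R i)) = S"
      unfolding S_def by (rule suminf_offset[symmetric]) (rule summableI)
    finally show ?thesis using 1 by (meson add_right_mono order_trans)
  qed
  have "(\<lambda>n. ?X + (\<Sum>i<n. hausdorff_outer k (R i))) \<longlonglongrightarrow> ?X + S"
    unfolding S_def by (intro tendsto_add tendsto_const summable_LIMSEQ summableI)
  then have "?X + S \<le> hausdorff_outer k A + S" using main by (intro LIMSEQ_le_const2) auto
  then show ?thesis using S by (metis add.commute ennreal_add_left_cancel_le less_irrefl infinity_ennreal_def)
qed

text \<open>The Caratheodory-measurable sets form a sigma-algebra that contains the closed sets,
  hence all Borel sets. This is what gives \<open>hausdorff_measure\<close> its content: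
  \<open>measure_of\<close> yields the zero measure when the given function is not a
  measure.\<close>

lemma measure_space_hausdorff_outer:
  assumes k: "0 < k"
  shows "measure_space UNIV (sets borel) (hausdorff_outer k :: 'a::metric_space set \<Rightarrow> ennreal)"
proof -
  interpret P: sigma_algebra "UNIV :: 'a set" "Pow UNIV" by (rule sigma_algebra_Pow)
  have "outer_measure_space (Pow UNIV) (hausdorff_outer k :: 'a set \<Rightarrow> ennreal)"
    unfolding outer_measure_space_def positive_def increasing_def countably_subadditive_def
    by (auto simp: hausdorff_outer_empty k intro: hausdorff_outer_mono hausdorff_outer_countable_subadditive)
  from P.caratheodory_lemma[OF this]
  have ms: "measure_space UNIV (lambda_system UNIV (Pow UNIV) (hausdorff_outer k)) (hausdorff_outer k :: 'a set \<Rightarrow> ennreal)" .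
  then interpret L: sigma_algebra "UNIV :: 'a set" "lambda_system UNIV (Pow UNIV) (hausdorff_outer k)"
    by (simp add: measure_space_def)
  have "F \<in> lambda_system UNIV (Pow UNIV) (hausdorff_outer k)" if "closed F" for F :: "'a set"
    unfolding P.lambda_system_eq
  proof (clarsimp, rule antisym)
    fix A :: "'a set"
    show "hausdorff_outer k (A \<inter> F) + hausdorff_outer k (A - F) \<le> hausdorff_outer k A"
      by (rule hausdorff_outer_closed_split[OF that k])
    show "hausdorff_outer k A \<le> hausdorff_outer k (A \<inter> F) + hausdorff_outer k (A - F)"
      using hausdorff_outer_Un_le[OF k, of "A \<inter> F" "A - F"] by (simp add: Un_Diff_Int Int_Diff_Un)
  qed
  then have sub: "sets borel \<subseteq> lambda_system UNIV (Pow UNIV) (hausdorff_outer k :: 'a set \<Rightarrow> ennreal)"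
    unfolding borel_eq_closed by (subst sets_measure_of) (simp, intro L.sigma_sets_subset, blast)
  show ?thesis
    using ms sub sets.sigma_algebra_axioms[of "borel :: 'a measure"] unfolding measure_space_def
    by (auto simp: positive_def countably_additive_def)
qed

lemma sets_hausdorff_measure [simp, measurable_cong]: "sets (hausdorff_measure k) = sets borel"
  unfolding hausdorff_measure_def using sets.sets_measure_of_eq[of borel] by simp

lemma space_hausdorff_measure [simp]: "space (hausdorff_measure k) = UNIV"
  unfolding hausdorff_measure_def by (simp add: space_measure_of_conv)

lemma emeasure_hausdorff_measure:
  assumes "0 < k" "A \<in> sets borel"
  shows "emeasure (hausdorff_measure k) A = hausdorff_outer k A"
proof -
  have "emeasure (measure_of UNIV (sets borel) (hausdorff_outer k)) A = hausdorff_outer k A"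
    using measure_space_hausdorff_outer[OF assms(1)] assms(2)
    by (intro emeasure_measure_of_sigma) (auto simp: measure_space_def)
  then show ?thesis by (simp add: hausdorff_measure_def)
qed

section \<open>Volume of maps\<close>

text \<open>Continuous images of Borel sets can fail to be Borel, but images of sigma-compact sets
  are again sigma-compact, and half-open grid cells of a compact set belong to this class.\<close>

definition sigma_compact :: "'a::topological_space set \<Rightarrow> bool" where
  "sigma_compact D \<longleftrightarrow> (\<exists>K :: nat \<Rightarrow> 'a set. (\<forall>n. compact (K n)) \<and> D = (\<Union>n. K n))"

lemma compact_imp_sigma_compact: "compact D \<Longrightarrow> sigma_compact D"
  unfolding sigma_compact_def by (intro exI[of _ "\<lambda>_. D"]) auto

lemma sigma_compact_image_borel:
  fixes f :: "'b::topological_space \<Rightarrow> 'a::t2_space"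
  assumes "sigma_compact D" "continuous_on D f"
  shows "f ` D \<in> sets borel"
proof -
  obtain K :: "nat \<Rightarrow> 'b set" where K: "\<And>n. compact (K n)" "D = (\<Union>n. K n)"
    using assms(1) unfolding sigma_compact_def by auto
  have "compact (f ` K n)" for n
    using K assms(2) by (intro compact_continuous_image) (auto intro: continuous_on_subset)
  then have "closed (f ` K n)" for n by (rule compact_imp_closed)
  then have "(\<Union>n. f ` K n) \<in> sets borel" by auto
  then show ?thesis by (simp add: K(2) image_UN)
qed

section \<open>Grids that separate the points of the domain\<close>

lemma unit_interval_cell:
  assumes "0 \<le> (x::real)" "x \<le> 1"
  obtains j where "j < Suc n" "real j / real (Suc n) \<le> x" "x \<le> real (Suc j) / real (Suc n)"
proof -
  \<comment> \<open>\<open>min n\<close> puts the right end point 1, whose floor is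
    \<open>Suc n\<close>, into the last cell.\<close>
  define j where "j = min n (nat \<lfloor>x * real (Suc n)\<rfloor>)"
  have sx: "0 \<le> x * real (Suc n)" "x * real (Suc n) \<le> real (Suc n)" using assms by (auto simp: mult_le_cancel_right1 del: of_nat_Suc)
  have "real j \<le> x * real (Suc n) \<and> x * real (Suc n) \<le> real (Suc j)"
  proof (cases "nat \<lfloor>x * real (Suc n)\<rfloor> \<le> n")
    case True
    then have "j = nat \<lfloor>x * real (Suc n)\<rfloor>" by (simp add: j_def)
    then show ?thesis using sx by linarith
  next
    case False
    then have "j = n" by (simp add: j_def)
    then show ?thesis using sx False by linarith
  qed
  then show ?thesis by (intro that[of j]) (auto simp: j_def field_simps)
qed

text \<open>Index of the half-open grid cube of side 1 / n that contains \<open>x\<close>; the value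
  0 off \<open>Basis\<close> makes the set of indices met by a bounded set finite.\<close>

definition cell :: "nat \<Rightarrow> 'b::euclidean_space \<Rightarrow> 'b \<Rightarrow> int" where
  "cell n x = (\<lambda>b. if b \<in> Basis then \<lfloor>real n * (x \<bullet> b)\<rfloor> else 0)"

lemma finite_cell_image:
  assumes "bounded D" shows "finite (cell n ` D)"
proof -
  obtain B where B: "\<And>x. x \<in> D \<Longrightarrow> norm x \<le> B" using assms bounded_iff by blast
  define m where "m = \<lceil>real n * B\<rceil> + 1"
  have "cell n x b \<in> {-m..m}" if "x \<in> D" "b \<in> Basis" for x b
  proof -
    have "\<bar>x \<bullet> b\<bar> \<le> B" using B[OF that(1)] Basis_le_norm[OF that(2), of x] by linarith
    then have "\<bar>real n * (x \<bullet> b)\<bar> \<le> real n * B" by (simp add: abs_mult mult_left_mono)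
    then show ?thesis using that unfolding cell_def m_def by simp linarith
  qed
  then have "cell n ` D \<subseteq> {h. \<forall>b. (b \<in> Basis \<longrightarrow> h b \<in> {-m..m}) \<and> (b \<notin> Basis \<longrightarrow> h b = 0)}"
    by (auto simp: cell_def)
  moreover have "finite {h. \<forall>b::'a. (b \<in> Basis \<longrightarrow> h b \<in> {-m..m}) \<and> (b \<notin> Basis \<longrightarrow> h b = 0)}"
    by (intro finite_set_of_finite_funs) auto
  ultimately show ?thesis by (rule finite_subset)
qed

text \<open>The grids for different \<open>n\<close> are not nested in general, so separation is
  shown for every \<open>n\<close> beyond the reciprocal of a coordinate difference, not by
  refinement.\<close>

lemma cell_separates:
  assumes "x \<noteq> y" shows "eventually (\<lambda>n. cell n x \<noteq> cell n y) sequentially"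
proof -
  obtain b where b: "b \<in> Basis" "x \<bullet> b \<noteq> y \<bullet> b" using assms by (meson euclidean_eqI)
  obtain N :: nat where N: "1 / \<bar>x \<bullet> b - y \<bullet> b\<bar> < real N" using reals_Archimedean2 by blast
  have "cell n x \<noteq> cell n y" if "n \<ge> N" for n
  proof
    assume "cell n x = cell n y"
    then have "cell n x b = cell n y b" by simp
    then have "\<bar>real n * (x \<bullet> b) - real n * (y \<bullet> b)\<bar> < 1" using b unfolding cell_def by simp linarith
    then have "real n * \<bar>x \<bullet> b - y \<bullet> b\<bar> < 1"
      by (simp add: abs_mult flip: right_diff_distrib)
    moreover have "1 < real N * \<bar>x \<bullet> b - y \<bullet> b\<bar>" using N b by (simp add: field_simps)
    moreover have "real N * \<bar>x \<bullet> b - y \<bullet> b\<bar> \<le> real n * \<bar>x \<bullet> b - y \<bullet> b\<bar>"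
      using that by (intro mult_right_mono) auto
    ultimately show False by linarith
  qed
  then show ?thesis unfolding eventually_sequentially by blast
qed

lemma sigma_compact_cell:
  fixes p :: "'c::t2_space \<Rightarrow> 'b::euclidean_space"
  assumes "compact E" "continuous_on E p"
  shows "sigma_compact {x \<in> E. cell n (p x) = c}"
proof (cases "\<forall>b. b \<notin> Basis \<longrightarrow> c b = 0")
  case False
  then have "{x \<in> E. cell n (p x) = c} = {}" unfolding cell_def by auto
  then show ?thesis using compact_imp_sigma_compact[OF compact_empty] by (simp only:)
next
  case True
  \<comment> \<open>The strict upper bound of a half-open cell is written as a countable union of
    closed conditions with slack 1 / (m + 1).\<close>
  define K where "K m = E \<inter> (\<Inter>b\<in>Basis. {x \<in> E. real_of_int (c b) \<le> real n * (p x \<bullet> b)} \<inter>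
     {x \<in> E. real n * (p x \<bullet> b) \<le> real_of_int (c b) + 1 - 1 / real (Suc m)})" for m
  have cE: "closed E" using assms by (simp add: compact_imp_closed)
  have "compact (K m)" for m
    unfolding K_def
    by (intro compact_Int_closed assms closed_INT ballI closed_Int continuous_on_closed_Collect_le continuous_intros cE)
  moreover have "{x \<in> E. cell n (p x) = c} = (\<Union>m. K m)"
  proof (intro equalityI subsetI)
    fix x assume x: "x \<in> {x \<in> E. cell n (p x) = c}"
    have fl: "\<lfloor>real n * (p x \<bullet> b)\<rfloor> = c b" if "b \<in> Basis" for b
      using x that unfolding cell_def by (auto dest: fun_cong[of _ _ b])
    have "eventually (\<lambda>m. real n * (p x \<bullet> b) \<le> real_of_int (c b) + 1 - 1 / real (Suc m)) sequentially" if "b \<in> Basis" for b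
    proof -
      have "real_of_int (c b) + 1 - real n * (p x \<bullet> b) > 0" using fl[OF that] by linarith
      then have "eventually (\<lambda>m. inverse (real (Suc m)) < real_of_int (c b) + 1 - real n * (p x \<bullet> b)) sequentially"
        by (intro order_tendstoD(2)[OF LIMSEQ_inverse_real_of_nat])
      then show ?thesis by (rule eventually_mono) (simp add: inverse_eq_divide)
    qed
    then have "eventually (\<lambda>m. \<forall>b\<in>Basis. real n * (p x \<bullet> b) \<le> real_of_int (c b) + 1 - 1 / real (Suc m)) sequentially"
      by (intro eventually_ball_finite) auto
    then obtain m where m: "\<forall>b\<in>Basis. real n * (p x \<bullet> b) \<le> real_of_int (c b) + 1 - 1 / real (Suc m)"
      using eventually_happens' sequentially_bot by blast
    have "real_of_int (c b) \<le> real n * (p x \<bullet> b)" if "b \<in> Basis" for b using fl[OF that] by linarith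
    then have "x \<in> K m" using x m unfolding K_def by auto
    then show "x \<in> (\<Union>m. K m)" by blast
  next
    fix x assume "x \<in> (\<Union>m. K m)"
    then obtain m where m: "x \<in> K m" by blast
    have "\<lfloor>real n * (p x \<bullet> b)\<rfloor> = c b" if "b \<in> Basis" for b
    proof -
      have "0 < 1 / real (Suc m)" by simp
      moreover have "real_of_int (c b) \<le> real n * (p x \<bullet> b)" "real n * (p x \<bullet> b) \<le> real_of_int (c b) + 1 - 1 / real (Suc m)"
        using m that unfolding K_def by auto
      ultimately show ?thesis by linarith
    qed
    then show "x \<in> {x \<in> E. cell n (p x) = c}" using m True unfolding cell_def K_def by auto
  qed
  ultimately show ?thesis unfolding sigma_compact_def by blast
qed

section \<open>Multiplicity as a counting measure, and its integral\<close>

lemma mult_eq_emeasure_count: "mult f D y = emeasure (count_space UNIV) (D \<inter> f -` {y})"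
  by (simp add: mult_def emeasure_count_space)

lemma mult_domain_mono: "D \<subseteq> D' \<Longrightarrow> mult f D y \<le> mult f D' y"
  unfolding mult_eq_emeasure_count by (intro emeasure_mono) auto

lemma mult_UN_le:
  "finite I \<Longrightarrow> mult f (\<Union>i\<in>I. D i) y \<le> (\<Sum>i\<in>I. mult f (D i) y)"
  unfolding mult_eq_emeasure_count
  by (rule order_trans[OF _ emeasure_subadditive_finite]) (auto intro!: emeasure_mono)

lemma sum_mult_le:
  assumes "finite I" "disjoint_family_on D I" "\<And>i. i \<in> I \<Longrightarrow> D i \<subseteq> E"
  shows "(\<Sum>i\<in>I. mult f (D i) y) \<le> mult f E y"
proof -
  have "(\<Sum>i\<in>I. mult f (D i) y) = emeasure (count_space UNIV) (\<Union>i\<in>I. D i \<inter> f -` {y})"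
    unfolding mult_eq_emeasure_count using assms
    by (intro sum_emeasure) (auto simp: disjoint_family_on_def)
  also have "\<dots> \<le> mult f E y" unfolding mult_eq_emeasure_count using assms by (intro emeasure_mono) auto
  finally show ?thesis .
qed

lemma indicator_image_le_mult: "indicator (f ` D) y \<le> mult f D y"
proof (cases "y \<in> f ` D")
  case True
  then obtain x where x: "x \<in> D" "y = f x" by blast
  have "1 = emeasure (count_space UNIV) {x}" by simp
  also have "\<dots> \<le> mult f D y" unfolding mult_eq_emeasure_count using x by (intro emeasure_mono) auto
  finally show ?thesis using True by simp
qed simp

lemma mult_eq_0: "y \<notin> f ` D \<Longrightarrow> mult f D y = 0"
proof -
  assume "y \<notin> f ` D"
  then have "D \<inter> f -` {y} = {}" by auto
  then show ?thesis by (simp add: mult_eq_emeasure_count)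
qed

lemma mult_cong: "(\<And>x. x \<in> D \<Longrightarrow> f x = g x) \<Longrightarrow> mult f D y = mult g D y"
proof -
  assume "\<And>x. x \<in> D \<Longrightarrow> f x = g x"
  then have "D \<inter> f -` {y} = D \<inter> g -` {y}" by auto
  then show ?thesis by (simp add: mult_eq_emeasure_count)
qed

lemma mult_Int_vimage: "mult f (D \<inter> f -` B) y = mult f D y * indicator B y"
proof (cases "y \<in> B")
  case True
  then have "D \<inter> f -` B \<inter> f -` {y} = D \<inter> f -` {y}" by auto
  then show ?thesis using True by (simp add: mult_eq_emeasure_count)
next
  case False
  then have "D \<inter> f -` B \<inter> f -` {y} = {}" by auto
  then show ?thesis using False by (simp add: mult_eq_emeasure_count)
qed

lemma mult_reparam:
  assumes "bij_betw \<phi> E D" "\<And>x. x \<in> E \<Longrightarrow> g x = f (\<phi> x)"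
  shows "mult g E y = mult f D y"
proof -
  have "bij_betw \<phi> (E \<inter> g -` {y}) (D \<inter> f -` {y})"
    using assms unfolding bij_betw_def inj_on_def by (auto simp: image_iff)
  then show ?thesis unfolding mult_def by (simp add: bij_betw_finite bij_betw_same_card)
qed

lemma vol_cong: "(\<And>x. x \<in> D \<Longrightarrow> f x = g x) \<Longrightarrow> vol k f D = vol k g D"
  unfolding vol_def by (intro nn_integral_cong mult_cong)

lemma vol_reparam: "bij_betw \<phi> E D \<Longrightarrow> (\<And>x. x \<in> E \<Longrightarrow> g x = f (\<phi> x)) \<Longrightarrow> vol k g E = vol k f D"
  unfolding vol_def by (intro nn_integral_cong mult_reparam)

lemma vol_mono: "D \<subseteq> D' \<Longrightarrow> vol k f D \<le> vol k f D'"
  unfolding vol_def by (intro nn_integral_mono mult_domain_mono)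

text \<open>Finitely many preimages of \<open>y\<close> end up in distinct pieces once
  \<open>n\<close> is large, so at least as many piece images contain \<open>y\<close>. The pieces
  may overlap: each preimage merely selects one that contains it.\<close>

lemma mult_le_liminf:
  fixes Q :: "nat \<Rightarrow> 'i \<Rightarrow> 'b set"
  assumes fin: "\<And>n. finite (I n)" and cov: "\<And>n. E \<subseteq> (\<Union>i\<in>I n. Q n i)"
    and sep: "\<And>x x'. x \<in> E \<Longrightarrow> x' \<in> E \<Longrightarrow> x \<noteq> x' \<Longrightarrow> eventually (\<lambda>n. \<forall>i\<in>I n. \<not> (x \<in> Q n i \<and> x' \<in> Q n i)) sequentially"
  shows "mult h E y \<le> liminf (\<lambda>n. \<Sum>i\<in>I n. indicator (h ` Q n i) y)"
proof -
  have *: "of_nat (card F) \<le> liminf (\<lambda>n. \<Sum>i\<in>I n. indicator (h ` Q n i) y :: ennreal)" if F: "finite F" "F \<subseteq> E \<inter> h -` {y}" for F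
  proof (rule Liminf_bounded)
    have "eventually (\<lambda>n. \<forall>x\<in>F. \<forall>x'\<in>F. x \<noteq> x' \<longrightarrow> (\<forall>i\<in>I n. \<not> (x \<in> Q n i \<and> x' \<in> Q n i))) sequentially"
    proof (intro eventually_ball_finite ballI F)
      fix x x' assume "x \<in> F" "x' \<in> F"
      then show "eventually (\<lambda>n. x \<noteq> x' \<longrightarrow> (\<forall>i\<in>I n. \<not> (x \<in> Q n i \<and> x' \<in> Q n i))) sequentially"
        using F sep[of x x'] by (cases "x = x'") (auto simp: subset_iff)
    qed
    then show "eventually (\<lambda>n. of_nat (card F) \<le> (\<Sum>i\<in>I n. indicator (h ` Q n i) y :: ennreal)) sequentially"
    proof (rule eventually_mono)
      fix n assume n: "\<forall>x\<in>F. \<forall>x'\<in>F. x \<noteq> x' \<longrightarrow> (\<forall>i\<in>I n. \<not> (x \<in> Q n i \<and> x' \<in> Q n i))"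
      have "\<forall>x\<in>F. \<exists>i. i \<in> I n \<and> x \<in> Q n i" using F cov[of n] by blast
      then obtain i where i: "\<And>x. x \<in> F \<Longrightarrow> i x \<in> I n \<and> x \<in> Q n (i x)" by metis
      have "inj_on i F" using n i by (intro inj_onI) metis
      then have "card F = card (i ` F)" by (simp add: card_image)
      also have "\<dots> \<le> card {j \<in> I n. y \<in> h ` Q n j}"
      proof (rule card_mono)
        show "finite {j \<in> I n. y \<in> h ` Q n j}" using fin by simp
        show "i ` F \<subseteq> {j \<in> I n. y \<in> h ` Q n j}"
        proof
          fix j assume "j \<in> i ` F"
          then obtain x where x: "x \<in> F" "j = i x" by blast
          then have "h x = y" using F by blast
          then show "j \<in> {j \<in> I n. y \<in> h ` Q n j}" using i[OF x(1)] x by blast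
        qed
      qed
      finally have "(of_nat (card F) :: ennreal) \<le> of_nat (card {j \<in> I n. y \<in> h ` Q n j})" by simp
      also have "\<dots> = (\<Sum>j\<in>I n. indicator (h ` Q n j) y)"
      proof -
        have "(\<Sum>j\<in>I n. indicator (h ` Q n j) y :: ennreal) = (\<Sum>j\<in>{j \<in> I n. y \<in> h ` Q n j}. 1)"
          by (rule sum.mono_neutral_cong_right) (use fin in \<open>auto simp del: image_iff\<close>)
        then show ?thesis by simp
      qed
      finally show "of_nat (card F) \<le> (\<Sum>i\<in>I n. indicator (h ` Q n i) y :: ennreal)" .
    qed
  qed
  show ?thesis
  proof (cases "finite (E \<inter> h -` {y})")
    case True then show ?thesis using *[OF True] by (simp add: mult_def)
  next
    case False
    have "of_nat m \<le> liminf (\<lambda>n. \<Sum>i\<in>I n. indicator (h ` Q n i) y :: ennreal)" for m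
    proof -
      obtain F where "finite F" "card F = m" "F \<subseteq> E \<inter> h -` {y}" using infinite_arbitrarily_large[OF False, of m] by blast
      then show ?thesis using *[of F] by simp
    qed
    then have "liminf (\<lambda>n. \<Sum>i\<in>I n. indicator (h ` Q n i) y :: ennreal) = top"
      using ennreal_Ex_less_of_nat top.not_eq_extremum leD by blast
    then show ?thesis by simp
  qed
qed

text \<open>Only measures of images enter the bound. Sigma-compactness of the pieces makes these
  images Borel, so that Fatou's lemma applies to the sums of indicators.\<close>

lemma vol_le_of_covers:
  fixes h :: "'b::topological_space \<Rightarrow> 'a::metric_space" and Q :: "nat \<Rightarrow> 'i \<Rightarrow> 'b set"
  assumes k: "0 < k" and h: "continuous_on E h"
    and fin: "\<And>n. finite (I n)" and cov: "\<And>n. E \<subseteq> (\<Union>i\<in>I n. Q n i)"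
    and sub: "\<And>n i. i \<in> I n \<Longrightarrow> Q n i \<subseteq> E \<and> sigma_compact (Q n i)"
    and sep: "\<And>x x'. x \<in> E \<Longrightarrow> x' \<in> E \<Longrightarrow> x \<noteq> x' \<Longrightarrow> eventually (\<lambda>n. \<forall>i\<in>I n. \<not> (x \<in> Q n i \<and> x' \<in> Q n i)) sequentially"
    and bound: "\<And>n. (\<Sum>i\<in>I n. hausdorff_outer k (h ` Q n i)) \<le> V"
  shows "vol k h E \<le> V"
proof -
  have b: "h ` Q n i \<in> sets borel" if "i \<in> I n" for n i
    using sub[OF that] h by (auto intro!: sigma_compact_image_borel intro: continuous_on_subset)
  have "vol k h E \<le> (\<integral>\<^sup>+ y. liminf (\<lambda>n. \<Sum>i\<in>I n. indicator (h ` Q n i) y) \<partial>hausdorff_measure k)"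
    unfolding vol_def by (intro nn_integral_mono mult_le_liminf fin cov sep)
  also have "\<dots> \<le> liminf (\<lambda>n. \<integral>\<^sup>+ y. (\<Sum>i\<in>I n. indicator (h ` Q n i) y) \<partial>hausdorff_measure k)"
    by (intro nn_integral_liminf borel_measurable_sum) (auto intro!: borel_measurable_indicator b)
  also have "\<dots> = liminf (\<lambda>n. \<Sum>i\<in>I n. hausdorff_outer k (h ` Q n i))"
  proof (intro arg_cong[where f = liminf] ext)
    fix n
    have "(\<integral>\<^sup>+ y. (\<Sum>i\<in>I n. indicator (h ` Q n i) y) \<partial>hausdorff_measure k) = (\<Sum>i\<in>I n. emeasure (hausdorff_measure k) (h ` Q n i))"
      by (subst nn_integral_sum) (auto intro!: borel_measurable_indicator b sum.cong nn_integral_indicator)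
    then show "(\<integral>\<^sup>+ y. (\<Sum>i\<in>I n. indicator (h ` Q n i) y) \<partial>hausdorff_measure k) = (\<Sum>i\<in>I n. hausdorff_outer k (h ` Q n i))"
      by (simp add: emeasure_hausdorff_measure k b)
  qed
  also have "\<dots> \<le> V" by (rule Liminf_le) (auto simp: bound)
  finally show ?thesis .
qed

text \<open>Reverse direction of the covering bound: over disjoint pieces, the number of images that
  contain \<open>y\<close> never exceeds the multiplicity.\<close>

lemma sum_hausdorff_outer_le_vol:
  fixes h :: "'b::topological_space \<Rightarrow> 'a::metric_space"
  assumes k: "0 < k" and h: "continuous_on E h" and fin: "finite I"
    and sub: "\<And>i. i \<in> I \<Longrightarrow> Q i \<subseteq> E \<and> sigma_compact (Q i)" and disj: "disjoint_family_on Q I"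
  shows "(\<Sum>i\<in>I. hausdorff_outer k (h ` Q i)) \<le> vol k h E"
proof -
  have b: "h ` Q i \<in> sets borel" if "i \<in> I" for i
    using sub[OF that] h by (auto intro!: sigma_compact_image_borel intro: continuous_on_subset)
  have "(\<Sum>i\<in>I. hausdorff_outer k (h ` Q i)) = (\<integral>\<^sup>+ y. (\<Sum>i\<in>I. indicator (h ` Q i) y) \<partial>hausdorff_measure k)"
    by (subst nn_integral_sum) (auto intro!: borel_measurable_indicator b sum.cong simp: emeasure_hausdorff_measure k b nn_integral_indicator)
  also have "\<dots> \<le> vol k h E" unfolding vol_def
  proof (intro nn_integral_mono)
    fix y
    have "(\<Sum>i\<in>I. indicator (h ` Q i) y) \<le> (\<Sum>i\<in>I. mult h (Q i) y)"
      by (intro sum_mono indicator_image_le_mult)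
    also have "\<dots> \<le> mult h E y" by (intro sum_mult_le fin disj) (use sub in auto)
    finally show "(\<Sum>i\<in>I. indicator (h ` Q i) y) \<le> mult h E y" .
  qed
  finally show ?thesis .
qed

lemma hausdorff_outer_image_le_vol:
  fixes h :: "'b::topological_space \<Rightarrow> 'a::metric_space"
  assumes "0 < k" "compact E" "continuous_on E h"
  shows "hausdorff_outer k (h ` E) \<le> vol k h E"
  using sum_hausdorff_outer_le_vol[of k E h "{()}" "\<lambda>_. E"] assms
  by (simp add: compact_imp_sigma_compact disjoint_family_on_def)

lemma cells_separate:
  assumes "x \<noteq> x'"
  shows "eventually (\<lambda>n. \<forall>c\<in>I n. \<not> (x \<in> {x \<in> E. cell n x = c} \<and> x' \<in> {x \<in> E. cell n x = c})) sequentially"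
  by (rule eventually_mono[OF cell_separates[OF assms]]) auto

text \<open>For grid partitions the sums of indicators lie below the multiplicity and their liminf
  lies above it, so \<open>mult h E\<close> is a liminf of Borel functions.\<close>

lemma borel_measurable_mult:
  fixes h :: "'b::euclidean_space \<Rightarrow> 'a::metric_space"
  assumes E: "compact E" and h: "continuous_on E h"
  shows "mult h E \<in> borel_measurable borel"
proof -
  let ?Q = "\<lambda>n c. {x \<in> E. cell n x = c}"
  let ?I = "\<lambda>n. cell n ` E"
  have fin: "finite (?I n)" for n using E by (intro finite_cell_image compact_imp_bounded)
  have "mult h E y = liminf (\<lambda>n. \<Sum>i\<in>?I n. indicator (h ` ?Q n i) y)" for y
  proof (rule antisym)
    show "mult h E y \<le> liminf (\<lambda>n. \<Sum>i\<in>?I n. indicator (h ` ?Q n i) y)"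
      by (rule mult_le_liminf[OF fin _ cells_separate]) auto
    have "(\<Sum>i\<in>?I n. indicator (h ` ?Q n i) y) \<le> mult h E y" for n
      by (rule order_trans[OF sum_mono[OF indicator_image_le_mult] sum_mult_le]) (auto simp: fin disjoint_family_on_def)
    then show "liminf (\<lambda>n. \<Sum>i\<in>?I n. indicator (h ` ?Q n i) y) \<le> mult h E y"
      by (intro Liminf_le) auto
  qed
  then have "mult h E = (\<lambda>y. liminf (\<lambda>n. \<Sum>i\<in>?I n. indicator (h ` ?Q n i) y))" by auto
  moreover have "h ` ?Q n i \<in> sets borel" for n i
    by (rule sigma_compact_image_borel)
      (use sigma_compact_cell[OF E continuous_on_id, of n i] h in \<open>auto intro: continuous_on_subset\<close>)
  ultimately show ?thesis by (auto intro!: borel_measurable_liminf borel_measurable_sum borel_measurable_indicator)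
qed

lemma borel_measurable_mult_hausdorff:
  fixes h :: "'b::euclidean_space \<Rightarrow> 'a::metric_space"
  assumes "compact E" "continuous_on E h"
  shows "mult h E \<in> borel_measurable (hausdorff_measure k)"
  using borel_measurable_mult[OF assms] by (simp cong: measurable_cong_sets)

lemma vol_UN_le:
  fixes h :: "'b::euclidean_space \<Rightarrow> 'a::metric_space"
  assumes "finite I" "\<And>i. i \<in> I \<Longrightarrow> compact (D i)" "\<And>i. i \<in> I \<Longrightarrow> continuous_on (D i) h"
  shows "vol k h (\<Union>i\<in>I. D i) \<le> (\<Sum>i\<in>I. vol k h (D i))"
proof -
  have "vol k h (\<Union>i\<in>I. D i) \<le> (\<integral>\<^sup>+ y. (\<Sum>i\<in>I. mult h (D i) y) \<partial>hausdorff_measure k)"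
    unfolding vol_def by (intro nn_integral_mono mult_UN_le assms)
  also have "\<dots> = (\<Sum>i\<in>I. vol k h (D i))"
    unfolding vol_def by (intro nn_integral_sum borel_measurable_mult_hausdorff assms)
  finally show ?thesis .
qed

lemma vol_Un_le:
  fixes h :: "'b::euclidean_space \<Rightarrow> 'a::metric_space"
  assumes "compact D1" "compact D2" "continuous_on D1 h" "continuous_on D2 h"
  shows "vol k h (D1 \<union> D2) \<le> vol k h D1 + vol k h D2"
  using vol_UN_le[of "{True,False}" "\<lambda>b. if b then D1 else D2" h k] assms by (simp add: Un_commute)

lemma sum_vol_le:
  fixes h :: "'b::euclidean_space \<Rightarrow> 'a::metric_space"
  assumes "finite I" "\<And>i. i \<in> I \<Longrightarrow> compact (D i)" "\<And>i. i \<in> I \<Longrightarrow> D i \<subseteq> E"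
    "disjoint_family_on D I" "continuous_on E h"
  shows "(\<Sum>i\<in>I. vol k h (D i)) \<le> vol k h E"
proof -
  have "(\<Sum>i\<in>I. vol k h (D i)) = (\<integral>\<^sup>+ y. (\<Sum>i\<in>I. mult h (D i) y) \<partial>hausdorff_measure k)"
    unfolding vol_def using assms
    by (intro nn_integral_sum[symmetric] borel_measurable_mult_hausdorff) (auto intro: continuous_on_subset)
  also have "\<dots> \<le> vol k h E" unfolding vol_def using assms by (intro nn_integral_mono sum_mult_le) auto
  finally show ?thesis .
qed

text \<open>Push-forward of the area of \<open>f\<close>: a Borel set receives the area of
  \<open>f\<close> over its preimage. It supplies additivity over balls of the target and continuity
  from above.\<close>

definition area_measure :: "('b \<Rightarrow> 'a::metric_space) \<Rightarrow> 'b set \<Rightarrow> 'a measure" where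
  "area_measure f D = density (hausdorff_measure 2) (mult f D)"

lemma sets_area_measure [simp, measurable_cong]: "sets (area_measure f D) = sets borel"
  by (simp add: area_measure_def)

lemma space_area_measure [simp]: "space (area_measure f D) = UNIV"
  by (simp add: area_measure_def)

lemma emeasure_area_measure:
  fixes f :: "'b::euclidean_space \<Rightarrow> 'a::metric_space"
  assumes "compact D" "continuous_on D f" "B \<in> sets borel"
  shows "emeasure (area_measure f D) B = vol 2 f (D \<inter> f -` B)"
  unfolding area_measure_def vol_def mult_Int_vimage using assms
  by (subst emeasure_density) (auto simp: borel_measurable_mult_hausdorff)

text \<open>The hypothesis ignores multiplicities but holds for every piece \<open>P\<close>.
  Applied to the cells of ever finer grids, the left sides control \<open>vol k h D\<close>, and the
  right sides sum to at most the area of \<open>f\<close>.\<close>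

lemma vol_le_vol_of_pieces:
  fixes f :: "'b::euclidean_space \<Rightarrow> 'c::metric_space" and h :: "'b \<Rightarrow> 'a::metric_space"
  assumes "0 < k" "compact D" "continuous_on D f" "continuous_on D h"
    and bound: "\<And>P. P \<subseteq> D \<Longrightarrow> hausdorff_outer k (h ` P) \<le> q * hausdorff_outer 2 (f ` P)"
  shows "vol k h D \<le> q * vol 2 f D"
proof -
  let ?Q = "\<lambda>n c. {x \<in> D. cell n x = c}"
  let ?I = "\<lambda>n. cell n ` D"
  have fin: "finite (?I n)" for n using assms by (intro finite_cell_image compact_imp_bounded)
  have sc: "sigma_compact (?Q n i)" for n i
    using sigma_compact_cell[OF assms(2) continuous_on_id, of n i] by simp
  show ?thesis
  proof (rule vol_le_of_covers[where I = ?I and Q = ?Q])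
    fix n
    have "(\<Sum>i\<in>?I n. hausdorff_outer k (h ` ?Q n i)) \<le> (\<Sum>i\<in>?I n. q * hausdorff_outer 2 (f ` ?Q n i))"
      by (intro sum_mono bound) auto
    also have "\<dots> = q * (\<Sum>i\<in>?I n. hausdorff_outer 2 (f ` ?Q n i))" by (simp add: sum_distrib_left)
    also have "\<dots> \<le> q * vol 2 f D"
      by (intro mult_left_mono sum_hausdorff_outer_le_vol fin assms) (auto simp: sc disjoint_family_on_def)
    finally show "(\<Sum>i\<in>?I n. hausdorff_outer k (h ` ?Q n i)) \<le> q * vol 2 f D" .
  next
    show "D \<subseteq> (\<Union>i\<in>?I n. ?Q n i)" for n by auto
  qed (use assms fin sc in \<open>auto simp only: intro: cells_separate\<close>)
qed

text \<open>The pair of \<open>p\<close> and \<open>s\<close> maps \<open>E\<close> injectively into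
  \<open>D\<close> times the unit interval, and the hypothesis bounds product pieces by height times
  area. With \<open>D\<close> cut by the grid and the interval cut into \<open>Suc n\<close> slices,
  the factors q / (n + 1) add up to \<open>q\<close> over each cell.\<close>

lemma vol_le_vol_of_cylinders:
  fixes f :: "'b::euclidean_space \<Rightarrow> 'a::metric_space" and h :: "'c::euclidean_space \<Rightarrow> 'a"
  assumes k: "0 < k" and D: "compact D" "continuous_on D f" and E: "compact E" "continuous_on E h"
    and p: "continuous_on E p" "p ` E \<subseteq> D" and s: "continuous_on E s" "\<And>x. x \<in> E \<Longrightarrow> 0 \<le> s x \<and> s x \<le> (1::real)"
    and inj: "\<And>x y. x \<in> E \<Longrightarrow> y \<in> E \<Longrightarrow> p x = p y \<Longrightarrow> s x = s y \<Longrightarrow> x = y" and q: "0 \<le> q"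
    and bound: "\<And>P a b. P \<subseteq> D \<Longrightarrow> 0 \<le> a \<Longrightarrow> a < b \<Longrightarrow> b \<le> 1 \<Longrightarrow>
      hausdorff_outer k (h ` {x \<in> E. p x \<in> P \<and> a \<le> s x \<and> s x \<le> b}) \<le> ennreal (q * (b - a)) * hausdorff_outer 2 (f ` P)"
  shows "vol k h E \<le> ennreal q * vol 2 f D"
proof -
  let ?P = "\<lambda>n c. {x \<in> D. cell n x = c}"
  let ?J = "\<lambda>n. cell n ` D"
  \<comment> \<open>The slices are closed and share end points, which the covering bound permits;
    closedness keeps them compact before they are cut by half-open cells.\<close>
  define Q where "Q n = (\<lambda>(c, j). {x \<in> {x \<in> E. real j / real (Suc n) \<le> s x \<and> s x \<le> real (Suc j) / real (Suc n)}. cell n (p x) = c})" for n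
  define I where "I n = ?J n \<times> {..<Suc n}" for n
  have finJ: "finite (?J n)" for n using D by (intro finite_cell_image compact_imp_bounded)
  have scP: "sigma_compact (?P n i)" for n i
    using sigma_compact_cell[OF D(1) continuous_on_id, of n i] by simp
  have cE: "closed E" using E by (simp add: compact_imp_closed)
  have cpt: "compact {x \<in> E. a \<le> s x \<and> s x \<le> b}" for a b
  proof -
    have "closed ({x \<in> E. a \<le> s x} \<inter> {x \<in> E. s x \<le> b})"
      by (intro closed_Int continuous_on_closed_Collect_le continuous_intros cE s)
    then have "compact (E \<inter> ({x \<in> E. a \<le> s x} \<inter> {x \<in> E. s x \<le> b}))" using E by (intro compact_Int_closed)
    moreover have "E \<inter> ({x \<in> E. a \<le> s x} \<inter> {x \<in> E. s x \<le> b}) = {x \<in> E. a \<le> s x \<and> s x \<le> b}" by auto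
    ultimately show ?thesis by simp
  qed
  show ?thesis
  proof (rule vol_le_of_covers[where I = I and Q = Q])
    show "finite (I n)" for n using finJ by (simp add: I_def)
    show "E \<subseteq> (\<Union>i\<in>I n. Q n i)" for n
    proof
      fix x assume x: "x \<in> E"
      obtain j where j: "j < Suc n" "real j / real (Suc n) \<le> s x" "s x \<le> real (Suc j) / real (Suc n)"
        using unit_interval_cell[of "s x" n] s(2)[OF x] by blast
      then have "x \<in> Q n (cell n (p x), j)" using x by (simp add: Q_def)
      moreover have "(cell n (p x), j) \<in> I n" using x p j by (auto simp: I_def)
      ultimately show "x \<in> (\<Union>i\<in>I n. Q n i)" by blast
    qed
    show "Q n i \<subseteq> E \<and> sigma_compact (Q n i)" if "i \<in> I n" for n i
    proof -
      obtain c j where i: "i = (c, j)" by fastforce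
      show ?thesis unfolding Q_def i prod.case
        by (intro conjI sigma_compact_cell cpt continuous_on_subset[OF p(1)]) auto
    qed
    show "eventually (\<lambda>n. \<forall>i\<in>I n. \<not> (x \<in> Q n i \<and> y \<in> Q n i)) sequentially" if xy: "x \<in> E" "y \<in> E" "x \<noteq> y" for x y
    proof (cases "p x = p y")
      case False
      show ?thesis by (rule eventually_mono[OF cell_separates[OF False]]) (auto simp: Q_def)
    next
      case True
      then have "0 < \<bar>s x - s y\<bar>" using inj xy by force
      then have "eventually (\<lambda>n. inverse (real (Suc n)) < \<bar>s x - s y\<bar>) sequentially"
        by (intro order_tendstoD(2)[OF LIMSEQ_inverse_real_of_nat])
      then show ?thesis
      proof (rule eventually_mono, clarify)
        fix n c j assume n: "inverse (real (Suc n)) < \<bar>s x - s y\<bar>" and "x \<in> Q n (c,j)" "y \<in> Q n (c,j)"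
        then have "real j / real (Suc n) \<le> s x" "s x \<le> real (Suc j) / real (Suc n)" "real j / real (Suc n) \<le> s y" "s y \<le> real (Suc j) / real (Suc n)"
          by (auto simp: Q_def)
        moreover have "real (Suc j) / real (Suc n) = real j / real (Suc n) + inverse (real (Suc n))" by (simp add: field_simps)
        ultimately show False using n by linarith
      qed
    qed
    fix n
    have "(\<Sum>i\<in>I n. hausdorff_outer k (h ` Q n i)) = (\<Sum>c\<in>?J n. \<Sum>j<Suc n. hausdorff_outer k (h ` Q n (c, j)))"
      unfolding I_def by (simp add: sum.cartesian_product del: sum.lessThan_Suc)
    also have "\<dots> \<le> (\<Sum>c\<in>?J n. \<Sum>j<Suc n. ennreal (q * (1 / real (Suc n))) * hausdorff_outer 2 (f ` ?P n c))"
    proof (intro sum_mono)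
      fix c j assume j: "j \<in> {..<Suc n}"
      have "h ` Q n (c, j) \<subseteq> h ` {x \<in> E. p x \<in> ?P n c \<and> real j / real (Suc n) \<le> s x \<and> s x \<le> real (Suc j) / real (Suc n)}"
        using p by (auto simp: Q_def)
      then have "hausdorff_outer k (h ` Q n (c, j)) \<le> hausdorff_outer k (h ` {x \<in> E. p x \<in> ?P n c \<and> real j / real (Suc n) \<le> s x \<and> s x \<le> real (Suc j) / real (Suc n)})"
        by (rule hausdorff_outer_mono)
      also have "\<dots> \<le> ennreal (q * (real (Suc j) / real (Suc n) - real j / real (Suc n))) * hausdorff_outer 2 (f ` ?P n c)"
        by (rule bound) (use j in \<open>auto simp: field_simps\<close>)
      also have "real (Suc j) / real (Suc n) - real j / real (Suc n) = 1 / real (Suc n)" by (simp add: field_simps)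
      finally show "hausdorff_outer k (h ` Q n (c, j)) \<le> ennreal (q * (1 / real (Suc n))) * hausdorff_outer 2 (f ` ?P n c)" .
    qed
    also have "\<dots> = (\<Sum>c\<in>?J n. ennreal q * hausdorff_outer 2 (f ` ?P n c))"
    proof (intro sum.cong refl)
      fix c
      have "(\<Sum>j<Suc n. ennreal (q * (1 / real (Suc n))) * hausdorff_outer 2 (f ` ?P n c)) = of_nat (Suc n) * (ennreal (q * (1 / real (Suc n))) * hausdorff_outer 2 (f ` ?P n c))"
        by (simp only: sum_constant card_lessThan)
      also have "\<dots> = ennreal (real (Suc n) * (q * (1 / real (Suc n)))) * hausdorff_outer 2 (f ` ?P n c)"
        by (subst ennreal_mult) (use q in \<open>auto simp: mult.assoc ennreal_of_nat_eq_real_of_nat simp del: of_nat_Suc\<close>)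
      also have "real (Suc n) * (q * (1 / real (Suc n))) = q" by simp
      finally show "(\<Sum>j<Suc n. ennreal (q * (1 / real (Suc n))) * hausdorff_outer 2 (f ` ?P n c)) = ennreal q * hausdorff_outer 2 (f ` ?P n c)" .
    qed
    also have "\<dots> = ennreal q * (\<Sum>c\<in>?J n. hausdorff_outer 2 (f ` ?P n c))" by (simp add: sum_distrib_left)
    also have "\<dots> \<le> ennreal q * vol 2 f D"
      by (intro mult_left_mono sum_hausdorff_outer_le_vol finJ D) (auto simp: scP disjoint_family_on_def)
    finally show "(\<Sum>i\<in>I n. hausdorff_outer k (h ` Q n i)) \<le> ennreal q * vol 2 f D" .
  qed (use assms in auto)
qed

section \<open>Geodesics in CAT(0) spaces\<close>

text \<open>\<open>p\<close> and \<open>q\<close> are placed on the first axis; \<open>x\<close> is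
  the first coordinate of \<open>r\<close> by the law of cosines, and the triangle inequalities give
  |x| \<le> c, so that the second coordinate is real.\<close>

lemma comparison_triangle_exists:
  fixes a b c :: real
  assumes "0 \<le> a" "0 \<le> b" "0 \<le> c" "a \<le> b + c" "b \<le> a + c" "c \<le> a + b"
  obtains p q r :: "real^2" where "dist p q = a" "dist q r = b" "dist r p = c"
proof -
  have nrm: "norm (vector [x, y] :: real^2) = sqrt (x\<^sup>2 + y\<^sup>2)" for x y :: real
    by (simp add: norm_eq_sqrt_inner inner_vec_def sum_2 power2_eq_square)
  have diff: "vector [x, y] - (vector [x', y'] :: real^2) = vector [x - x', y - y']" for x y x' y' :: real
    by (simp add: vec_eq_iff forall_2)
  show ?thesis
  proof (cases "a = 0")
    case True
    then have "b = c" using assms by auto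
    then show ?thesis using True assms
      by (intro that[of "vector [0,0]" "vector [0,0]" "vector [c,0]"]) (auto simp: dist_norm diff nrm)
  next
    case False
    define x where "x = (a\<^sup>2 + c\<^sup>2 - b\<^sup>2) / (2 * a)"
    have ax: "2 * a * x = a\<^sup>2 + c\<^sup>2 - b\<^sup>2" using False by (simp add: x_def)
    have "b\<^sup>2 \<le> (a + c)\<^sup>2" "(a - c)\<^sup>2 \<le> b\<^sup>2"
      using assms by (auto intro!: power_mono simp: abs_le_square_iff[symmetric])
    then have le: "2 * a * x \<le> 2 * a * c" "2 * a * (-c) \<le> 2 * a * x"
      unfolding ax by (simp_all add: power2_eq_square algebra_simps)
    have "0 < 2 * a" using False assms by simp
    then have "x \<le> c" "- c \<le> x" using mult_left_le_imp_le[OF le(1)] mult_left_le_imp_le[OF le(2)] by auto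
    then have "\<bar>x\<bar> \<le> \<bar>c\<bar>" by linarith
    then have xc: "x\<^sup>2 \<le> c\<^sup>2" by (simp only: abs_le_square_iff)
    have "(a - x)\<^sup>2 + (c\<^sup>2 - x\<^sup>2) = b\<^sup>2" using ax by (simp add: power2_eq_square algebra_simps)
    then have "norm (vector [a - x, - sqrt (c\<^sup>2 - x\<^sup>2)] :: real^2) = b"
      using xc assms by (simp add: nrm)
    moreover have "norm (vector [x, sqrt (c\<^sup>2 - x\<^sup>2)] :: real^2) = c" using xc assms by (simp add: nrm)
    ultimately show ?thesis using assms
      by (intro that[of "vector [0,0]" "vector [a,0]" "vector [x, sqrt (c\<^sup>2 - x\<^sup>2)]"]) (auto simp: dist_norm diff nrm)
  qed
qed

section \<open>Convexity of the distance along geodesics\<close>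

lemma geodesic_seg_reverse: "geodesic_seg g a b \<Longrightarrow> geodesic_seg (\<lambda>s. g (1 - s)) b a"
  unfolding geodesic_seg_def by (auto simp: dist_commute abs_minus_commute)

text \<open>A chosen geodesic. Uniqueness is not developed; reversed paths are handled by stating
  \<open>geodesic_fan_convex\<close> for arbitrary geodesics.\<close>

definition geod :: "'a::metric_space \<Rightarrow> 'a \<Rightarrow> real \<Rightarrow> 'a" where
  "geod x y = (SOME g. geodesic_seg g x y)"

locale cat0_space =
  fixes dummy :: "'a::metric_space itself"
  assumes cat0: "CAT0 TYPE('a)"
begin

lemma geodesic_seg_geod: "geodesic_seg (geod x y) (x::'a) y"
  unfolding geod_def using cat0 unfolding CAT0_def by (metis someI_ex)

lemma geod_0 [simp]: "geod x y 0 = (x::'a)" and geod_1 [simp]: "geod x y 1 = y"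
  using geodesic_seg_geod[of x y] unfolding geodesic_seg_def by auto

lemma dist_geod: "s \<in> {0..1} \<Longrightarrow> t \<in> {0..1} \<Longrightarrow> dist (geod x y s) (geod x (y::'a) t) = \<bar>s - t\<bar> * dist x y"
  using geodesic_seg_geod[of x y] unfolding geodesic_seg_def by auto

lemma geod_refl [simp]: "t \<in> {0..1} \<Longrightarrow> geod x x t = (x::'a)"
  using dist_geod[of t 0 x x] by simp

text \<open>Comparison in a triangle with apex \<open>p\<close>, between points of equal parameter
  on the two sides leaving \<open>p\<close>. The third side in \<open>CAT0\<close> runs back to
  \<open>p\<close>, hence \<open>h\<close> enters reversed, with parameter 1 - t.\<close>

lemma geodesic_fan_convex:
  fixes x y p :: 'a
  assumes g: "geodesic_seg g p x" and h: "geodesic_seg h p y" and t: "t \<in> {0..1}"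
  shows "dist (g t) (h t) \<le> t * dist x y"
proof -
  obtain p' x' y' :: "real^2" where d: "dist p' x' = dist p x" "dist x' y' = dist x y" "dist y' p' = dist y p"
    using comparison_triangle_exists[of "dist p x" "dist x y" "dist y p"]
    by (metis dist_commute dist_triangle zero_le_dist)
  have "geodesic_seg g p x \<and> geodesic_seg (geod x y) x y \<and> geodesic_seg (\<lambda>s. h (1 - s)) y p \<and>
       dist p' x' = dist p x \<and> dist x' y' = dist x y \<and> dist y' p' = dist y p"
    using g h d geodesic_seg_geod geodesic_seg_reverse by blast
  from cat0[unfolded CAT0_def, THEN conjunct2, THEN conjunct2, rule_format, OF this, unfolded Let_def, rule_format, of 0 2 t "1 - t"]
  have "dist (g t) (h t) \<le> dist ((1 - t) *\<^sub>R p' + t *\<^sub>R x') (t *\<^sub>R y' + (1 - t) *\<^sub>R p')" using t by simp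
  also have "\<dots> = norm (t *\<^sub>R (x' - y'))" by (simp add: dist_norm algebra_simps)
  also have "\<dots> = t * dist x y" using t d by (simp add: dist_norm)
  finally show ?thesis .
qed

text \<open>Two fans are joined along the diagonal from \<open>p\<close> to \<open>y\<close>: the
  first has apex \<open>p\<close>, the second, after reversal, apex \<open>y\<close>.\<close>

lemma geod_convex:
  fixes x y p q :: 'a
  assumes t: "t \<in> {0..1}"
  shows "dist (geod p x t) (geod q y t) \<le> (1 - t) * dist p q + t * dist x y"
proof -
  have "dist (geod p x t) (geod p y t) \<le> t * dist x y"
    by (intro geodesic_fan_convex[OF geodesic_seg_geod geodesic_seg_geod t])
  moreover have "dist (geod p y (1 - (1 - t))) (geod q y (1 - (1 - t))) \<le> (1 - t) * dist p q"
    by (rule geodesic_fan_convex[OF geodesic_seg_reverse[OF geodesic_seg_geod] geodesic_seg_reverse[OF geodesic_seg_geod]])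
      (use t in auto)
  ultimately show ?thesis using dist_triangle[of "geod p x t" "geod q y t" "geod p y t"] by simp
qed

lemma geod_dist_le:
  fixes x y p q :: 'a
  assumes "s \<in> {0..1}" "t \<in> {0..1}"
  shows "dist (geod p x s) (geod q y t) \<le> (1 - t) * dist p q + t * dist x y + \<bar>s - t\<bar> * dist p x"
  using dist_triangle[of "geod p x s" "geod q y t" "geod p x t"] geod_convex[OF assms(2), of p x q y] dist_geod[OF assms, of p x]
  by linarith

lemma geod_dist_le':
  fixes x y p q :: 'a
  assumes "s \<in> {0..1}" "t \<in> {0..1}"
  shows "dist (geod p x s) (geod q y t) \<le> dist p q + dist x y + \<bar>s - t\<bar> * dist p x"
proof -
  have "(1 - t) * dist p q \<le> dist p q" "t * dist x y \<le> dist x y"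
    using assms by (auto intro: mult_left_le_one_le)
  then show ?thesis using geod_dist_le[OF assms, of p x q y] by linarith
qed

lemma geod_in_cball:
  fixes x y c :: 'a
  assumes "t \<in> {0..1}" "dist c x \<le> r" "dist c y \<le> r"
  shows "dist c (geod x y t) \<le> r"
proof -
  have "dist c (geod x y t) \<le> (1 - t) * dist c x + t * dist c y"
    using geod_convex[OF assms(1), of c c x y] assms(1) by simp
  also have "\<dots> \<le> (1 - t) * r + t * r" using assms by (intro add_mono mult_left_mono) auto
  finally show ?thesis by (simp add: algebra_simps)
qed

end

section \<open>Covering estimates\<close>

text \<open>Transfer principle: a near-optimal cover of the image of \<open>f\<close> is pulled back
  to pieces on which \<open>f\<close> oscillates by at most \<open>e\<close>. The image of such a
  piece under \<open>F\<close> is covered by sets of size \<open>b * e\<close>, few enough that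
  their total \<open>k\<close>-dimensional content is a multiple of \<open>e^2\<close>, the
  two-dimensional content of the original covering set.\<close>

lemma hausdorff_outer_le_of_local_covers:
  fixes F :: "'b \<Rightarrow> 'a::metric_space" and f :: "'b \<Rightarrow> 'c::metric_space"
  assumes k: "0 < k" and \<rho>: "0 < \<rho>" and b: "0 < b" and q: "0 < q"
    and cover: "\<And>e S. 0 < e \<Longrightarrow> e \<le> \<rho> \<Longrightarrow> S \<subseteq> E \<Longrightarrow> (\<And>x y. x \<in> S \<Longrightarrow> y \<in> S \<Longrightarrow> dist (f x) (f y) \<le> e) \<Longrightarrow>
      \<exists>\<G>. finite \<G> \<and> F ` S \<subseteq> \<Union>\<G> \<and> (\<forall>G\<in>\<G>. \<forall>u\<in>G. \<forall>w\<in>G. dist u w \<le> b * e) \<and> real (card \<G>) * e ^ k \<le> q * e\<^sup>2"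
  shows "hausdorff_outer k (F ` E) \<le> ennreal (2 * hausdorff_const k * b ^ k * q / hausdorff_const 2) * hausdorff_outer 2 (f ` E)"
proof (cases "hausdorff_outer 2 (f ` E) = top")
  case True
  then show ?thesis using b q hausdorff_const_pos[of k] hausdorff_const_pos[of 2]
    by (simp add: ennreal_mult_top)
next
  case False
  define \<kappa> where "\<kappa> = hausdorff_const 2"
  define K where "K = hausdorff_const k * b ^ k * q"
  have \<kappa>: "0 < \<kappa>" and K: "0 < K" using b q hausdorff_const_pos by (auto simp: \<kappa>_def K_def)
  show ?thesis
  proof (rule hausdorff_outer_leI[of 1])
    fix \<delta> :: real assume \<delta>: "0 < \<delta>"
    show "hausdorff_pre k \<delta> (F ` E) \<le> ennreal (2 * hausdorff_const k * b ^ k * q / hausdorff_const 2) * hausdorff_outer 2 (f ` E)"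
    proof (rule ennreal_le_epsilon)
      fix r :: real assume r: "0 < r"
      \<comment> \<open>The enlarged sizes are at most 2 * \<delta>'; these bounds keep them below
        \<rho>, as \<open>cover\<close> requires, and make sets of size \<open>b * e\<close>
        admissible at scale \<delta>.\<close>
      define \<delta>' where "\<delta>' = min (\<rho> / 2) (\<delta> / (2 * b))"
      define \<eta> where "\<eta> = min \<delta>' (min 1 (r / (4 * K)))"
      \<comment> \<open>Covering sets may have diameter 0 while \<open>cover\<close> demands
        \<open>0 < e\<close>. The summable \<epsilon> i make every size positive at a total cost of
        \<open>2 * K * \<eta>\<close>, which is at most half of \<open>r\<close>.\<close>
      define \<epsilon> where "\<epsilon> i = \<eta> * (1/2) ^ Suc i" for i :: nat
      have \<delta>': "0 < \<delta>'" "2 * \<delta>' \<le> \<rho>" "2 * \<delta>' * b \<le> \<delta>" using \<rho> \<delta> b by (auto simp: \<delta>'_def min_def field_simps)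
      have \<eta>: "0 < \<eta>" "\<eta> \<le> \<delta>'" "\<eta> \<le> 1" using \<delta>' r K by (auto simp: \<eta>_def)
      have "\<eta> \<le> r / (4 * K)" by (simp add: \<eta>_def)
      then have \<eta>K: "2 * K * \<eta> \<le> r / 2" using K by (simp add: field_simps)
      have \<epsilon>: "0 < \<epsilon> i" "\<epsilon> i \<le> \<eta>" for i
      proof -
        have "(1/2 :: real) ^ Suc i \<le> 1" by (intro power_le_one) auto
        then show "0 < \<epsilon> i" "\<epsilon> i \<le> \<eta>" using \<eta> by (auto simp: \<epsilon>_def intro: mult_left_le simp del: power_Suc)
      qed
      have "hausdorff_pre 2 \<delta>' (f ` E) \<le> hausdorff_outer 2 (f ` E)" by (rule hausdorff_pre_le_outer[OF \<delta>'(1)])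
      also have "\<dots> < hausdorff_outer 2 (f ` E) + ennreal (r * \<kappa> / (4 * K))"
        using False r \<kappa> K by (simp add: ennreal_less_zero_iff less_top)
      finally obtain C :: "nat \<Rightarrow> 'c set" where C: "f ` E \<subseteq> (\<Union>i. C i)" "\<And>i. bounded (C i)" "\<And>i. diameter (C i) \<le> \<delta>'"
        "(\<Sum>i. ennreal (hausdorff_const 2 * diameter (C i) ^ 2)) < hausdorff_outer 2 (f ` E) + ennreal (r * \<kappa> / (4 * K))"
        by (rule hausdorff_pre_approx) blast
      define d where "d i = diameter (C i)" for i
      define S where "S i = {x \<in> E. f x \<in> C i}" for i
      have d0: "0 \<le> d i" for i by (simp add: d_def diameter_ge_0 C)
      have piece: "hausdorff_pre k \<delta> (F ` S i) \<le> ennreal (K * (d i + \<epsilon> i)\<^sup>2)" for i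
      proof -
        define e where "e = d i + \<epsilon> i"
        have e: "0 < e" "e \<le> 2 * \<delta>'" "e \<le> \<rho>" using d0[of i] \<epsilon>[of i] \<eta> C(3)[of i] \<delta>' by (auto simp: e_def d_def)
        have "dist (f x) (f y) \<le> e" if "x \<in> S i" "y \<in> S i" for x y
        proof -
          have "dist (f x) (f y) \<le> d i" using that diameter_bounded_bound[OF C(2)] by (auto simp: S_def d_def)
          then show ?thesis using \<epsilon>(1)[of i] by (simp add: e_def)
        qed
        then obtain \<G> where \<G>: "finite \<G>" "F ` S i \<subseteq> \<Union>\<G>" "\<forall>G\<in>\<G>. \<forall>u\<in>G. \<forall>w\<in>G. dist u w \<le> b * e" "real (card \<G>) * e ^ k \<le> q * e\<^sup>2"
          using cover[OF e(1,3), of "S i"] by (auto simp: S_def)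
        have be: "b * e \<le> \<delta>"
        proof -
          have "b * e \<le> b * (2 * \<delta>')" using e b by (intro mult_left_mono) auto
          then show ?thesis using \<delta>' by (simp add: algebra_simps)
        qed
        have "hausdorff_pre k \<delta> (F ` S i) \<le> hausdorff_pre k \<delta> (\<Union>G\<in>\<G>. G)" using \<G> by (intro hausdorff_pre_mono) auto
        also have "\<dots> \<le> (\<Sum>G\<in>\<G>. hausdorff_pre k \<delta> G)" using \<G> k \<delta> by (intro hausdorff_pre_finite_subadditive) auto
        also have "\<dots> \<le> (\<Sum>G\<in>\<G>. ennreal (hausdorff_const k * (b * e) ^ k))"
          using \<G> b e be k by (intro sum_mono hausdorff_pre_le_const) auto
        also have "\<dots> = ennreal (real (card \<G>) * (hausdorff_const k * (b * e) ^ k))"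
          using b e hausdorff_const_pos[of k] by (subst sum_ennreal) auto
        also have "\<dots> \<le> ennreal (K * e\<^sup>2)"
        proof (rule ennreal_leI)
          have "real (card \<G>) * (hausdorff_const k * (b * e) ^ k) = (hausdorff_const k * b ^ k) * (real (card \<G>) * e ^ k)"
            by (simp add: power_mult_distrib)
          also have "\<dots> \<le> (hausdorff_const k * b ^ k) * (q * e\<^sup>2)"
            using \<G>(4) b hausdorff_const_pos[of k] by (intro mult_left_mono) auto
          finally show "real (card \<G>) * (hausdorff_const k * (b * e) ^ k) \<le> K * e\<^sup>2" by (simp add: K_def)
        qed
        finally show ?thesis by (simp add: e_def)
      qed
      have "F ` E \<subseteq> (\<Union>i. F ` S i)" using C(1) by (fastforce simp: S_def)
      then have "hausdorff_pre k \<delta> (F ` E) \<le> hausdorff_pre k \<delta> (\<Union>i. F ` S i)" by (rule hausdorff_pre_mono)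
      also have "\<dots> \<le> (\<Sum>i. hausdorff_pre k \<delta> (F ` S i))" by (rule hausdorff_pre_countable_subadditive)
      also have "\<dots> \<le> (\<Sum>i. ennreal (2 * K / \<kappa>) * ennreal (\<kappa> * (d i)\<^sup>2) + ennreal (2 * K) * ennreal (\<epsilon> i))"
      proof (intro suminf_le summableI)
        fix i
        \<comment> \<open>Splitting the square this way is the origin of the factor 2 in the
          constant.\<close>
        have "(d i + \<epsilon> i)\<^sup>2 \<le> 2 * (d i)\<^sup>2 + 2 * (\<epsilon> i)\<^sup>2"
          using zero_le_power2[of "d i - \<epsilon> i"] by (simp add: power2_eq_square algebra_simps)
        moreover have "(\<epsilon> i)\<^sup>2 \<le> \<epsilon> i" using \<epsilon>[of i] \<eta> by (simp add: power2_eq_square mult_left_le)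
        ultimately have "(d i + \<epsilon> i)\<^sup>2 \<le> 2 * (d i)\<^sup>2 + 2 * \<epsilon> i" by linarith
        then have "K * (d i + \<epsilon> i)\<^sup>2 \<le> K * (2 * (d i)\<^sup>2 + 2 * \<epsilon> i)" using K by (intro mult_left_mono) auto
        also have "\<dots> = 2 * K / \<kappa> * (\<kappa> * (d i)\<^sup>2) + 2 * K * \<epsilon> i" using \<kappa> by (simp add: field_simps)
        finally have "ennreal (K * (d i + \<epsilon> i)\<^sup>2) \<le> ennreal (2 * K / \<kappa> * (\<kappa> * (d i)\<^sup>2) + 2 * K * \<epsilon> i)" by (rule ennreal_leI)
        also have "\<dots> = ennreal (2 * K / \<kappa>) * ennreal (\<kappa> * (d i)\<^sup>2) + ennreal (2 * K) * ennreal (\<epsilon> i)"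
        proof -
          have nn: "0 \<le> 2 * K / \<kappa>" "0 \<le> \<kappa> * (d i)\<^sup>2" "0 \<le> 2 * K" "0 \<le> \<epsilon> i" using K \<kappa> \<epsilon>[of i] by auto
          show ?thesis unfolding ennreal_mult[OF nn(1,2), symmetric] ennreal_mult[OF nn(3,4), symmetric]
            using mult_nonneg_nonneg[OF nn(1,2)] mult_nonneg_nonneg[OF nn(3,4)] by (rule ennreal_plus)
        qed
        finally show "hausdorff_pre k \<delta> (F ` S i) \<le> ennreal (2 * K / \<kappa>) * ennreal (\<kappa> * (d i)\<^sup>2) + ennreal (2 * K) * ennreal (\<epsilon> i)"
          using piece[of i] by (rule order_trans[rotated])
      qed
      also have "\<dots> = ennreal (2 * K / \<kappa>) * (\<Sum>i. ennreal (\<kappa> * (d i)\<^sup>2)) + ennreal (2 * K) * (\<Sum>i. ennreal (\<epsilon> i))"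
        by (subst suminf_add[symmetric]) auto
      also have "(\<Sum>i. ennreal (\<epsilon> i)) = ennreal \<eta>" unfolding \<epsilon>_def using \<eta> by (intro suminf_ennreal_half) auto
      also have "ennreal (2 * K / \<kappa>) * (\<Sum>i. ennreal (\<kappa> * (d i)\<^sup>2)) + ennreal (2 * K) * ennreal \<eta>
        \<le> ennreal (2 * K / \<kappa>) * (hausdorff_outer 2 (f ` E) + ennreal (r * \<kappa> / (4 * K))) + ennreal (r / 2)"
      proof (intro add_mono mult_left_mono)
        show "(\<Sum>i. ennreal (\<kappa> * (d i)\<^sup>2)) \<le> hausdorff_outer 2 (f ` E) + ennreal (r * \<kappa> / (4 * K))"
          using C(4) by (simp add: d_def \<kappa>_def)
        show "ennreal (2 * K) * ennreal \<eta> \<le> ennreal (r / 2)"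
          using \<eta>K \<eta> K by (simp add: ennreal_leI flip: ennreal_mult)
      qed auto
      also have "\<dots> = ennreal (2 * K / \<kappa>) * hausdorff_outer 2 (f ` E) + (ennreal (2 * K / \<kappa>) * ennreal (r * \<kappa> / (4 * K)) + ennreal (r / 2))"
        by (simp add: distrib_left add.assoc)
      also have "ennreal (2 * K / \<kappa>) * ennreal (r * \<kappa> / (4 * K)) = ennreal (r / 2)"
        using K \<kappa> r by (simp flip: ennreal_mult)
      also have "ennreal (r / 2) + ennreal (r / 2) = ennreal r" using r by (simp flip: ennreal_plus)
      finally show "hausdorff_pre k \<delta> (F ` E) \<le> ennreal (2 * hausdorff_const k * b ^ k * q / hausdorff_const 2) * hausdorff_outer 2 (f ` E) + ennreal r"
        by (simp add: K_def \<kappa>_def mult.assoc)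
    qed
  qed simp
qed

section \<open>Stretching along one direction\<close>

lemma real_card_int_interval: "0 \<le> K \<Longrightarrow> real (card {\<lfloor>- K\<rfloor>..\<lfloor>K\<rfloor>}) \<le> 2 * K + 2"
  by simp linarith

lemma floor_between: "\<bar>x\<bar> \<le> K \<Longrightarrow> \<lfloor>x\<rfloor> \<in> {\<lfloor>- K\<rfloor>..\<lfloor>K::real\<rfloor>}"
  by (auto intro!: floor_mono)

lemma same_floor_div: "\<lfloor>x / e\<rfloor> = \<lfloor>y / e\<rfloor> \<Longrightarrow> 0 < e \<Longrightarrow> \<bar>x - y\<bar> \<le> (e::real)"
proof -
  assume "\<lfloor>x / e\<rfloor> = \<lfloor>y / e\<rfloor>" "0 < e"
  then have "\<bar>x / e - y / e\<bar> \<le> 1" by linarith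
  then have "\<bar>x - y\<bar> / e \<le> 1" using \<open>0 < e\<close> by (simp flip: diff_divide_distrib)
  then show ?thesis using \<open>0 < e\<close> by (simp add: field_simps)
qed

text \<open>Read as a Lipschitz bound, the hypothesis would only give a factor of order (K + 2)^2.
  But the stretch is along the single function \<open>v\<close>: a piece of size \<open>e\<close> is
  sorted into about 2 K + 2 buckets by the value of \<open>v\<close>, each with an image of diameter
  at most 3 e, and the factor becomes linear in \<open>K\<close>. The estimates are asked for only
  at scales up to \<eta>, since cluster centres will be constant only locally.\<close>

lemma hausdorff_outer_stretch:
  fixes F :: "'b \<Rightarrow> 'a::metric_space" and f :: "'b \<Rightarrow> 'c::metric_space" and v :: "'b \<Rightarrow> real"
  assumes \<eta>: "0 < \<eta>" and K: "0 \<le> K"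
    and F: "\<And>x y. x \<in> E \<Longrightarrow> y \<in> E \<Longrightarrow> dist (f x) (f y) \<le> \<eta> \<Longrightarrow> dist (F x) (F y) \<le> 2 * dist (f x) (f y) + \<bar>v x - v y\<bar>"
    and v: "\<And>x y. x \<in> E \<Longrightarrow> y \<in> E \<Longrightarrow> dist (f x) (f y) \<le> \<eta> \<Longrightarrow> \<bar>v x - v y\<bar> \<le> K * dist (f x) (f y)"
  shows "hausdorff_outer 2 (F ` E) \<le> ennreal (36 * (K + 1)) * hausdorff_outer 2 (f ` E)"
proof -
  have "hausdorff_outer 2 (F ` E) \<le> ennreal (2 * hausdorff_const 2 * 3 ^ 2 * (2 * K + 2) / hausdorff_const 2) * hausdorff_outer 2 (f ` E)"
  proof (rule hausdorff_outer_le_of_local_covers[where \<rho> = \<eta>])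
    fix e S assume e: "0 < e" "e \<le> \<eta>" and S: "S \<subseteq> E" "\<And>x y. x \<in> S \<Longrightarrow> y \<in> S \<Longrightarrow> dist (f x) (f y) \<le> e"
    show "\<exists>\<G>. finite \<G> \<and> F ` S \<subseteq> \<Union>\<G> \<and> (\<forall>G\<in>\<G>. \<forall>u\<in>G. \<forall>w\<in>G. dist u w \<le> 3 * e) \<and> real (card \<G>) * e\<^sup>2 \<le> (2 * K + 2) * e\<^sup>2"
    proof (cases "S = {}")
      case False
      then obtain x0 where x0: "x0 \<in> S" by blast
      define J where "J = {\<lfloor>- K\<rfloor>..\<lfloor>K\<rfloor>}"
      define c where "c x = \<lfloor>(v x - v x0) / e\<rfloor>" for x
      define G where "G j = F ` {x \<in> S. c x = j}" for j
      have bound: "dist (f x) (f y) \<le> e" "dist (f x) (f y) \<le> \<eta>" "x \<in> E" "y \<in> E" if "x \<in> S" "y \<in> S" for x y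
        using S that e by fastforce+
      have cJ: "c x \<in> J" if "x \<in> S" for x
      proof -
        have "\<bar>v x - v x0\<bar> \<le> K * dist (f x) (f x0)" using bound[OF that x0] by (intro v)
        also have "\<dots> \<le> K * e" using bound(1)[OF that x0] K by (intro mult_left_mono)
        finally have "\<bar>(v x - v x0) / e\<bar> \<le> K" using e by (simp add: field_simps)
        then show ?thesis unfolding c_def J_def by (rule floor_between)
      qed
      have d: "dist u w \<le> 3 * e" if "u \<in> G j" "w \<in> G j" for j u w
      proof -
        obtain x y where xy: "x \<in> S" "y \<in> S" "c x = j" "c y = j" "u = F x" "w = F y" using \<open>u \<in> G j\<close> \<open>w \<in> G j\<close> by (auto simp: G_def)
        have "\<bar>(v x - v x0) - (v y - v x0)\<bar> \<le> e" using xy e by (intro same_floor_div) (auto simp: c_def)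
        then show ?thesis using F[of x y] bound[OF xy(1,2)] xy by auto
      qed
      have "real (card (G ` J)) \<le> real (card J)" by (intro of_nat_mono card_image_le) (simp add: J_def)
      also have "\<dots> \<le> 2 * K + 2" unfolding J_def by (rule real_card_int_interval[OF K])
      finally have "real (card (G ` J)) * e\<^sup>2 \<le> (2 * K + 2) * e\<^sup>2" by (intro mult_right_mono) auto
      moreover have "F ` S \<subseteq> \<Union> (G ` J)"
      proof
        fix w assume "w \<in> F ` S"
        then obtain x where x: "x \<in> S" "w = F x" by blast
        then have "w \<in> G (c x)" by (auto simp: G_def)
        then show "w \<in> \<Union> (G ` J)" using cJ[OF x(1)] by blast
      qed
      moreover have "finite (G ` J)" by (simp add: J_def)
      moreover have "\<forall>A\<in>G ` J. \<forall>u\<in>A. \<forall>w\<in>A. dist u w \<le> 3 * e" using d by blast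
      ultimately show ?thesis by blast
    qed (use K in \<open>auto intro!: exI[of _ "{}"]\<close>)
  qed (use \<eta> K in auto)
  also have "2 * hausdorff_const 2 * 3 ^ 2 * (2 * K + 2) / hausdorff_const 2 = 36 * (K + 1)"
    using hausdorff_const_pos[of 2] by (simp add: field_simps)
  finally show ?thesis .
qed

text \<open>512 = 2 * 4^3 * 4: the doubling in the transfer principle, image pieces of diameter 4 e,
  and the count 4 (K + 1) L / e of such pieces for a slice of length L.\<close>

definition cylinder_const :: real where
  "cylinder_const = 512 * hausdorff_const 3 / hausdorff_const 2"

lemma cylinder_const_pos: "0 < cylinder_const"
  using hausdorff_const_pos by (simp add: cylinder_const_def)

text \<open>Buckets are formed by \<open>v\<close> and by the height \<open>s\<close>. A slice of
  length \<open>L = T * (\<beta> - \<alpha>)\<close> needs at most L / e + 1 height buckets, and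
  this is at most 2 L / e because scales are restricted to \<open>e \<le> L\<close>. The restriction
  makes the bound linear in the height, so that thin slices can be added up.\<close>

lemma hausdorff_outer_stretch_cylinder:
  fixes F :: "'b \<Rightarrow> 'a::metric_space" and f :: "'b \<Rightarrow> 'c::metric_space" and v s :: "'b \<Rightarrow> real"
  assumes \<eta>: "0 < \<eta>" and K: "0 \<le> K" and T: "0 < T" and \<alpha>\<beta>: "\<alpha> < \<beta>"
    and F: "\<And>x y. x \<in> E \<Longrightarrow> y \<in> E \<Longrightarrow> dist (f x) (f y) \<le> \<eta> \<Longrightarrow>
       dist (F x) (F y) \<le> 2 * dist (f x) (f y) + \<bar>v x - v y\<bar> + T * \<bar>s x - s y\<bar>"
    and v: "\<And>x y. x \<in> E \<Longrightarrow> y \<in> E \<Longrightarrow> dist (f x) (f y) \<le> \<eta> \<Longrightarrow> \<bar>v x - v y\<bar> \<le> K * dist (f x) (f y)"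
    and s: "\<And>x. x \<in> E \<Longrightarrow> \<alpha> \<le> s x \<and> s x \<le> \<beta>"
  shows "hausdorff_outer 3 (F ` E) \<le> ennreal (cylinder_const * (K + 1) * T * (\<beta> - \<alpha>)) * hausdorff_outer 2 (f ` E)"
proof -
  define L where "L = T * (\<beta> - \<alpha>)"
  have L: "0 < L" using T \<alpha>\<beta> by (simp add: L_def)
  have "hausdorff_outer 3 (F ` E) \<le> ennreal (2 * hausdorff_const 3 * 4 ^ 3 * ((4 * K + 4) * L) / hausdorff_const 2) * hausdorff_outer 2 (f ` E)"
  proof (rule hausdorff_outer_le_of_local_covers[where \<rho> = "min \<eta> L"])
    fix e S assume e: "0 < e" "e \<le> min \<eta> L" and S: "S \<subseteq> E" "\<And>x y. x \<in> S \<Longrightarrow> y \<in> S \<Longrightarrow> dist (f x) (f y) \<le> e"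
    show "\<exists>\<G>. finite \<G> \<and> F ` S \<subseteq> \<Union>\<G> \<and> (\<forall>G\<in>\<G>. \<forall>u\<in>G. \<forall>w\<in>G. dist u w \<le> 4 * e) \<and> real (card \<G>) * e ^ 3 \<le> (4 * K + 4) * L * e\<^sup>2"
    proof (cases "S = {}")
      case False
      then obtain x0 where x0: "x0 \<in> S" by blast
      define J where "J = {\<lfloor>- K\<rfloor>..\<lfloor>K\<rfloor>}"
      define I where "I = {0..\<lfloor>L / e\<rfloor>}"
      define c where "c x = \<lfloor>(v x - v x0) / e\<rfloor>" for x
      define c' where "c' x = \<lfloor>(T * (s x - \<alpha>)) / e\<rfloor>" for x
      define G where "G j = F ` {x \<in> S. (c x, c' x) = j}" for j
      have bound: "dist (f x) (f y) \<le> e" "dist (f x) (f y) \<le> \<eta>" "x \<in> E" "y \<in> E" if "x \<in> S" "y \<in> S" for x y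
        using S that e by fastforce+
      have cJ: "(c x, c' x) \<in> J \<times> I" if "x \<in> S" for x
      proof -
        have "\<bar>v x - v x0\<bar> \<le> K * dist (f x) (f x0)" using bound[OF that x0] by (intro v)
        also have "\<dots> \<le> K * e" using bound(1)[OF that x0] K by (intro mult_left_mono)
        finally have "\<bar>(v x - v x0) / e\<bar> \<le> K" using e by (simp add: field_simps)
        then have 1: "c x \<in> J" unfolding c_def J_def by (rule floor_between)
        have "0 \<le> T * (s x - \<alpha>)" "T * (s x - \<alpha>) \<le> L"
          using s[OF bound(3)[OF that x0]] T by (auto simp: L_def)
        then have "0 \<le> c' x" "c' x \<le> \<lfloor>L / e\<rfloor>" unfolding c'_def using e
          by (auto intro!: floor_mono divide_right_mono)
        then show ?thesis using 1 by (simp add: I_def)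
      qed
      have d: "dist u w \<le> 4 * e" if "u \<in> G j" "w \<in> G j" for j u w
      proof -
        obtain x y where xy: "x \<in> S" "y \<in> S" "(c x, c' x) = j" "(c y, c' y) = j" "u = F x" "w = F y" using \<open>u \<in> G j\<close> \<open>w \<in> G j\<close> by (auto simp: G_def)
        have "\<bar>(v x - v x0) - (v y - v x0)\<bar> \<le> e" using xy e by (intro same_floor_div) (auto simp: c_def)
        moreover have "\<bar>T * (s x - \<alpha>) - T * (s y - \<alpha>)\<bar> \<le> e" using xy e by (intro same_floor_div) (auto simp: c'_def)
        then have "T * \<bar>s x - s y\<bar> \<le> e"
          using T by (simp add: abs_mult flip: right_diff_distrib)
        ultimately show ?thesis using F[of x y] bound[OF xy(1,2)] xy by auto
      qed
      have "real (card (G ` (J \<times> I))) \<le> real (card (J \<times> I))" by (intro of_nat_mono card_image_le) (simp add: J_def I_def)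
      also have "\<dots> = real (card J) * real (card I)" by (simp only: card_cartesian_product of_nat_mult)
      also have "\<dots> \<le> (2 * K + 2) * (L / e + 1)"
      proof (intro mult_mono)
        show "real (card J) \<le> 2 * K + 2" unfolding J_def by (rule real_card_int_interval[OF K])
        have "0 \<le> \<lfloor>L / e\<rfloor>" using L e by simp
        then show "real (card I) \<le> L / e + 1" unfolding I_def by simp
      qed (use K in auto)
      finally have "real (card (G ` (J \<times> I))) * e ^ 3 \<le> (2 * K + 2) * (L / e + 1) * e ^ 3" using e by (intro mult_right_mono) auto
      also have "\<dots> = (2 * K + 2) * (L + e) * e\<^sup>2" using e by (simp add: field_simps power2_eq_square power3_eq_cube)
      also have "\<dots> \<le> (2 * K + 2) * (2 * L) * e\<^sup>2" using e K by (intro mult_right_mono mult_left_mono) auto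
      finally have "real (card (G ` (J \<times> I))) * e ^ 3 \<le> (4 * K + 4) * L * e\<^sup>2" by (simp add: algebra_simps)
      moreover have "F ` S \<subseteq> \<Union> (G ` (J \<times> I))"
      proof
        fix w assume "w \<in> F ` S"
        then obtain x where x: "x \<in> S" "w = F x" by blast
        then have "w \<in> G (c x, c' x)" by (auto simp: G_def)
        then show "w \<in> \<Union> (G ` (J \<times> I))" using cJ[OF x(1)] by blast
      qed
      moreover have "finite (G ` (J \<times> I))" by (simp add: J_def I_def)
      moreover have "\<forall>A\<in>G ` (J \<times> I). \<forall>u\<in>A. \<forall>w\<in>A. dist u w \<le> 4 * e" using d by blast
      ultimately show ?thesis by blast
    qed (use K L in \<open>auto intro!: exI[of _ "{}"]\<close>)
  qed (use \<eta> K L in auto)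
  also have "2 * hausdorff_const 3 * 4 ^ 3 * ((4 * K + 4) * L) / hausdorff_const 2 = cylinder_const * (K + 1) * T * (\<beta> - \<alpha>)"
    by (simp add: field_simps cylinder_const_def L_def)
  finally show ?thesis .
qed

text \<open>\<open>Suc n\<close> arcs of diameter at most \<open>L / Suc n\<close> have
  two-dimensional content of order 1 / n.\<close>

lemma hausdorff_outer_curve_null:
  fixes g :: "real \<Rightarrow> 'a::metric_space"
  assumes g: "\<And>s t. s \<in> {0..1} \<Longrightarrow> t \<in> {0..1} \<Longrightarrow> dist (g s) (g t) \<le> L * \<bar>s - t\<bar>" and L: "0 \<le> L"
  shows "hausdorff_outer 2 (g ` {0..1}) = 0"
proof -
  have "hausdorff_outer 2 (g ` {0..1}) \<le> 0"
  proof (rule hausdorff_outer_leI[of 1])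
    fix \<delta> :: real assume \<delta>: "0 < \<delta>"
    have *: "hausdorff_pre 2 \<delta> (g ` {0..1}) \<le> ennreal (hausdorff_const 2 * L\<^sup>2 / real (Suc n))" if n: "L / \<delta> \<le> real (Suc n)" for n
    proof -
      define I where "I j = {real j / real (Suc n) .. real (Suc j) / real (Suc n)} \<inter> {0..1}" for j
      have "{0..1::real} \<subseteq> (\<Union>j\<in>{..<Suc n}. I j)"
      proof
        fix x :: real assume x: "x \<in> {0..1}"
        obtain j where j: "j < Suc n" "real j / real (Suc n) \<le> x" "x \<le> real (Suc j) / real (Suc n)"
          using unit_interval_cell[of x n] x by auto
        then have "x \<in> I j" using x by (simp add: I_def)
        then show "x \<in> (\<Union>j\<in>{..<Suc n}. I j)" using j by blast
      qed
      then have "hausdorff_pre 2 \<delta> (g ` {0..1}) \<le> hausdorff_pre 2 \<delta> (\<Union>j\<in>{..<Suc n}. g ` I j)"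
        by (intro hausdorff_pre_mono) blast
      also have "\<dots> \<le> (\<Sum>j\<in>{..<Suc n}. hausdorff_pre 2 \<delta> (g ` I j))"
        by (rule hausdorff_pre_finite_subadditive) (use \<delta> in auto)
      also have "\<dots> \<le> (\<Sum>j\<in>{..<Suc n}. ennreal (hausdorff_const 2 * (L / real (Suc n))\<^sup>2))"
      proof (intro sum_mono hausdorff_pre_le_const)
        fix j x y assume "x \<in> g ` I j" "y \<in> g ` I j"
        then obtain a b where ab: "a \<in> I j" "b \<in> I j" "x = g a" "y = g b" by auto
        have "real (Suc j) / real (Suc n) = real j / real (Suc n) + 1 / real (Suc n)" by (simp add: field_simps)
        then have "\<bar>a - b\<bar> \<le> 1 / real (Suc n)" using ab by (auto simp: I_def)
        then have "L * \<bar>a - b\<bar> \<le> L * (1 / real (Suc n))" using L by (rule mult_left_mono)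
        moreover have "dist x y \<le> L * \<bar>a - b\<bar>" using g[of a b] ab unfolding I_def by blast
        ultimately show "dist x y \<le> L / real (Suc n)" by simp
      qed (use L \<delta> n in \<open>auto simp: field_simps\<close>)
      also have "\<dots> = ennreal (real (Suc n) * (hausdorff_const 2 * (L / real (Suc n))\<^sup>2))"
        using hausdorff_const_pos[of 2] by (subst sum_ennreal) auto
      also have "real (Suc n) * (hausdorff_const 2 * (L / real (Suc n))\<^sup>2) = hausdorff_const 2 * L\<^sup>2 / real (Suc n)"
      proof -
        have "N * (c * (L / N)\<^sup>2) = c * L\<^sup>2 / N" if "0 < N" for N c :: real
          using that by (simp add: power2_eq_square field_simps)
        then show ?thesis by simp
      qed
      finally show ?thesis .
    qed
    have "(\<lambda>n. hausdorff_const 2 * L\<^sup>2 * inverse (real (Suc n))) \<longlonglongrightarrow> hausdorff_const 2 * L\<^sup>2 * 0"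
      by (intro tendsto_mult tendsto_const LIMSEQ_inverse_real_of_nat)
    then have "(\<lambda>n. ennreal (hausdorff_const 2 * L\<^sup>2 / real (Suc n))) \<longlonglongrightarrow> ennreal 0"
      by (intro tendsto_ennrealI) (simp add: field_simps)
    moreover have "eventually (\<lambda>n. hausdorff_pre 2 \<delta> (g ` {0..1}) \<le> ennreal (hausdorff_const 2 * L\<^sup>2 / real (Suc n))) sequentially"
    proof -
      obtain N :: nat where "L / \<delta> < real N" using reals_Archimedean2 by blast
      then show ?thesis unfolding eventually_sequentially by (intro exI[of _ N] allI impI *) simp
    qed
    ultimately have "hausdorff_pre 2 \<delta> (g ` {0..1}) \<le> ennreal 0" by (intro tendsto_lowerbound) auto
    then show "hausdorff_pre 2 \<delta> (g ` {0..1}) \<le> 0" by simp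
  qed simp
  then show ?thesis by simp
qed

lemma hausdorff_outer_singleton: "0 < k \<Longrightarrow> hausdorff_outer k {x :: 'a::metric_space} = 0"
proof -
  assume k: "0 < k"
  have "hausdorff_outer k {x} \<le> 0"
    by (rule hausdorff_outer_leI[of 1]) (use hausdorff_pre_le_const[of "{x}" 0 _ k] k in \<open>auto simp: zero_power\<close>)
  then show ?thesis by simp
qed

section \<open>Lipschitz spheres and their fillings\<close>

lemma abs_sin_diff_le: "\<bar>sin a - sin b\<bar> \<le> \<bar>a - b :: real\<bar>"
proof -
  have "\<bar>sin a - sin b\<bar> = 2 * (\<bar>sin ((a - b) / 2)\<bar> * \<bar>cos ((a + b) / 2)\<bar>)"
    by (simp add: sin_diff_sin abs_mult)
  also have "\<dots> \<le> 2 * (\<bar>(a - b) / 2\<bar> * 1)"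
    by (intro mult_left_mono mult_mono abs_sin_x_le_abs_x) auto
  finally show ?thesis by simp
qed

lemma abs_cos_diff_le: "\<bar>cos a - cos b\<bar> \<le> \<bar>a - b :: real\<bar>"
  using abs_sin_diff_le[of "pi / 2 - a" "pi / 2 - b"] by (simp add: sin_diff)

lemma abs_mult_diff_le:
  fixes a b c d :: real
  assumes "\<bar>b\<bar> \<le> 1" "\<bar>c\<bar> \<le> 1"
  shows "\<bar>a * b - c * d\<bar> \<le> \<bar>a - c\<bar> + \<bar>b - d\<bar>"
proof -
  have "\<bar>a * b - c * d\<bar> = \<bar>(a - c) * b + c * (b - d)\<bar>" by (simp add: algebra_simps)
  also have "\<dots> \<le> \<bar>a - c\<bar> * \<bar>b\<bar> + \<bar>c\<bar> * \<bar>b - d\<bar>" by (metis abs_mult abs_triangle_ineq)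
  also have "\<dots> \<le> \<bar>a - c\<bar> * 1 + 1 * \<bar>b - d\<bar>" using assms by (intro add_mono mult_left_mono mult_right_mono) auto
  finally show ?thesis by simp
qed

definition spherical :: "real \<Rightarrow> real \<Rightarrow> real^3" where
  "spherical \<theta> \<phi> = vector [cos \<theta> * cos \<phi>, cos \<theta> * sin \<phi>, sin \<theta>]"

lemma dist_spherical_le: "dist (spherical \<theta> \<phi>) (spherical \<theta>' \<phi>') \<le> 3 * \<bar>\<theta> - \<theta>'\<bar> + 2 * \<bar>\<phi> - \<phi>'\<bar>"
proof -
  have "dist (spherical \<theta> \<phi>) (spherical \<theta>' \<phi>') \<le> (\<Sum>i\<in>UNIV. \<bar>(spherical \<theta> \<phi> - spherical \<theta>' \<phi>') $ i\<bar>)"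
    unfolding dist_norm by (rule norm_le_l1_cart)
  also have "\<dots> = \<bar>cos \<theta> * cos \<phi> - cos \<theta>' * cos \<phi>'\<bar> + \<bar>cos \<theta> * sin \<phi> - cos \<theta>' * sin \<phi>'\<bar> + \<bar>sin \<theta> - sin \<theta>'\<bar>"
    by (simp add: sum_3 spherical_def)
  also have "\<dots> \<le> (\<bar>\<theta> - \<theta>'\<bar> + \<bar>\<phi> - \<phi>'\<bar>) + (\<bar>\<theta> - \<theta>'\<bar> + \<bar>\<phi> - \<phi>'\<bar>) + \<bar>\<theta> - \<theta>'\<bar>"
    by (intro add_mono order_trans[OF abs_mult_diff_le] abs_sin_diff_le abs_cos_diff_le) auto
  finally show ?thesis by simp
qed

lemma spherical_surj:
  fixes x :: "real^3" assumes "norm x = 1"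
  obtains \<theta> \<phi> where "0 \<le> \<theta>" "\<theta> \<le> 7" "0 \<le> \<phi>" "\<phi> \<le> 7" "x = spherical \<theta> \<phi>"
proof -
  have pi7: "2 * pi \<le> 7" using pi_less_4 pi_approx by simp
  have n: "(x$1)\<^sup>2 + (x$2)\<^sup>2 + (x$3)\<^sup>2 = 1"
    using assms by (simp add: norm_eq_sqrt_inner inner_vec_def sum_3 power2_eq_square)
  define c where "c = sqrt (1 - (x$3)\<^sup>2)"
  have c2: "c\<^sup>2 = 1 - (x$3)\<^sup>2" unfolding c_def using n by (simp add: real_sqrt_pow2) (smt (verit) zero_le_power2)
  then have "c\<^sup>2 + (x$3)\<^sup>2 = 1" by simp
  then obtain \<theta> where \<theta>: "0 \<le> \<theta>" "\<theta> < 2 * pi" "c = cos \<theta>" "x$3 = sin \<theta>" by (rule sincos_total_2pi)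
  have "\<exists>\<phi>. 0 \<le> \<phi> \<and> \<phi> \<le> 2 * pi \<and> x$1 = c * cos \<phi> \<and> x$2 = c * sin \<phi>"
  proof (cases "c = 0")
    case True
    then have "(x$1)\<^sup>2 + (x$2)\<^sup>2 = 0" using n c2 by simp
    then have "x$1 = 0" "x$2 = 0" by (auto simp: sum_power2_eq_zero_iff)
    then show ?thesis using True by (intro exI[of _ 0]) auto
  next
    case False
    have "(x$1 / c)\<^sup>2 + (x$2 / c)\<^sup>2 = ((x$1)\<^sup>2 + (x$2)\<^sup>2) / c\<^sup>2" by (simp add: power_divide add_divide_distrib)
    also have "(x$1)\<^sup>2 + (x$2)\<^sup>2 = c\<^sup>2" using n c2 by simp
    finally have "(x$1 / c)\<^sup>2 + (x$2 / c)\<^sup>2 = 1" using False by simp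
    then obtain \<phi> where "0 \<le> \<phi>" "\<phi> \<le> 2 * pi" "x$1 / c = cos \<phi>" "x$2 / c = sin \<phi>" using sincos_total_2pi_le by blast
    then show ?thesis using False by (intro exI[of _ \<phi>]) (auto simp: field_simps)
  qed
  then obtain \<phi> where \<phi>: "0 \<le> \<phi>" "\<phi> \<le> 2 * pi" "x$1 = c * cos \<phi>" "x$2 = c * sin \<phi>" by blast
  have "x = spherical \<theta> \<phi>" unfolding spherical_def using \<theta> \<phi> by (simp add: vec_eq_iff forall_3)
  then show ?thesis using that[of \<theta> \<phi>] \<theta> \<phi> pi7 by auto
qed

lemma hausdorff_outer_sphere_finite: "hausdorff_outer 2 (sphere 0 1 :: (real^3) set) < top"
proof -
  \<comment> \<open>The parameter square has side 7, which exceeds 2 pi, and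
    \<open>spherical\<close> stretches its two coordinates by at most 3 and 2, hence 35 = 7 * (3 +
    2).\<close>
  have "hausdorff_outer 2 (sphere 0 1 :: (real^3) set) \<le> ennreal (hausdorff_const 2 * 35\<^sup>2)"
  proof (rule hausdorff_outer_leI[of 1])
    fix \<delta> :: real assume \<delta>: "0 < \<delta>"
    obtain n :: nat where n: "35 / \<delta> < real n" using reals_Archimedean2 by blast
    define N where "N = real (Suc n)"
    have N: "0 < N" "35 / N \<le> \<delta>" using n \<delta> by (auto simp: N_def field_simps)
    define A where "A = (\<lambda>(i::nat, j::nat). {spherical \<theta> \<phi> | \<theta> \<phi>. real i / N \<le> \<theta> / 7 \<and> \<theta> / 7 \<le> real (Suc i) / N \<and> real j / N \<le> \<phi> / 7 \<and> \<phi> / 7 \<le> real (Suc j) / N})"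
    define J where "J = {..<Suc n} \<times> {..<Suc n}"
    have "sphere 0 1 \<subseteq> (\<Union>p\<in>J. A p)"
    proof
      fix x :: "real^3" assume "x \<in> sphere 0 1"
      then have "norm x = 1" by simp
      then obtain \<theta> \<phi> where x: "0 \<le> \<theta>" "\<theta> \<le> 7" "0 \<le> \<phi>" "\<phi> \<le> 7" "x = spherical \<theta> \<phi>" by (rule spherical_surj)
      obtain i where i: "i < Suc n" "real i / N \<le> \<theta> / 7" "\<theta> / 7 \<le> real (Suc i) / N"
        using unit_interval_cell[of "\<theta> / 7" n] x unfolding N_def by auto
      obtain j where j: "j < Suc n" "real j / N \<le> \<phi> / 7" "\<phi> / 7 \<le> real (Suc j) / N"
        using unit_interval_cell[of "\<phi> / 7" n] x unfolding N_def by auto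
      have "x \<in> A (i, j)" unfolding A_def using x i j by blast
      then show "x \<in> (\<Union>p\<in>J. A p)" using i j unfolding J_def by blast
    qed
    then have "hausdorff_pre 2 \<delta> (sphere 0 1 :: (real^3) set) \<le> hausdorff_pre 2 \<delta> (\<Union>p\<in>J. A p)" by (rule hausdorff_pre_mono)
    also have "\<dots> \<le> (\<Sum>p\<in>J. hausdorff_pre 2 \<delta> (A p))"
      by (rule hausdorff_pre_finite_subadditive) (use \<delta> in \<open>auto simp: J_def\<close>)
    also have "\<dots> \<le> (\<Sum>p\<in>J. ennreal (hausdorff_const 2 * (35 / N)\<^sup>2))"
    proof (intro sum_mono hausdorff_pre_le_const)
      fix p x y assume "x \<in> A p" "y \<in> A p"
      then obtain i j \<theta> \<phi> \<theta>' \<phi>' where *: "x = spherical \<theta> \<phi>" "y = spherical \<theta>' \<phi>'"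
        "real i / N \<le> \<theta> / 7" "\<theta> / 7 \<le> real (Suc i) / N" "real j / N \<le> \<phi> / 7" "\<phi> / 7 \<le> real (Suc j) / N"
        "real i / N \<le> \<theta>' / 7" "\<theta>' / 7 \<le> real (Suc i) / N" "real j / N \<le> \<phi>' / 7" "\<phi>' / 7 \<le> real (Suc j) / N"
        by (auto simp: A_def split: prod.splits)
      have S: "real (Suc m) / N = real m / N + 1 / N" for m by (simp add: add_divide_distrib)
      have "\<bar>\<theta> - \<theta>'\<bar> \<le> 7 * (1 / N)" "\<bar>\<phi> - \<phi>'\<bar> \<le> 7 * (1 / N)" using *(3-) unfolding S by linarith+
      then show "dist x y \<le> 35 / N" using dist_spherical_le[of \<theta> \<phi> \<theta>' \<phi>'] * by simp
    qed (use N in auto)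
    also have "\<dots> = ennreal (real (card J) * (hausdorff_const 2 * (35 / N)\<^sup>2))"
      using hausdorff_const_pos[of 2] by (subst sum_ennreal) auto
    also have "real (card J) * (hausdorff_const 2 * (35 / N)\<^sup>2) = hausdorff_const 2 * 35\<^sup>2"
    proof -
      have "real (card J) = N * N" by (simp only: J_def card_cartesian_product card_lessThan of_nat_mult N_def)
      then show ?thesis using N by (simp add: power2_eq_square)
    qed
    finally show "hausdorff_pre 2 \<delta> (sphere 0 1 :: (real^3) set) \<le> ennreal (hausdorff_const 2 * 35\<^sup>2)" .
  qed simp
  also have "\<dots> < top" by simp
  finally show ?thesis .
qed

text \<open>One image set per piece suffices in the transfer principle; \<open>L + 1\<close> keeps
  the factor positive when \<open>L = 0\<close>.\<close>

lemma hausdorff_outer_lipschitz_image: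
  fixes f :: "'b::metric_space \<Rightarrow> 'a::metric_space"
  assumes f: "L-lipschitz_on P f"
  shows "hausdorff_outer 2 (f ` P) \<le> ennreal (2 * (L + 1)\<^sup>2) * hausdorff_outer 2 P"
proof -
  have L: "0 \<le> L" using f by (rule lipschitz_on_nonneg)
  have "hausdorff_outer 2 (f ` P) \<le> ennreal (2 * hausdorff_const 2 * (L + 1) ^ 2 * 1 / hausdorff_const 2) * hausdorff_outer 2 (id ` P)"
  proof (rule hausdorff_outer_le_of_local_covers[of _ 1])
    fix e S assume e: "(0::real) < e" and S: "S \<subseteq> P" "\<And>x y. x \<in> S \<Longrightarrow> y \<in> S \<Longrightarrow> dist (id x) (id y) \<le> e"
    have "dist (f x) (f y) \<le> (L + 1) * e" if "x \<in> S" "y \<in> S" for x y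
    proof -
      have "dist (f x) (f y) \<le> L * dist x y" using that S by (intro lipschitz_onD[OF f]) auto
      also have "\<dots> \<le> (L + 1) * e" using S(2)[OF that] L e by (intro mult_mono) auto
      finally show ?thesis .
    qed
    then show "\<exists>\<G>. finite \<G> \<and> f ` S \<subseteq> \<Union>\<G> \<and> (\<forall>G\<in>\<G>. \<forall>u\<in>G. \<forall>w\<in>G. dist u w \<le> (L + 1) * e) \<and> real (card \<G>) * e\<^sup>2 \<le> 1 * e\<^sup>2"
      by (intro exI[of _ "{f ` S}"]) auto
  qed (use L in auto)
  then show ?thesis using hausdorff_const_pos[of 2] by simp
qed

text \<open>Finiteness gives \<open>enn2real\<close> in the final statement its meaning, since an
  infinite area would be read as 0.\<close>

lemma vol_lipschitz_sphere_finite: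
  fixes f :: "real^3 \<Rightarrow> 'a::metric_space"
  assumes f: "L-lipschitz_on (sphere 0 1) f"
  shows "vol 2 f (sphere 0 1) < top"
proof -
  have "vol 2 f (sphere 0 1) \<le> ennreal (2 * (L + 1)\<^sup>2) * vol 2 id (sphere 0 1 :: (real^3) set)"
  proof (rule vol_le_vol_of_pieces)
    show "continuous_on (sphere 0 1) f" using f by (rule lipschitz_on_continuous_on)
    fix P :: "(real^3) set" assume "P \<subseteq> sphere 0 1"
    then have "L-lipschitz_on P f" using f lipschitz_on_subset by blast
    then show "hausdorff_outer 2 (f ` P) \<le> ennreal (2 * (L + 1)\<^sup>2) * hausdorff_outer 2 (id ` P)"
      using hausdorff_outer_lipschitz_image by simp
  qed (auto simp: continuous_on_id)
  moreover have "vol 2 id (sphere 0 1 :: (real^3) set) \<le> hausdorff_outer 2 (sphere 0 1 :: (real^3) set)"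
  proof -
    have "mult id (sphere 0 1) y \<le> indicator (sphere 0 1) y" for y :: "real^3"
    proof (cases "y \<in> sphere 0 1")
      case True
      have "mult id (sphere 0 1) y \<le> emeasure (count_space UNIV) {y}"
        unfolding mult_eq_emeasure_count by (intro emeasure_mono) auto
      then show ?thesis using True by simp
    qed (simp add: mult_eq_0)
    then have "vol 2 id (sphere 0 1 :: (real^3) set) \<le> (\<integral>\<^sup>+ y. indicator (sphere 0 1 :: (real^3) set) y \<partial>hausdorff_measure 2)"
      unfolding vol_def by (intro nn_integral_mono)
    also have "\<dots> = hausdorff_outer 2 (sphere 0 1 :: (real^3) set)"
      by (subst nn_integral_indicator) (auto simp: emeasure_hausdorff_measure)
    finally show ?thesis .
  qed
  then have "vol 2 id (sphere 0 1 :: (real^3) set) < top" using hausdorff_outer_sphere_finite by (rule le_less_trans)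
  ultimately show ?thesis by (simp add: ennreal_mult_less_top le_less_trans)
qed

section \<open>Fillings and concentric gluing\<close>

definition fillable :: "(real^3 \<Rightarrow> 'a::metric_space) \<Rightarrow> ennreal \<Rightarrow> bool" where
  "fillable f V \<longleftrightarrow> (\<exists>g. lipschitz (cball 0 1) g \<and> (\<forall>x\<in>sphere 0 1. g x = f x) \<and> vol 3 g (cball 0 1) \<le> V)"

lemma fillable_mono: "fillable f V \<Longrightarrow> V \<le> W \<Longrightarrow> fillable f W"
  unfolding fillable_def by (meson order_trans)

text \<open>The only nonempty fibre is infinite, but it lies over a single point, which is a null
  set, and \<open>top * 0 = 0\<close>.\<close>

lemma fillable_const: "fillable (\<lambda>_. p :: 'a::metric_space) 0"
proof -
  have "vol 3 (\<lambda>_. p) (cball 0 1 :: (real^3) set) \<le> (\<integral>\<^sup>+ y. top * indicator {p} y \<partial>hausdorff_measure 3)"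
    unfolding vol_def
  proof (intro nn_integral_mono)
    fix y show "mult (\<lambda>_. p) (cball 0 1 :: (real^3) set) y \<le> top * indicator {p} y"
      using mult_eq_0[of y "\<lambda>_. p" "cball 0 1 :: (real^3) set"] by (cases "y = p") auto
  qed
  also have "\<dots> = top * emeasure (hausdorff_measure 3) {p}" by (intro nn_integral_cmult_indicator) auto
  also have "\<dots> = 0" by (simp add: emeasure_hausdorff_measure hausdorff_outer_singleton)
  finally show ?thesis unfolding fillable_def lipschitz_def
    by (intro exI[of _ "\<lambda>_. p"]) (auto intro!: exI[of _ 0] lipschitz_onI)
qed

text \<open>A segment from the inner ball to the shell crosses the common sphere; splitting it there
  preserves the constant \<open>M\<close>.\<close>

lemma lipschitz_on_glue_cball:
  fixes g :: "'b::real_normed_vector \<Rightarrow> 'a::metric_space"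
  assumes in1: "M-lipschitz_on (cball 0 r) g" and out: "M-lipschitz_on {x. r \<le> norm x \<and> norm x \<le> R} g" and "r \<le> R"
  shows "M-lipschitz_on (cball 0 R) g"
proof -
  have mixed: "dist (g x) (g y) \<le> M * dist x y" if "norm x \<le> r" "r \<le> norm y" "norm y \<le> R" for x y
  proof -
    define w where "w t = x + t *\<^sub>R (y - x)" for t
    have "\<exists>t\<ge>0. t \<le> 1 \<and> norm (w t) = r"
      using that by (intro IVT') (auto simp: w_def intro!: continuous_intros)
    then obtain t where t: "0 \<le> t" "t \<le> 1" "norm (w t) = r" by blast
    have "w t - y = (1 - t) *\<^sub>R (x - y)" by (simp add: w_def algebra_simps)
    then have d: "dist x (w t) = t * dist x y" "dist (w t) y = (1 - t) * dist x y"
      using t by (simp_all add: dist_norm w_def norm_minus_commute)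
    have "dist (g x) (g y) \<le> dist (g x) (g (w t)) + dist (g (w t)) (g y)" by (rule dist_triangle)
    also have "\<dots> \<le> M * dist x (w t) + M * dist (w t) y"
      using that t \<open>r \<le> R\<close> by (intro add_mono lipschitz_onD[OF in1] lipschitz_onD[OF out]) auto
    also have "\<dots> = M * dist x y" unfolding d by (simp add: algebra_simps)
    finally show ?thesis .
  qed
  show ?thesis
  proof (rule lipschitz_onI)
    show "0 \<le> M" using in1 by (rule lipschitz_on_nonneg)
    fix x y :: 'b assume "x \<in> cball 0 R" "y \<in> cball 0 R"
    then consider "norm x \<le> r" "norm y \<le> r" | "norm x \<le> r" "r \<le> norm y" "norm y \<le> R"
      | "norm y \<le> r" "r \<le> norm x" "norm x \<le> R" | "r \<le> norm x" "r \<le> norm y" "norm x \<le> R" "norm y \<le> R" by fastforce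
    then show "dist (g x) (g y) \<le> M * dist x y"
    proof cases
      case 1 then show ?thesis by (intro lipschitz_onD[OF in1]) auto
    next
      case 2 then show ?thesis by (rule mixed)
    next
      case 3 then show ?thesis using mixed[of y x] by (simp add: dist_commute)
    next
      case 4 then show ?thesis by (intro lipschitz_onD[OF out]) auto
    qed
  qed
qed

text \<open>The inverse norms are at most 2; one multiple 2 comes from the difference of the
  vectors, the other from the difference of their norms.\<close>

lemma dist_normalize_le:
  fixes x y :: "'b::real_normed_vector"
  assumes "1 / 2 \<le> norm x" "1 / 2 \<le> norm y"
  shows "dist (x /\<^sub>R norm x) (y /\<^sub>R norm y) \<le> 4 * dist x y"
proof -
  have "norm (x /\<^sub>R a - y /\<^sub>R b) \<le> 4 * norm (x - y)"
    if a: "1 / 2 \<le> a" and b: "1 / 2 \<le> b" and ny: "norm y = b" and ab: "\<bar>b - a\<bar> \<le> norm (x - y)" for a b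
  proof -
    have "x /\<^sub>R a - y /\<^sub>R b = inverse a *\<^sub>R (x - y) + (inverse a - inverse b) *\<^sub>R y"
      by (simp add: scaleR_diff_left scaleR_diff_right)
    then have "norm (x /\<^sub>R a - y /\<^sub>R b) \<le> norm (inverse a *\<^sub>R (x - y)) + norm ((inverse a - inverse b) *\<^sub>R y)"
      by (simp only: norm_triangle_ineq)
    also have "norm (inverse a *\<^sub>R (x - y)) = inverse a * norm (x - y)" using a by simp
    also have "norm ((inverse a - inverse b) *\<^sub>R y) = inverse a * \<bar>b - a\<bar>"
    proof -
      have "(inverse a - inverse b) * b = inverse a * (b - a)" using a b by (simp add: left_diff_distrib right_diff_distrib)
      then have "\<bar>inverse a - inverse b\<bar> * b = inverse a * \<bar>b - a\<bar>" using a b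
        by (metis abs_mult abs_of_pos inverse_positive_iff_positive half_gt_zero_iff less_le_trans zero_less_one)
      then show ?thesis using ny by simp
    qed
    also have "inverse a * norm (x - y) + inverse a * \<bar>b - a\<bar> \<le> 2 * norm (x - y) + 2 * norm (x - y)"
    proof -
      have "inverse a \<le> inverse (1 / 2)" using a by (intro le_imp_inverse_le) auto
      then have "inverse a \<le> 2" by simp
      then show ?thesis using ab a by (intro add_mono mult_mono) auto
    qed
    finally show ?thesis by simp
  qed
  moreover have "\<bar>norm y - norm x\<bar> \<le> norm (x - y)" using norm_triangle_ineq3[of x y] by simp
  ultimately show ?thesis unfolding dist_norm using assms by blast
qed

text \<open>Concentric gluing: the homotopy occupies the shell between the spheres of radius 1/2 and 1, and a
  filling of its end map, rescaled, the ball of radius 1/2.\<close>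

lemma fillable_homotopy:
  fixes f f' :: "real^3 \<Rightarrow> 'a::metric_space"
  assumes M: "0 \<le> M"
    and lip: "\<And>s t x y. s \<in> {0..1} \<Longrightarrow> t \<in> {0..1} \<Longrightarrow> x \<in> sphere 0 1 \<Longrightarrow> y \<in> sphere 0 1 \<Longrightarrow>
      dist (H s x) (H t y) \<le> M * (\<bar>s - t\<bar> + dist x y)"
    and H0: "\<And>x. x \<in> sphere 0 1 \<Longrightarrow> H 0 x = f x" and H1: "\<And>x. x \<in> sphere 0 1 \<Longrightarrow> H 1 x = f' x"
    and I: "finite I" and D: "\<And>i. i \<in> I \<Longrightarrow> compact (D i)" "sphere 0 1 = (\<Union>i\<in>I. D i)"
    and q: "\<And>i. i \<in> I \<Longrightarrow> 0 \<le> q i"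
    and bound: "\<And>i P a b. i \<in> I \<Longrightarrow> P \<subseteq> D i \<Longrightarrow> 0 \<le> a \<Longrightarrow> a < b \<Longrightarrow> b \<le> 1 \<Longrightarrow>
      hausdorff_outer 3 ((\<lambda>(t, x). H t x) ` ({a..b} \<times> P)) \<le> ennreal (q i * (b - a)) * hausdorff_outer 2 (f ` P)"
    and fill: "fillable f' V"
  shows "fillable f (V + (\<Sum>i\<in>I. ennreal (q i) * vol 2 f (D i)))"
proof -
  obtain g' where g': "lipschitz (cball 0 1) g'" "\<And>x. x \<in> sphere 0 1 \<Longrightarrow> g' x = f' x" "vol 3 g' (cball 0 1) \<le> V"
    using fill unfolding fillable_def by auto
  then obtain L where L: "L-lipschitz_on (cball 0 1) g'" by (auto simp: lipschitz_def)
  have L0: "0 \<le> L" using L by (rule lipschitz_on_nonneg)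
  \<comment> \<open>Cylinder coordinates on the shell: the direction \<open>p\<close>, and a height
    \<open>s\<close> that runs from 0 on the unit sphere to 1 on the sphere of radius 1/2.\<close>
  define p where "p x = x /\<^sub>R norm x" for x :: "real^3"
  define s where "s x = 2 - 2 * norm x" for x :: "real^3"
  define g where "g x = (if norm x \<le> 1/2 then g' (2 *\<^sub>R x) else H (s x) (p x))" for x
  define shell where "shell = {x :: real^3. 1/2 \<le> norm x \<and> norm x \<le> 1}"
  have ps: "p x \<in> sphere 0 1" "s x \<in> {0..1}" if "x \<in> shell" for x
  proof -
    have "norm x \<noteq> 0" using that by (auto simp: shell_def)
    then show "p x \<in> sphere 0 1" by (simp add: p_def)
    show "s x \<in> {0..1}" using that by (auto simp: shell_def s_def)
  qed
  have gshell: "g x = H (s x) (p x)" if "x \<in> shell" for x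
  proof (cases "norm x = 1/2")
    case True
    then have "g x = g' (2 *\<^sub>R x)" by (simp add: g_def)
    also have "2 *\<^sub>R x = p x" unfolding p_def True by simp
    also have "g' (p x) = H 1 (p x)" using g'(2) H1 ps[OF that] by simp
    moreover have "s x = 1" unfolding s_def True by simp
    ultimately show ?thesis by simp
  next
    case False
    then show ?thesis using that by (simp add: g_def shell_def)
  qed
  \<comment> \<open>\<open>2 * L\<close> comes from rescaling the inner ball; \<open>6 * M\<close>
    comes from the Lipschitz constants 2 of \<open>s\<close> and 4 of \<open>p\<close> on the
    shell.\<close>
  define K where "K = 2 * L + 6 * M"
  have in1: "K-lipschitz_on (cball 0 (1/2)) g"
  proof (rule lipschitz_onI)
    fix x y :: "real^3" assume "x \<in> cball 0 (1/2)" "y \<in> cball 0 (1/2)"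
    then have "dist (g x) (g y) \<le> L * dist (2 *\<^sub>R x) (2 *\<^sub>R y)"
      unfolding g_def by simp (intro lipschitz_onD[OF L], auto)
    also have "dist (2 *\<^sub>R x) (2 *\<^sub>R y) = 2 * dist x y" by (simp add: dist_norm flip: scaleR_diff_right)
    also have "L * (2 * dist x y) \<le> K * dist x y" using M by (simp add: K_def algebra_simps)
    finally show "dist (g x) (g y) \<le> K * dist x y" .
  qed (use L0 M in \<open>auto simp: K_def\<close>)
  have out: "K-lipschitz_on shell g"
  proof (rule lipschitz_onI)
    fix x y assume xy: "x \<in> shell" "y \<in> shell"
    have "dist (g x) (g y) \<le> M * (\<bar>s x - s y\<bar> + dist (p x) (p y))"
      unfolding gshell[OF xy(1)] gshell[OF xy(2)] using ps xy by (intro lip) auto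
    also have "\<dots> \<le> M * (2 * dist x y + 4 * dist x y)"
    proof (intro mult_left_mono add_mono M)
      have "\<bar>norm x - norm y\<bar> \<le> dist x y" unfolding dist_norm by (rule norm_triangle_ineq3)
      then show "\<bar>s x - s y\<bar> \<le> 2 * dist x y" unfolding s_def by linarith
      show "dist (p x) (p y) \<le> 4 * dist x y" unfolding p_def using xy by (intro dist_normalize_le) (auto simp: shell_def)
    qed
    also have "\<dots> \<le> K * dist x y" using L0 by (simp add: K_def algebra_simps)
    finally show "dist (g x) (g y) \<le> K * dist x y" .
  qed (use L0 M in \<open>auto simp: K_def\<close>)
  have glip: "K-lipschitz_on (cball 0 1) g"
    using in1 out unfolding shell_def by (rule lipschitz_on_glue_cball) simp
  have gcont: "continuous_on (cball 0 1) g" using glip by (rule lipschitz_on_continuous_on)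
  define E where "E i = (\<lambda>(r, x). r *\<^sub>R x) ` ({1/2..1::real} \<times> D i)" for i
  have Dsub: "D i \<subseteq> sphere 0 1" if "i \<in> I" for i using D that by blast
  have Eshell: "E i \<subseteq> shell" if "i \<in> I" for i
    using Dsub[OF that] by (auto simp: E_def shell_def)
  have pE: "p ` E i \<subseteq> D i" if "i \<in> I" for i
    using Dsub[OF that] by (auto simp: E_def p_def)
  have Ecpt: "compact (E i)" if "i \<in> I" for i
    unfolding E_def using D(1)[OF that] by (intro compact_continuous_image compact_Times) (auto simp: case_prod_beta intro!: continuous_intros)
  have shellE: "shell = (\<Union>i\<in>I. E i)"
  proof (intro equalityI subsetI)
    fix x assume x: "x \<in> shell"
    then obtain i where i: "i \<in> I" "p x \<in> D i" using ps D by blast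
    have "norm x \<noteq> 0" using x by (auto simp: shell_def)
    then have "x = norm x *\<^sub>R p x" by (simp add: p_def)
    then have "x \<in> E i" unfolding E_def using i x by (auto simp: shell_def intro!: rev_image_eqI[of "(norm x, p x)"])
    then show "x \<in> (\<Union>i\<in>I. E i)" using i by blast
  qed (use Eshell in blast)
  have contE: "continuous_on (E i) g" if "i \<in> I" for i
    using gcont by (rule continuous_on_subset) (use Eshell[OF that] in \<open>auto simp: shell_def\<close>)
  have fcont: "continuous_on (sphere 0 1) f"
  proof -
    have "M-lipschitz_on (sphere 0 1) f"
    proof (rule lipschitz_onI[OF _ M])
      fix x y :: "real^3" assume "x \<in> sphere 0 1" "y \<in> sphere 0 1"
      then show "dist (f x) (f y) \<le> M * dist x y" using lip[of 0 0 x y] H0[of x] H0[of y] by simp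
    qed
    then show ?thesis by (rule lipschitz_on_continuous_on)
  qed
  have shell_vol: "vol 3 g (E i) \<le> ennreal (q i) * vol 2 f (D i)" if i: "i \<in> I" for i
  proof (rule vol_le_vol_of_cylinders[where p = p and s = s])
    show "continuous_on (D i) f" using fcont Dsub[OF i] by (rule continuous_on_subset)
    show "continuous_on (E i) p" unfolding p_def
      using Eshell[OF i] by (intro continuous_intros) (auto simp: shell_def)
    show "continuous_on (E i) s" unfolding s_def by (intro continuous_intros)
    show "0 \<le> s x \<and> s x \<le> 1" if "x \<in> E i" for x using ps(2)[of x] Eshell[OF i] that by auto
    show "x = y" if "x \<in> E i" "y \<in> E i" "p x = p y" "s x = s y" for x y
    proof -
      have "norm x = norm y" using that by (simp add: s_def)
      moreover have "norm x \<noteq> 0" using Eshell[OF i] that by (auto simp: shell_def)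
      ultimately show ?thesis using that(3) by (auto simp: p_def)
    qed
    fix P a b assume P: "P \<subseteq> D i" and ab: "0 \<le> a" "a < b" "b \<le> (1::real)"
    have "g ` {x \<in> E i. p x \<in> P \<and> a \<le> s x \<and> s x \<le> b} \<subseteq> (\<lambda>(t, x). H t x) ` ({a..b} \<times> P)"
    proof
      fix z assume "z \<in> g ` {x \<in> E i. p x \<in> P \<and> a \<le> s x \<and> s x \<le> b}"
      then obtain x where x: "x \<in> E i" "p x \<in> P" "a \<le> s x" "s x \<le> b" "z = g x" by blast
      then have "z = H (s x) (p x)" using gshell Eshell[OF i] by auto
      then show "z \<in> (\<lambda>(t, x). H t x) ` ({a..b} \<times> P)" using x by (intro rev_image_eqI[of "(s x, p x)"]) auto
    qed
    then show "hausdorff_outer 3 (g ` {x \<in> E i. p x \<in> P \<and> a \<le> s x \<and> s x \<le> b}) \<le> ennreal (q i * (b - a)) * hausdorff_outer 2 (f ` P)"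
      using bound[OF i P ab] hausdorff_outer_mono order_trans by blast
  qed (use i q D Ecpt contE pE in auto)
  have "vol 3 g (cball 0 1) \<le> vol 3 g (cball 0 (1/2) \<union> shell)"
    by (intro vol_mono) (auto simp: shell_def)
  also have "\<dots> \<le> vol 3 g (cball 0 (1/2)) + vol 3 g shell"
  proof (rule vol_Un_le)
    show "compact shell" unfolding shellE using I Ecpt by (intro compact_UN) auto
  qed (auto intro!: continuous_on_subset[OF gcont] simp: shell_def)
  also have "vol 3 g (cball 0 (1/2)) = vol 3 g' (cball 0 1)"
  proof (rule vol_reparam[where \<phi> = "\<lambda>x. 2 *\<^sub>R x"])
    show "bij_betw (\<lambda>x. 2 *\<^sub>R x) (cball 0 (1/2)) (cball 0 1 :: (real^3) set)"
      by (rule bij_betw_byWitness[where f' = "\<lambda>x. x /\<^sub>R 2"]) auto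
  qed (auto simp: g_def)
  also have "vol 3 g shell \<le> (\<Sum>i\<in>I. vol 3 g (E i))" unfolding shellE using I Ecpt contE by (intro vol_UN_le)
  also have "\<dots> \<le> (\<Sum>i\<in>I. ennreal (q i) * vol 2 f (D i))" by (intro sum_mono shell_vol)
  finally have "vol 3 g (cball 0 1) \<le> vol 3 g' (cball 0 1) + (\<Sum>i\<in>I. ennreal (q i) * vol 2 f (D i))" by (simp add: add_left_mono)
  also have "\<dots> \<le> V + (\<Sum>i\<in>I. ennreal (q i) * vol 2 f (D i))" using g'(3) by (rule add_right_mono)
  finally have "vol 3 g (cball 0 1) \<le> V + (\<Sum>i\<in>I. ennreal (q i) * vol 2 f (D i))" .
  moreover have "g x = f x" if "x \<in> sphere 0 1" for x
  proof -
    have "x \<in> shell" "p x = x" "s x = 0" using that by (auto simp: shell_def p_def s_def)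
    then show ?thesis using gshell[of x] H0[OF that] by simp
  qed
  ultimately show ?thesis unfolding fillable_def lipschitz_def using glip by blast
qed

section \<open>Thin slabs\<close>

text \<open>A new set \<open>C\<close> is united with all members that it meets. Two points of the
  union are joined by a chain through \<open>C\<close> that uses at most two of those members, so
  the diameter of the union is at most the sum of the diameters that are merged.\<close>

lemma merge_overlapping_sets:
  fixes \<C> :: "'a::metric_space set set"
  assumes "finite \<C>" "\<And>C. C \<in> \<C> \<Longrightarrow> compact C"
  shows "\<exists>\<D>. finite \<D> \<and> disjoint \<D> \<and> (\<forall>D\<in>\<D>. compact D) \<and> \<Union>\<D> = \<Union>\<C> \<and> sum diameter \<D> \<le> sum diameter \<C>"
  using assms
proof (induction \<C>)
  case empty
  show ?case by (intro exI[of _ "{}"]) auto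
next
  case (insert C \<C>)
  then obtain \<D> where \<D>: "finite \<D>" "disjoint \<D>" "\<And>D. D \<in> \<D> \<Longrightarrow> compact D" "\<Union>\<D> = \<Union>\<C>" "sum diameter \<D> \<le> sum diameter \<C>"
    by auto
  define M where "M = {D \<in> \<D>. D \<inter> C \<noteq> {}}"
  define D' where "D' = C \<union> \<Union>M"
  have M: "finite M" "M \<subseteq> \<D>" using \<D> by (auto simp: M_def)
  have cC: "compact C" using insert by auto
  have d0: "0 \<le> diameter D" if "compact D" for D :: "'a set"
    using that by (intro diameter_ge_0 compact_imp_bounded)
  have C0: "0 \<le> diameter C" using cC by (rule d0)
  have dd: "dist x y \<le> diameter D" if "compact D" "x \<in> D" "y \<in> D" for D :: "'a set" and x y
    using that by (intro diameter_bounded_bound compact_imp_bounded)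
  have two: "diameter D1 + diameter D2 \<le> sum diameter M" if "D1 \<in> M" "D2 \<in> M" "D1 \<noteq> D2" for D1 D2
  proof -
    have "sum diameter {D1, D2} \<le> sum diameter M" using that M \<D> by (intro sum_mono2) (auto intro!: d0)
    then show ?thesis using that by simp
  qed
  have one: "diameter D1 \<le> sum diameter M" if "D1 \<in> M" for D1
  proof -
    have "sum diameter {D1} \<le> sum diameter M" using that M \<D> by (intro sum_mono2) (auto intro!: d0)
    then show ?thesis by simp
  qed
  have M0: "0 \<le> sum diameter M" using M \<D> by (intro sum_nonneg d0) auto
  have CM: "dist x y \<le> diameter C + diameter D" if "x \<in> C" "y \<in> D" "D \<in> M" for x y D
  proof -
    obtain w where w: "w \<in> D" "w \<in> C" using \<open>D \<in> M\<close> by (auto simp: M_def)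
    have "dist x w \<le> diameter C" "dist w y \<le> diameter D" using w that M \<D> cC by (auto intro!: dd)
    then show ?thesis using dist_triangle[of x y w] by linarith
  qed
  have diamD': "diameter D' \<le> diameter C + sum diameter M"
  proof (rule diameter_leI)
    show "0 \<le> diameter C + sum diameter M" using C0 M0 by simp
    fix x y assume "x \<in> D'" "y \<in> D'"
    then consider "x \<in> C" "y \<in> C" | D where "x \<in> C" "y \<in> D" "D \<in> M" | D where "x \<in> D" "y \<in> C" "D \<in> M"
      | D1 D2 where "x \<in> D1" "y \<in> D2" "D1 \<in> M" "D2 \<in> M" by (auto simp: D'_def)
    then show "dist x y \<le> diameter C + sum diameter M"
    proof cases
      case 1 then show ?thesis using dd[OF cC, of x y] M0 by linarith
    next
      case 2 then show ?thesis using CM[of x y D] one[of D] by linarith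
    next
      case 3 then show ?thesis using CM[of y x D] one[of D] by (simp add: dist_commute)
    next
      case 4
      show ?thesis
      proof (cases "D1 = D2")
        case True
        then have "dist x y \<le> diameter D1" using 4 M \<D> by (intro dd) auto
        then show ?thesis using one[of D1] 4 C0 by linarith
      next
        case False
        obtain w where w: "w \<in> D1" "w \<in> C" using 4 by (auto simp: M_def)
        have "dist x w \<le> diameter D1" using w 4 M \<D> by (intro dd) auto
        moreover have "dist w y \<le> diameter C + diameter D2" using w 4 by (intro CM)
        ultimately show ?thesis using two[OF 4(3,4) False] dist_triangle[of x y w] by linarith
      qed
    qed
  qed
  have cD': "compact D'" unfolding D'_def using cC M \<D> by (intro compact_Un compact_Union) auto
  have "sum diameter (insert D' (\<D> - M)) \<le> diameter D' + sum diameter (\<D> - M)"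
    using \<D> d0[OF cD'] by (simp add: sum.insert_if)
  also have "\<dots> \<le> diameter C + (sum diameter M + sum diameter (\<D> - M))" using diamD' by simp
  also have "sum diameter M + sum diameter (\<D> - M) = sum diameter \<D>" using M \<D> by (metis add.commute sum.subset_diff)
  also have "diameter C + sum diameter \<D> \<le> sum diameter (insert C \<C>)" using insert \<D> by simp
  finally have "sum diameter (insert D' (\<D> - M)) \<le> sum diameter (insert C \<C>)" .
  moreover have "\<Union> (insert D' (\<D> - M)) = \<Union> (insert C \<C>)"
  proof -
    have "\<Union>M \<union> \<Union>(\<D> - M) = \<Union>\<D>" using M by blast
    then show ?thesis using \<D>(4) unfolding D'_def by auto
  qed
  moreover have "disjoint (insert D' (\<D> - M))"
  proof -
    have "D' \<inter> D = {}" if "D \<in> \<D> - M" for D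
    proof -
      have "C \<inter> D = {}" using that by (auto simp: M_def)
      moreover have "D1 \<inter> D = {}" if "D1 \<in> M" for D1
        using \<open>D \<in> \<D> - M\<close> that M(2) \<D>(2) unfolding disjoint_def by (metis Diff_iff subsetD)
      then have "\<Union>M \<inter> D = {}" by blast
      ultimately show ?thesis by (auto simp: D'_def)
    qed
    then have 1: "D' \<inter> D = {}" "D \<inter> D' = {}" if "D \<in> \<D> - M" for D using that by (auto simp: Int_commute)
    show ?thesis unfolding disjoint_def
    proof (intro ballI impI)
      fix a b assume "a \<in> insert D' (\<D> - M)" "b \<in> insert D' (\<D> - M)" "a \<noteq> b"
      then show "a \<inter> b = {}" using 1 \<D>(2) unfolding disjoint_def by (metis Diff_iff insertE)
    qed
  qed
  ultimately show ?case using \<D> cD' by (intro exI[of _ "insert D' (\<D> - M)"]) auto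
qed

lemma compact_closed_gap:
  fixes S T :: "'a::metric_space set"
  assumes S: "compact S" and T: "closed T" "S \<inter> T = {}"
  shows "\<exists>d>0. \<forall>x\<in>S. \<forall>y\<in>T. d \<le> dist x y"
proof (cases "S = {} \<or> T = {}")
  case True
  then show ?thesis by (auto intro: exI[of _ 1])
next
  case False
  have "continuous_on S (\<lambda>x. infdist x T)" by (intro continuous_intros)
  with S False obtain a where a: "a \<in> S" "\<And>x. x \<in> S \<Longrightarrow> infdist a T \<le> infdist x T"
    using continuous_attains_inf[of S "\<lambda>x. infdist x T"] by blast
  have "0 < infdist a T" using a T False by (intro infdist_pos_not_in_closed) auto
  moreover have "infdist a T \<le> dist x y" if "x \<in> S" "y \<in> T" for x y
    using a(2)[OF that(1)] infdist_le[OF that(2), of x] by linarith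
  ultimately show ?thesis by blast
qed

text \<open>The disjoint compact clusters have a positive mutual gap \<eta>. One chosen point in
  each cluster gives a map that is constant at scales below \<eta> and moves no point further than
  the total diameter.\<close>

lemma locally_constant_selection:
  fixes \<C> :: "'a::metric_space set set"
  assumes "finite \<C>" "\<And>C. C \<in> \<C> \<Longrightarrow> compact C"
  obtains z \<eta> where "0 < \<eta>" "\<And>y. y \<in> \<Union>\<C> \<Longrightarrow> z y \<in> \<Union>\<C>" "\<And>y. y \<in> \<Union>\<C> \<Longrightarrow> dist y (z y) \<le> sum diameter \<C>"
    "\<And>y y'. y \<in> \<Union>\<C> \<Longrightarrow> y' \<in> \<Union>\<C> \<Longrightarrow> dist y y' < \<eta> \<Longrightarrow> z y = z y'" "finite (z ` \<Union>\<C>)"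
proof -
  have "\<exists>\<D>. finite \<D> \<and> disjoint \<D> \<and> (\<forall>D\<in>\<D>. compact D) \<and> \<Union>\<D> = \<Union>\<C> \<and> sum diameter \<D> \<le> sum diameter \<C>"
    using assms by (intro merge_overlapping_sets)
  then obtain \<D> where \<D>: "finite \<D>" "disjoint \<D>" "\<And>D. D \<in> \<D> \<Longrightarrow> compact D" "\<Union>\<D> = \<Union>\<C>" "sum diameter \<D> \<le> sum diameter \<C>"
    by (elim exE conjE) simp
  have "\<exists>d>0. \<forall>x\<in>D. \<forall>y\<in>\<Union>(\<D> - {D}). d \<le> dist x y" if "D \<in> \<D>" for D
  proof (rule compact_closed_gap)
    show "compact D" using \<D> that by auto
    show "closed (\<Union>(\<D> - {D}))" using \<D> by (intro closed_Union) (auto intro: compact_imp_closed)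
    have "D \<inter> D1 = {}" if "D1 \<in> \<D> - {D}" for D1 using \<D>(2) \<open>D \<in> \<D>\<close> that unfolding disjoint_def by (metis Diff_iff singletonI)
    then show "D \<inter> \<Union>(\<D> - {D}) = {}" by auto
  qed
  then obtain d where d: "\<And>D. D \<in> \<D> \<Longrightarrow> 0 < d D" "\<And>D x y. D \<in> \<D> \<Longrightarrow> x \<in> D \<Longrightarrow> y \<in> \<Union>(\<D> - {D}) \<Longrightarrow> d D \<le> dist x y" by metis
  define \<eta> where "\<eta> = Min (insert 1 (d ` \<D>))"
  have \<eta>: "0 < \<eta>" using d \<D> by (auto simp: \<eta>_def)
  have \<eta>d: "\<eta> \<le> d D" if "D \<in> \<D>" for D unfolding \<eta>_def using that \<D> by (intro Min_le) auto
  define c where "c D = (SOME w. w \<in> D)" for D :: "'a set"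
  define cl where "cl y = (SOME D. D \<in> \<D> \<and> y \<in> D)" for y
  have cl: "cl y \<in> \<D> \<and> y \<in> cl y" if "y \<in> \<Union>\<C>" for y
  proof -
    have "y \<in> \<Union>\<D>" using that \<D>(4) by simp
    then have "\<exists>D. D \<in> \<D> \<and> y \<in> D" by auto
    then show ?thesis unfolding cl_def by (rule someI_ex)
  qed
  have c: "c (cl y) \<in> cl y" if "y \<in> \<Union>\<C>" for y
    unfolding c_def using cl[OF that, THEN conjunct2] by (rule someI)
  show ?thesis
  proof (rule that[of \<eta> "\<lambda>y. c (cl y)"])
    show "0 < \<eta>" by (rule \<eta>)
    show "c (cl y) \<in> \<Union>\<C>" if "y \<in> \<Union>\<C>" for y
      unfolding \<D>(4)[symmetric] using c[OF that] cl[OF that] by (intro UnionI) auto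
    show "dist y (c (cl y)) \<le> sum diameter \<C>" if "y \<in> \<Union>\<C>" for y
    proof -
      have "dist y (c (cl y)) \<le> diameter (cl y)" using c[OF that] cl[OF that] \<D>(3) by (intro diameter_bounded_bound compact_imp_bounded) auto
      also have "\<dots> \<le> sum diameter \<D>" using cl[OF that] \<D> by (intro member_le_sum) (auto intro!: diameter_ge_0 compact_imp_bounded)
      finally show ?thesis using \<D>(5) by linarith
    qed
    show "c (cl y) = c (cl y')" if "y \<in> \<Union>\<C>" "y' \<in> \<Union>\<C>" "dist y y' < \<eta>" for y y'
    proof (rule ccontr)
      assume "c (cl y) \<noteq> c (cl y')"
      then have "cl y \<noteq> cl y'" by auto
      then have "d (cl y) \<le> dist y y'" using cl[OF that(1)] cl[OF that(2)] by (intro d) auto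
      then show False using \<eta>d[of "cl y"] cl[OF that(1)] that(3) by auto
    qed
    have "(\<lambda>y. c (cl y)) ` \<Union>\<C> \<subseteq> c ` \<D>" by (intro image_subsetI imageI cl[THEN conjunct1])
    then show "finite ((\<lambda>y. c (cl y)) ` \<Union>\<C>)" using finite_imageI[OF \<D>(1)] by (rule finite_subset)
  qed
qed

section \<open>Slabs of small area and small total diameter\<close>

lemma compact_preimage_closed:
  fixes f :: "'b::t2_space \<Rightarrow> 'a::topological_space"
  assumes "compact S" "continuous_on S f" "closed F"
  shows "compact (S \<inter> f -` F)"
proof -
  have "closed (S \<inter> f -` F)" using assms by (intro continuous_closed_preimage compact_imp_closed)
  then have "compact (S \<inter> (S \<inter> f -` F))" using assms(1) by (intro compact_Int_closed)
  then show ?thesis by (simp add: Int_assoc[symmetric])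
qed

text \<open>A near-optimal cover is fattened to open sets, made finite by compactness, and then
  closed. What is controlled is the sum of the squares of the sizes; the pigeonhole over slabs
  trades it for a plain sum of sizes.\<close>

lemma finite_open_cover_with_diameters:
  fixes Y :: "'a::metric_space set"
  assumes Y: "compact Y" and M: "0 < M" "hausdorff_outer 2 Y \<le> ennreal M"
  obtains N :: "nat set" and A e where "finite N" "Y = (\<Union>i\<in>N. A i)" "\<And>i. i \<in> N \<Longrightarrow> compact (A i)"
    "\<And>i. 0 < e i" "\<And>i x y. x \<in> A i \<Longrightarrow> y \<in> A i \<Longrightarrow> dist x y \<le> e i" "(\<Sum>i\<in>N. (e i)\<^sup>2) \<le> (4 / hausdorff_const 2 + 1) * M"
proof -
  define \<kappa> where "\<kappa> = hausdorff_const 2"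
  have \<kappa>: "0 < \<kappa>" using hausdorff_const_pos by (simp add: \<kappa>_def)
  have "hausdorff_pre 2 1 Y \<le> hausdorff_outer 2 Y" by (rule hausdorff_pre_le_outer) simp
  also have "\<dots> \<le> ennreal M" by (rule M)
  also have "\<dots> < ennreal (2 * M)" using M by (simp add: ennreal_lessI)
  finally obtain C :: "nat \<Rightarrow> 'a set" where C: "Y \<subseteq> (\<Union>i. C i)" "\<And>i. bounded (C i)"
      "(\<Sum>i. ennreal (\<kappa> * diameter (C i) ^ 2)) < ennreal (2 * M)"
    unfolding \<kappa>_def by (rule hausdorff_pre_approx) blast
  \<comment> \<open>Fattening adds at most \<open>8 * \<theta> \<le> M\<close> to the sum of
    squares.\<close>
  define \<theta> where "\<theta> = min 1 (M / 8)"
  define \<epsilon> where "\<epsilon> i = \<theta> * (1/2) ^ Suc i" for i :: nat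
  define e where "e i = diameter (C i) + 2 * \<epsilon> i" for i
  define U where "U i = (\<Union>c\<in>C i. ball c (\<epsilon> i))" for i
  have \<theta>: "0 < \<theta>" "\<theta> \<le> 1" "8 * \<theta> \<le> M" using M by (auto simp: \<theta>_def)
  have \<epsilon>: "0 < \<epsilon> i" "\<epsilon> i \<le> 1" for i
  proof -
    have "(1/2 :: real) ^ Suc i \<le> 1" by (intro power_le_one) auto
    then have "\<theta> * (1/2) ^ Suc i \<le> 1 * 1" using \<theta> by (intro mult_mono) auto
    then show "0 < \<epsilon> i" "\<epsilon> i \<le> 1" using \<theta> by (auto simp: \<epsilon>_def)
  qed
  have d0: "0 \<le> diameter (C i)" for i using C by (intro diameter_ge_0)
  have e: "0 < e i" for i using d0[of i] \<epsilon>[of i] by (simp add: e_def)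
  have Ud: "dist x y \<le> e i" if "x \<in> U i" "y \<in> U i" for i x y
  proof -
    obtain c c' where c: "c \<in> C i" "c' \<in> C i" "dist c x < \<epsilon> i" "dist c' y < \<epsilon> i" using \<open>x \<in> U i\<close> \<open>y \<in> U i\<close> by (auto simp: U_def)
    have "dist c c' \<le> diameter (C i)" using c C by (intro diameter_bounded_bound)
    then show ?thesis unfolding e_def
      using c dist_triangle[of x y c] dist_triangle[of c y c'] dist_commute[of c x] by linarith
  qed
  have Ub: "bounded (U i)" for i using Ud bounded_two_points by blast
  have Udiam: "diameter (U i) \<le> e i" for i using Ud e[of i] by (intro diameter_leI) auto
  have "C i \<subseteq> U i" for i using \<epsilon>(1)[of i] by (auto simp: U_def)
  then have "Y \<subseteq> (\<Union>i\<in>UNIV. U i)" using C(1) by fastforce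
  moreover have "open (U i)" for i by (auto simp: U_def)
  ultimately obtain N where N: "finite N" "Y \<subseteq> (\<Union>i\<in>N. U i)" using compactE_image[OF Y, of UNIV U] by auto
  define A where "A i = Y \<inter> closure (U i)" for i
  have sumbound: "(\<Sum>i\<in>N. (e i)\<^sup>2) \<le> (4 / \<kappa> + 1) * M"
  proof -
    have "ennreal (\<Sum>i\<in>N. \<kappa> * (diameter (C i))\<^sup>2) = (\<Sum>i\<in>N. ennreal (\<kappa> * (diameter (C i))\<^sup>2))"
      using \<kappa> by (subst sum_ennreal) auto
    also have "\<dots> \<le> (\<Sum>i. ennreal (\<kappa> * (diameter (C i))\<^sup>2))" using N by (intro sum_le_suminf) auto
    also have "\<dots> \<le> ennreal (2 * M)" using C(3) by simp
    finally have "(\<Sum>i\<in>N. \<kappa> * (diameter (C i))\<^sup>2) \<le> 2 * M" using M by (simp add: ennreal_le_iff)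
    then have 1: "(\<Sum>i\<in>N. (diameter (C i))\<^sup>2) \<le> 2 * M / \<kappa>" using \<kappa> by (simp add: field_simps flip: sum_distrib_left)
    have "ennreal (\<Sum>i\<in>N. \<epsilon> i) = (\<Sum>i\<in>N. ennreal (\<epsilon> i))" using \<epsilon> by (subst sum_ennreal) (auto intro: less_imp_le)
    also have "\<dots> \<le> (\<Sum>i. ennreal (\<epsilon> i))" using N by (intro sum_le_suminf) auto
    also have "\<dots> = ennreal \<theta>" unfolding \<epsilon>_def using \<theta> by (intro suminf_ennreal_half) auto
    finally have 2: "(\<Sum>i\<in>N. \<epsilon> i) \<le> \<theta>" using \<theta> by (simp add: ennreal_le_iff)
    have "(e i)\<^sup>2 \<le> 2 * (diameter (C i))\<^sup>2 + 8 * \<epsilon> i" for i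
    proof -
      have "(e i)\<^sup>2 \<le> 2 * (diameter (C i))\<^sup>2 + 8 * (\<epsilon> i)\<^sup>2"
        using zero_le_power2[of "diameter (C i) - 2 * \<epsilon> i"] by (simp add: e_def power2_eq_square algebra_simps)
      moreover have "(\<epsilon> i)\<^sup>2 \<le> \<epsilon> i" using \<epsilon>[of i] by (simp add: power2_eq_square mult_left_le)
      ultimately show ?thesis by linarith
    qed
    then have "(\<Sum>i\<in>N. (e i)\<^sup>2) \<le> (\<Sum>i\<in>N. 2 * (diameter (C i))\<^sup>2 + 8 * \<epsilon> i)" by (intro sum_mono)
    also have "\<dots> = 2 * (\<Sum>i\<in>N. (diameter (C i))\<^sup>2) + 8 * (\<Sum>i\<in>N. \<epsilon> i)" by (simp add: sum.distrib sum_distrib_left)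
    also have "\<dots> \<le> 2 * (2 * M / \<kappa>) + M" using 1 2 \<theta> by linarith
    finally show ?thesis by (simp add: algebra_simps)
  qed
  show ?thesis
  proof (rule that[of N A e])
    show "Y = (\<Union>i\<in>N. A i)" using N(2) closure_subset unfolding A_def by blast
    show "compact (A i)" if "i \<in> N" for i unfolding A_def using Y by (intro compact_Int_closed) auto
    show "dist x y \<le> e i" if "x \<in> A i" "y \<in> A i" for i x y
    proof -
      have "dist x y \<le> diameter (closure (U i))" using that Ub[of i] by (intro diameter_bounded_bound) (auto simp: A_def)
      also have "\<dots> = diameter (U i)" using Ub by (rule diameter_closure)
      finally show ?thesis using Udiam[of i] by linarith
    qed
    show "(\<Sum>i\<in>N. (e i)\<^sup>2) \<le> (4 / hausdorff_const 2 + 1) * M" using sumbound by (simp add: \<kappa>_def)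
  qed (use N e in auto)
qed

lemma card_le_of_spread:
  fixes S :: "nat set"
  assumes "finite S" "\<And>i j. i \<in> S \<Longrightarrow> j \<in> S \<Longrightarrow> i \<le> j \<Longrightarrow> real (j - i) \<le> B" "0 \<le> B"
  shows "real (card S) \<le> B + 1"
proof (cases "S = {}")
  case False
  define a where "a = Min S"
  define b where "b = Max S"
  have ab: "a \<in> S" "b \<in> S" "a \<le> b" using assms False by (auto simp: a_def b_def)
  have "S \<subseteq> {a..b}" using assms False by (auto simp: a_def b_def)
  then have "card S \<le> card {a..b}" by (intro card_mono) auto
  also have "\<dots> = b - a + 1" using ab by simp
  finally have "real (card S) \<le> real (b - a) + 1" by simp
  then show ?thesis using assms(2)[OF ab] by linarith
qed (use assms in simp)

text \<open>The pigeonhole yields \<open>4 / hausdorff_const 2 + 1\<close> from the squares of the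
  cover, 1 from rounding in the count of slabs and 1 from the area; the outer 4 converts the spacing
  \<open>w\<close> into \<open>\<delta> = w / 4\<close>.\<close>

definition slab_const :: real where
  "slab_const = 4 * (4 / hausdorff_const 2 + 3)"

lemma slab_const_ge: "12 \<le> slab_const"
  using hausdorff_const_pos[of 2] by (simp add: slab_const_def)

text \<open>Pigeonhole over equally spaced disjoint slabs; this replaces the coarea inequality.\<close>

lemma thin_slab_exists:
  fixes f :: "'b::euclidean_space \<Rightarrow> 'a::metric_space"
  assumes S: "compact S" and f: "continuous_on S f" and \<rho>: "0 < \<rho>" and \<epsilon>: "0 < \<epsilon>"
    and M: "0 < M" "vol 2 f (S \<inter> f -` cball t (2 * \<rho>)) \<le> ennreal M"
  obtains r \<delta> \<C> where "0 < \<delta>" "\<delta> \<le> \<epsilon>" "\<rho> \<le> r - 2 * \<delta>" "r \<le> 2 * \<rho>"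
    "vol 2 f (S \<inter> f -` {y. r - 2 * \<delta> \<le> dist t y \<and> dist t y \<le> r}) \<le> ennreal (slab_const * M * \<delta> / \<rho>)"
    "finite \<C>" "\<And>C. C \<in> \<C> \<Longrightarrow> compact C" "\<Union>\<C> = f ` S \<inter> {y. r - 2 * \<delta> \<le> dist t y \<and> dist t y \<le> r}"
    "sum diameter \<C> \<le> slab_const * M / \<rho>"
proof -
  define C0 where "C0 = 4 / hausdorff_const 2 + 1"
  define B where "B a b = {y. a \<le> dist t y \<and> dist t y \<le> b}" for a b :: real
  have Bcl: "closed (B a b)" for a b
  proof -
    have "closed ({y. a \<le> dist t y} \<inter> {y. dist t y \<le> b})" by (intro closed_Int closed_Collect_le continuous_intros)
    moreover have "{y. a \<le> dist t y} \<inter> {y. dist t y \<le> b} = B a b" by (auto simp: B_def)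
    ultimately show ?thesis by simp
  qed
  have cpt: "compact (S \<inter> f -` F)" if "closed F" for F
    using S f that by (rule compact_preimage_closed)
  define Y where "Y = f ` (S \<inter> f -` cball t (2 * \<rho>))"
  have cS: "compact (S \<inter> f -` cball t (2 * \<rho>))" by (rule cpt) simp
  have fS: "continuous_on (S \<inter> f -` cball t (2 * \<rho>)) f" using f by (rule continuous_on_subset) auto
  have Yc: "compact Y" unfolding Y_def using fS cS by (rule compact_continuous_image)
  have "hausdorff_outer 2 Y \<le> ennreal M"
    unfolding Y_def using hausdorff_outer_image_le_vol[OF _ cS fS, of 2] M(2) by (auto intro: order_trans)
  with Yc M(1) obtain N :: "nat set" and A e where A: "finite N" "Y = (\<Union>i\<in>N. A i)" "\<And>i. i \<in> N \<Longrightarrow> compact (A i)"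
    "\<And>i. 0 < e i" "\<And>i x y. x \<in> A i \<Longrightarrow> y \<in> A i \<Longrightarrow> dist x y \<le> e i" "(\<Sum>i\<in>N. (e i)\<^sup>2) \<le> C0 * M"
    unfolding C0_def by (rule finite_open_cover_with_diameters) blast
  define E where "E = (\<Sum>i\<in>N. e i)"
  have E: "0 \<le> E" unfolding E_def using A by (intro sum_nonneg) (auto intro: less_imp_le)
  \<comment> \<open>The cover is fixed before the spacing of the slabs, so \<open>n\<close> can be
    taken so large that the rounding error \<open>2 * w * E\<close> is at most \<open>M\<close> and
    that \<open>w \<le> \<epsilon>\<close>.\<close>
  obtain n0 :: nat where n0: "max (2 * \<rho> * E / M) (\<rho> / \<epsilon>) < real n0" using reals_Archimedean2 by blast
  define n where "n = Suc n0"
  define w where "w = \<rho> / real n"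
  have n: "0 < n" "2 * \<rho> * E / M \<le> real n" "\<rho> / \<epsilon> \<le> real n" using n0 by (auto simp: n_def)
  have w: "0 < w" using \<rho> n by (simp add: w_def)
  have wn: "w * real n = \<rho>" using n by (simp add: w_def)
  have wE: "2 * w * E \<le> M" using n M \<rho> by (simp add: w_def field_simps)
  have w\<epsilon>: "w \<le> \<epsilon>" using n \<epsilon> by (simp add: w_def field_simps)
  define a where "a k = \<rho> + real k * w" for k :: nat
  \<comment> \<open>Slabs of width \<open>w / 2\<close> at spacing \<open>w\<close>: the gaps make
    these closed preimages disjoint.\<close>
  define D where "D k = S \<inter> f -` B (a k) (a k + w / 2)" for k
  define m where "m k = enn2real (vol 2 f (D k))" for k
  define T where "T k = {i \<in> N. A i \<inter> B (a k) (a k + w / 2) \<noteq> {}}" for k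
  have a2: "a k + w / 2 \<le> 2 * \<rho>" if "k < n" for k
  proof -
    have "real k + 1 \<le> real n" using that by simp
    then have "(real k + 1) * w \<le> real n * w" using w by (intro mult_right_mono) auto
    then show ?thesis using wn w by (simp add: a_def algebra_simps)
  qed
  have Dsub: "D k \<subseteq> S \<inter> f -` cball t (2 * \<rho>)" if "k < n" for k
    using a2[OF that] by (auto simp: D_def B_def)
  have Dfin: "vol 2 f (D k) = ennreal (m k)" if "k < n" for k
  proof -
    have "vol 2 f (D k) \<le> ennreal M" using vol_mono[OF Dsub[OF that]] M(2) by (rule order_trans)
    then have "vol 2 f (D k) < top" by (rule le_less_trans) simp
    then show ?thesis unfolding m_def by simp
  qed
  have step: "a i + w \<le> a j" if "i < j" for i j
  proof -
    have "real i + 1 \<le> real j" using that by simp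
    then have "(real i + 1) * w \<le> real j * w" using w by (intro mult_right_mono) auto
    then show ?thesis by (simp add: a_def algebra_simps)
  qed
  have dj: "disjoint_family_on D {..<n}"
    unfolding disjoint_family_on_def
  proof (intro ballI impI)
    fix i j :: nat assume "i \<noteq> j"
    then consider "i < j" | "j < i" by linarith
    then show "D i \<inter> D j = {}"
    proof cases
      case 1 then show ?thesis using step[OF 1] w by (auto simp: D_def B_def)
    next
      case 2 then show ?thesis using step[OF 2] w by (auto simp: D_def B_def)
    qed
  qed
  have "(\<Sum>k<n. vol 2 f (D k)) \<le> vol 2 f (S \<inter> f -` cball t (2 * \<rho>))"
  proof (rule sum_vol_le[OF finite_lessThan _ _ dj fS])
    show "compact (D k)" for k unfolding D_def by (intro cpt Bcl)
  qed (use Dsub in auto)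
  then have "ennreal (\<Sum>k<n. m k) \<le> ennreal M"
  proof -
    assume *: "(\<Sum>k<n. vol 2 f (D k)) \<le> vol 2 f (S \<inter> f -` cball t (2 * \<rho>))"
    have "ennreal (\<Sum>k<n. m k) = (\<Sum>k<n. ennreal (m k))" by (rule sum_ennreal[symmetric]) (simp add: m_def)
    also have "\<dots> = (\<Sum>k<n. vol 2 f (D k))" using Dfin by (intro sum.cong) auto
    finally show ?thesis using * M(2) by (metis order_trans)
  qed
  then have sum_m: "(\<Sum>k<n. m k) \<le> M" using M by (simp add: ennreal_le_iff)
  have count: "real (card {k \<in> {..<n}. i \<in> T k}) \<le> e i / w + 2" if "i \<in> N" for i
  proof -
    have "real (card {k \<in> {..<n}. i \<in> T k}) \<le> (e i / w + 1) + 1"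
    proof (rule card_le_of_spread)
      fix j k assume jk: "j \<in> {k \<in> {..<n}. i \<in> T k}" "k \<in> {k \<in> {..<n}. i \<in> T k}" "j \<le> k"
      then obtain x y where xy: "x \<in> A i" "x \<in> B (a j) (a j + w / 2)" "y \<in> A i" "y \<in> B (a k) (a k + w / 2)"
        by (auto simp: T_def)
      have "dist t y - dist t x \<le> dist x y" using dist_triangle[of t y x] by linarith
      then have "a k - a j - w / 2 \<le> e i" using xy A(5)[OF xy(1,3)] by (simp add: B_def)
      then have "real (k - j) * w \<le> e i + w" using jk(3) w by (simp add: a_def of_nat_diff algebra_simps)
      then have "real (k - j) \<le> (e i + w) / w" using w by (simp add: field_simps)
      then show "real (k - j) \<le> e i / w + 1" using w by (simp add: add_divide_distrib)
    qed (use A(4)[of i] w in \<open>auto intro: less_imp_le\<close>)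
    then show ?thesis by simp
  qed
  \<comment> \<open>Double counting: each size is weighted by the number of slabs that its set
    meets, and w * (e / w + 2) * e is a square plus an error linear in \<open>w\<close>.\<close>
  have sum_g: "w * (\<Sum>k<n. \<Sum>i\<in>T k. e i) \<le> C0 * M + M"
  proof -
    have "(\<Sum>k<n. \<Sum>i\<in>T k. e i) = (\<Sum>k<n. \<Sum>i\<in>N. if i \<in> T k then e i else 0)"
      using A(1) by (intro sum.cong refl sum.mono_neutral_cong_left) (auto simp: T_def)
    also have "\<dots> = (\<Sum>i\<in>N. \<Sum>k<n. if i \<in> T k then e i else 0)" by (rule sum.swap)
    also have "\<dots> = (\<Sum>i\<in>N. real (card {k \<in> {..<n}. i \<in> T k}) * e i)"
    proof (intro sum.cong refl)
      fix i
      have "(\<Sum>k<n. if i \<in> T k then e i else 0) = (\<Sum>k\<in>{k \<in> {..<n}. i \<in> T k}. e i)"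
        by (intro sum.mono_neutral_cong_right) auto
      then show "(\<Sum>k<n. if i \<in> T k then e i else 0) = real (card {k \<in> {..<n}. i \<in> T k}) * e i" by simp
    qed
    also have "\<dots> \<le> (\<Sum>i\<in>N. (e i / w + 2) * e i)"
      using count A(4) by (intro sum_mono mult_right_mono) (auto intro: less_imp_le)
    finally have "w * (\<Sum>k<n. \<Sum>i\<in>T k. e i) \<le> w * (\<Sum>i\<in>N. (e i / w + 2) * e i)" using w by (intro mult_left_mono) auto
    also have "\<dots> = (\<Sum>i\<in>N. (e i)\<^sup>2) + 2 * w * E"
    proof -
      have "w * ((e i / w + 2) * e i) = (e i)\<^sup>2 + 2 * w * e i" for i
        using w by (simp add: power2_eq_square algebra_simps)
      then show ?thesis unfolding E_def by (simp add: sum_distrib_left sum.distrib)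
    qed
    also have "\<dots> \<le> C0 * M + M" using A(6) wE by linarith
    finally show ?thesis .
  qed
  \<comment> \<open>Area and total diameter are combined in one quantity, so that a single slab is
    good for both.\<close>
  have "\<exists>k<n. m k + w * (\<Sum>i\<in>T k. e i) \<le> (C0 + 2) * M / real n"
  proof (rule ccontr)
    assume "\<not> ?thesis"
    then have "\<And>k. k \<in> {..<n} \<Longrightarrow> (C0 + 2) * M / real n < m k + w * (\<Sum>i\<in>T k. e i)" by (auto simp: not_le)
    then have "(\<Sum>k<n. (C0 + 2) * M / real n) < (\<Sum>k<n. m k + w * (\<Sum>i\<in>T k. e i))"
      using n by (intro sum_strict_mono) auto
    also have "\<dots> = (\<Sum>k<n. m k) + w * (\<Sum>k<n. \<Sum>i\<in>T k. e i)" by (simp add: sum.distrib sum_distrib_left)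
    also have "\<dots> \<le> M + (C0 * M + M)" using sum_m sum_g by linarith
    finally have "(\<Sum>k<n. (C0 + 2) * M / real n) < (C0 + 2) * M" by (simp add: algebra_simps)
    moreover have "(\<Sum>k<n. (C0 + 2) * M / real n) = (C0 + 2) * M" using n by simp
    ultimately show False by simp
  qed
  then obtain k where k: "k < n" "m k + w * (\<Sum>i\<in>T k. e i) \<le> (C0 + 2) * M / real n" by blast
  have nn: "0 \<le> m k" "0 \<le> (\<Sum>i\<in>T k. e i)" using less_imp_le[OF A(4)] by (auto simp: m_def intro!: sum_nonneg)
  define G where "G = (C0 + 2) * M"
  have "G / real n = G * w / \<rho>" using \<rho> n by (simp add: w_def)
  then have k': "m k + w * (\<Sum>i\<in>T k. e i) \<le> G * w / \<rho>" using k(2) by (simp add: G_def)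
  have mk: "m k \<le> G * w / \<rho>" using k' nn mult_nonneg_nonneg[of w "\<Sum>i\<in>T k. e i"] w by linarith
  have "w * (\<Sum>i\<in>T k. e i) \<le> w * (G / \<rho>)" using k' nn by (simp add: algebra_simps)
  then have gk: "(\<Sum>i\<in>T k. e i) \<le> G / \<rho>" using w by (simp only: mult_le_cancel_left_pos)
  have G: "slab_const * M = 4 * G" by (simp add: slab_const_def G_def C0_def algebra_simps)
  have G0: "0 \<le> G" using M hausdorff_const_pos[of 2] by (simp add: G_def C0_def)
  define \<delta> where "\<delta> = w / 4"
  define r where "r = a k + w / 2"
  have r\<delta>: "r - 2 * \<delta> = a k" by (simp add: r_def \<delta>_def)
  have TN: "finite (T k)" "T k \<subseteq> N" using A(1) by (auto simp: T_def)
  show ?thesis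
  proof (rule that[of \<delta> r "(\<lambda>i. A i \<inter> B (a k) r) ` T k"])
    show "0 < \<delta>" "\<delta> \<le> \<epsilon>" using w w\<epsilon> by (auto simp: \<delta>_def)
    show "\<rho> \<le> r - 2 * \<delta>" unfolding r\<delta> a_def using w by simp
    show "r \<le> 2 * \<rho>" unfolding r_def by (rule a2[OF k(1)])
    have "vol 2 f (D k) \<le> ennreal (slab_const * M * \<delta> / \<rho>)"
      unfolding Dfin[OF k(1)] using mk by (intro ennreal_leI) (simp add: G \<delta>_def)
    then show "vol 2 f (S \<inter> f -` {y. r - 2 * \<delta> \<le> dist t y \<and> dist t y \<le> r}) \<le> ennreal (slab_const * M * \<delta> / \<rho>)"
      unfolding r\<delta> by (simp add: D_def B_def r_def)
    show "finite ((\<lambda>i. A i \<inter> B (a k) r) ` T k)" using TN by simp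
    show "compact C" if "C \<in> (\<lambda>i. A i \<inter> B (a k) r) ` T k" for C
      using that TN A(3) Bcl by (auto intro!: compact_Int_closed)
    show "\<Union> ((\<lambda>i. A i \<inter> B (a k) r) ` T k) = f ` S \<inter> {y. r - 2 * \<delta> \<le> dist t y \<and> dist t y \<le> r}"
    proof -
      have "f ` S \<inter> B (a k) r = Y \<inter> B (a k) r"
        using a2[OF k(1)] by (auto simp: Y_def B_def r_def)
      also have "\<dots> = \<Union> ((\<lambda>i. A i \<inter> B (a k) r) ` T k)"
        unfolding A(2) T_def r_def by blast
      finally show ?thesis unfolding r\<delta> by (simp add: B_def)
    qed
    have "sum diameter ((\<lambda>i. A i \<inter> B (a k) r) ` T k) \<le> sum (diameter \<circ> (\<lambda>i. A i \<inter> B (a k) r)) (T k)"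
      using TN A(3) Bcl by (intro sum_image_le) (auto intro!: diameter_ge_0 compact_imp_bounded compact_Int_closed)
    also have "\<dots> \<le> (\<Sum>i\<in>T k. e i)"
      using less_imp_le[OF A(4)] A(5) by (intro sum_mono) (auto intro!: diameter_leI)
    also have "\<dots> \<le> slab_const * M / \<rho>" using gk G0 \<rho> unfolding G by (simp add: field_simps)
    finally show "sum diameter ((\<lambda>i. A i \<inter> B (a k) r) ` T k) \<le> slab_const * M / \<rho>" .
  qed
qed

section \<open>Collapsing a ball\<close>

definition clamp01 :: "real \<Rightarrow> real" where "clamp01 a = max 0 (min 1 a)"

lemma clamp01_bounds: "clamp01 a \<in> {0..1}"
  by (auto simp: clamp01_def)

lemma clamp01_diff: "\<bar>clamp01 a - clamp01 b\<bar> \<le> \<bar>a - b\<bar>"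
  by (auto simp: clamp01_def max_def min_def)

lemma clamp01_id: "0 \<le> a \<Longrightarrow> a \<le> 1 \<Longrightarrow> clamp01 a = a"
  and clamp01_0: "a \<le> 0 \<Longrightarrow> clamp01 a = 0" and clamp01_1: "1 \<le> a \<Longrightarrow> clamp01 a = 1"
  by (auto simp: clamp01_def)

text \<open>Between the radii r and r - \<delta> points are coned off to the centre z of their cluster, between
  r - \<delta> and r - 2 \<delta> the segment from z to t is traversed, and the rest of the ball goes to t.
  Only the first layer contributes area.\<close>

definition collapse :: "'a::metric_space \<Rightarrow> real \<Rightarrow> real \<Rightarrow> 'a \<Rightarrow> 'a \<Rightarrow> 'a" where
  "collapse t r \<delta> z y = geod t (geod z y (clamp01 ((dist t y - (r - \<delta>)) / \<delta>))) (clamp01 ((dist t y - (r - 2 * \<delta>)) / \<delta>))"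

text \<open>The assumptions are the outcome of slab selection and clustering: \<open>l\<close>
  bounds the distance to the cluster centre \<open>z y\<close>, and \<eta> is the scale at which
  \<open>z\<close> is constant. Positivity is the only lower bound on \<delta>, and the values of
  \<open>z\<close> off \<open>slab\<close> are arbitrary.\<close>

locale collapsing = cat0_space dummy for dummy :: "'a::metric_space itself" +
  fixes f :: "real^3 \<Rightarrow> 'a" and L :: real and t :: 'a and r \<delta> \<eta> l :: real and z :: "'a \<Rightarrow> 'a" and slab :: "'a set"
  defines "slab \<equiv> f ` sphere 0 1 \<inter> {y. r - 2 * \<delta> \<le> dist t y \<and> dist t y \<le> r}"
  assumes f: "L-lipschitz_on (sphere 0 1) f"
    and \<delta>: "0 < \<delta>" "0 \<le> r - 2 * \<delta>" and \<eta>: "0 < \<eta>" and l: "0 \<le> l"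
    and z_slab: "\<And>y. y \<in> slab \<Longrightarrow> z y \<in> slab"
    and z_near: "\<And>y. y \<in> slab \<Longrightarrow> dist y (z y) \<le> l"
    and z_const: "\<And>y y'. y \<in> slab \<Longrightarrow> y' \<in> slab \<Longrightarrow> dist y y' < \<eta> \<Longrightarrow> z y = z y'"
    and z_finite: "finite (z ` slab)"
begin

definition \<Phi> :: "'a \<Rightarrow> 'a" where "\<Phi> y = collapse t r \<delta> (z y) y"

definition f' :: "real^3 \<Rightarrow> 'a" where "f' x = \<Phi> (f x)"

lemma r_pos: "0 < r" using \<delta> by linarith

section \<open>Range and Lipschitz property of the collapsed map\<close>

lemma collapse_out: "r \<le> dist t y \<Longrightarrow> collapse t r \<delta> w y = y"
  using \<delta> by (simp add: collapse_def clamp01_1 field_simps)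

lemma collapse_in: "dist t y \<le> r - 2 * \<delta> \<Longrightarrow> collapse t r \<delta> w y = t"
  using \<delta> by (simp add: collapse_def clamp01_0 divide_nonpos_pos)

lemma collapse_slab1:
  assumes "r - \<delta> \<le> dist t y" "dist t y \<le> r"
  shows "collapse t r \<delta> w y = geod w y ((dist t y - (r - \<delta>)) / \<delta>)"
proof -
  have "1 \<le> (dist t y - (r - 2 * \<delta>)) / \<delta>" using assms \<delta> by (simp add: field_simps)
  moreover have "0 \<le> (dist t y - (r - \<delta>)) / \<delta>" "(dist t y - (r - \<delta>)) / \<delta> \<le> 1" using assms \<delta> by (auto simp: field_simps)
  ultimately show ?thesis by (simp add: collapse_def clamp01_1 clamp01_id)
qed

lemma collapse_slab2:
  assumes "r - 2 * \<delta> \<le> dist t y" "dist t y \<le> r - \<delta>"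
  shows "collapse t r \<delta> w y = geod t w ((dist t y - (r - 2 * \<delta>)) / \<delta>)"
proof -
  have "(dist t y - (r - \<delta>)) / \<delta> \<le> 0" using assms \<delta> by (simp add: divide_nonpos_pos)
  moreover have "0 \<le> (dist t y - (r - 2 * \<delta>)) / \<delta>" "(dist t y - (r - 2 * \<delta>)) / \<delta> \<le> 1" using assms \<delta> by (auto simp: field_simps)
  ultimately show ?thesis by (simp add: collapse_def clamp01_0 clamp01_id)
qed

lemma z_dist: "y \<in> slab \<Longrightarrow> dist t (z y) \<le> r"
  using z_slab by (auto simp: slab_def)

lemma in_slab: "x \<in> sphere 0 1 \<Longrightarrow> r - 2 * \<delta> \<le> dist t (f x) \<Longrightarrow> dist t (f x) \<le> r \<Longrightarrow> f x \<in> slab"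
  by (auto simp: slab_def)

lemma f'_out: "r \<le> dist t (f x) \<Longrightarrow> f' x = f x"
  by (simp add: f'_def \<Phi>_def collapse_out)

lemma f'_in: "dist t (f x) \<le> r - 2 * \<delta> \<Longrightarrow> f' x = t"
  by (simp add: f'_def \<Phi>_def collapse_in)

text \<open>Balls are geodesically convex, and every geodesic used joins points obtained from
  \<open>t\<close> and the image. Hence one radius serves for the final cone whatever modifications
  precede it.\<close>

lemma f'_convex:
  assumes x: "x \<in> sphere 0 1" and R: "f ` sphere 0 1 \<subseteq> cball p R" "t \<in> cball p R"
  shows "f' x \<in> cball p R"
proof -
  consider "r \<le> dist t (f x)" | "dist t (f x) \<le> r - 2 * \<delta>" | "f x \<in> slab" using in_slab[OF x] by linarith
  then show ?thesis
  proof cases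
    case 3
    then have "z (f x) \<in> f ` sphere 0 1" using z_slab[OF 3] unfolding slab_def by blast
    then have "z (f x) \<in> cball p R" using R(1) by blast
    moreover have "f x \<in> cball p R" using R(1) x by blast
    ultimately have "dist p (f' x) \<le> R" unfolding f'_def \<Phi>_def collapse_def
      using R(2) clamp01_bounds by (intro geod_in_cball) auto
    then show ?thesis by simp
  qed (use subsetD[OF R(1) imageI[OF x]] R(2) f'_out f'_in in auto)
qed

text \<open>Points of the ball stay in it, which lets modifications in disjoint balls be made one
  after another.\<close>

lemma f'_in_ball:
  assumes x: "x \<in> sphere 0 1" and "dist t (f x) \<le> r"
  shows "dist t (f' x) \<le> r"
proof -
  consider "dist t (f x) \<le> r - 2 * \<delta>" | "f x \<in> slab" using in_slab[OF x] assms by linarith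
  then show ?thesis
  proof cases
    case 1 then show ?thesis using f'_in r_pos by simp
  next
    case 2
    then show ?thesis unfolding f'_def \<Phi>_def collapse_def
      using z_dist assms clamp01_bounds r_pos by (intro geod_in_cball) auto
  qed
qed

lemma displacement: "x \<in> sphere 0 1 \<Longrightarrow> dist (f x) (f' x) \<le> 2 * r"
proof (cases "r \<le> dist t (f x)")
  case True then show ?thesis using f'_out r_pos by simp
next
  case False
  assume "x \<in> sphere 0 1"
  then have "dist t (f' x) \<le> r" using False by (intro f'_in_ball) auto
  then show ?thesis using False dist_triangle3[of "f x" "f' x" t] by linarith
qed

text \<open>The constant blows up with 1 / \<delta>; it serves only to show that the new map is
  Lipschitz at all.\<close>

lemma collapse_lipschitz:
  assumes "dist t w \<le> r" "dist t y \<le> R" "dist t y' \<le> R"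
  shows "dist (collapse t r \<delta> w y) (collapse t r \<delta> w y') \<le> (1 + 2 * (r + R) / \<delta>) * dist y y'"
proof -
  define a where "a y = clamp01 ((dist t y - (r - \<delta>)) / \<delta>)" for y
  define b where "b y = clamp01 ((dist t y - (r - 2 * \<delta>)) / \<delta>)" for y
  have ab: "a y \<in> {0..1}" "b y \<in> {0..1}" for y using clamp01_bounds by (auto simp: a_def b_def)
  have dd: "\<bar>dist t y - dist t y'\<bar> \<le> dist y y'" using dist_triangle[of t y y'] dist_triangle[of t y' y] dist_commute[of y y'] by linarith
  have "\<bar>(dist t y - s) / \<delta> - (dist t y' - s) / \<delta>\<bar> \<le> dist y y' / \<delta>" for s
    using dd \<delta> by (simp add: diff_divide_distrib[symmetric] abs_divide divide_right_mono)
  then have lip: "\<bar>a y - a y'\<bar> \<le> dist y y' / \<delta>" "\<bar>b y - b y'\<bar> \<le> dist y y' / \<delta>"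
    unfolding a_def b_def using clamp01_diff order_trans by blast+
  have R0: "0 \<le> R" using assms(2) zero_le_dist[of t y] by linarith
  have wy: "dist w y \<le> r + R" using assms dist_triangle3[of w y t] by linarith
  have inner: "dist (geod w y (a y)) (geod w y' (a y')) \<le> dist y y' + dist y y' / \<delta> * (r + R)"
  proof -
    have "dist (geod w y (a y)) (geod w y' (a y')) \<le> dist w w + dist y y' + \<bar>a y - a y'\<bar> * dist w y"
      by (rule geod_dist_le') (use ab in auto)
    also have "\<bar>a y - a y'\<bar> * dist w y \<le> dist y y' / \<delta> * (r + R)" using lip wy \<delta> by (intro mult_mono) auto
    finally show ?thesis by simp
  qed
  have "dist t (geod w y (a y)) \<le> r + R" using assms ab[of y] r_pos R0 by (intro geod_in_cball) auto
  then have "\<bar>b y - b y'\<bar> * dist t (geod w y (a y)) \<le> dist y y' / \<delta> * (r + R)" using lip \<delta> by (intro mult_mono) auto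
  moreover have "dist (collapse t r \<delta> w y) (collapse t r \<delta> w y') \<le> dist t t + dist (geod w y (a y)) (geod w y' (a y')) + \<bar>b y - b y'\<bar> * dist t (geod w y (a y))"
    unfolding collapse_def a_def[symmetric] b_def[symmetric] by (rule geod_dist_le') (use ab in auto)
  ultimately have "dist (collapse t r \<delta> w y) (collapse t r \<delta> w y') \<le> dist y y' + dist y y' / \<delta> * (r + R) + dist y y' / \<delta> * (r + R)"
    using inner dist_self[of t] by linarith
  also have "\<dots> = (1 + 2 * (r + R) / \<delta>) * dist y y'" using \<delta> by (simp add: field_simps)
  finally show ?thesis .
qed

text \<open>Close points can be given a common centre \<open>w\<close>: two points of the slab share
  theirs, and off the slab \<open>collapse\<close> does not depend on \<open>w\<close>.\<close>

lemma \<Phi>_locally_lipschitz: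
  assumes y: "y \<in> f ` sphere 0 1" "y' \<in> f ` sphere 0 1" and d: "dist y y' < \<eta>"
    and R: "dist t y \<le> R" "dist t y' \<le> R"
  shows "dist (\<Phi> y) (\<Phi> y') \<le> (1 + 2 * (r + R) / \<delta>) * dist y y'"
proof -
  have indep: "collapse t r \<delta> w y = collapse t r \<delta> w' y" if "y \<in> f ` sphere 0 1" "y \<notin> slab" for w w' y
  proof -
    have "r \<le> dist t y \<or> dist t y \<le> r - 2 * \<delta>" using that by (auto simp: slab_def)
    then show ?thesis using collapse_out collapse_in by auto
  qed
  have "\<exists>w. dist t w \<le> r \<and> \<Phi> y = collapse t r \<delta> w y \<and> \<Phi> y' = collapse t r \<delta> w y'"
  proof (cases "y \<in> slab")
    case True
    show ?thesis
    proof (cases "y' \<in> slab")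
      case t': True
      then show ?thesis using True z_const[OF True t' d] z_dist[OF True] by (auto simp: \<Phi>_def)
    next
      case False
      then show ?thesis using True z_dist[OF True] indep[OF y(2) False] by (auto simp: \<Phi>_def)
    qed
  next
    case nF: False
    show ?thesis
    proof (cases "y' \<in> slab")
      case True
      then show ?thesis using z_dist[OF True] indep[OF y(1) nF] by (auto simp: \<Phi>_def)
    next
      case False
      have "dist t t \<le> r" using r_pos by simp
      then show ?thesis using indep[OF y(1) nF] indep[OF y(2) False] unfolding \<Phi>_def by metis
    qed
  qed
  then show ?thesis using collapse_lipschitz R by metis
qed

text \<open>Below distance \<eta> the local bound applies; from \<eta> on, the diameter bound
  \<open>4 * r + 2 * R'\<close> of the new image, divided by \<eta>, suffices.\<close>

lemma f'_lipschitz: "\<exists>L'. L'-lipschitz_on (sphere 0 1) f'"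
proof -
  have "compact (f ` sphere 0 1)" using f by (intro compact_continuous_image lipschitz_on_continuous_on) auto
  then obtain R where R: "\<And>y. y \<in> f ` sphere 0 1 \<Longrightarrow> dist t y \<le> R"
    by (meson bounded_any_center compact_imp_bounded)
  define R' where "R' = max R 0"
  have R': "0 \<le> R'" "\<And>y. y \<in> f ` sphere 0 1 \<Longrightarrow> dist t y \<le> R'" using R by (auto simp: R'_def intro: max.coboundedI1)
  define \<Lambda> where "\<Lambda> = (1 + 2 * (r + R') / \<delta>) + (4 * r + 2 * R') / \<eta>"
  have \<Lambda>: "0 \<le> (1 + 2 * (r + R') / \<delta>)" "0 \<le> (4 * r + 2 * R') / \<eta>" using \<delta> r_pos R' \<eta> by auto
  have "\<Lambda>-lipschitz_on (f ` sphere 0 1) \<Phi>"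
  proof (rule lipschitz_onI)
    show "0 \<le> \<Lambda>" using \<Lambda> by (simp add: \<Lambda>_def)
    fix y y' assume y: "y \<in> f ` sphere 0 1" "y' \<in> f ` sphere 0 1"
    show "dist (\<Phi> y) (\<Phi> y') \<le> \<Lambda> * dist y y'"
    proof (cases "dist y y' < \<eta>")
      case True
      have "dist (\<Phi> y) (\<Phi> y') \<le> (1 + 2 * (r + R') / \<delta>) * dist y y'" using True y R' by (intro \<Phi>_locally_lipschitz)
      also have "\<dots> \<le> \<Lambda> * dist y y'" using \<Lambda> by (intro mult_right_mono) (auto simp: \<Lambda>_def)
      finally show ?thesis .
    next
      case False
      have near: "dist t (\<Phi> y) \<le> 2 * r + R'" if "y \<in> f ` sphere 0 1" for y
      proof -
        obtain x where x: "x \<in> sphere 0 1" "y = f x" using \<open>y \<in> f ` sphere 0 1\<close> by blast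
        show ?thesis using displacement[OF x(1)] R'(2)[OF that] dist_triangle[of t "f' x" "f x"] x by (simp add: f'_def)
      qed
      have "dist (\<Phi> y) (\<Phi> y') \<le> 4 * r + 2 * R'" using near[OF y(1)] near[OF y(2)] dist_triangle3[of "\<Phi> y" "\<Phi> y'" t] by linarith
      also have "\<dots> = (4 * r + 2 * R') / \<eta> * \<eta>" using \<eta> by simp
      also have "\<dots> \<le> \<Lambda> * dist y y'" using False \<Lambda> \<eta> by (intro mult_mono) (auto simp: \<Lambda>_def)
      finally show ?thesis .
    qed
  qed
  then have "(\<Lambda> * L)-lipschitz_on (sphere 0 1) (\<lambda>x. \<Phi> (f x))" using f by (intro lipschitz_on_compose2)
  then show ?thesis unfolding f'_def[abs_def] by blast
qed

text \<open>In order: the part left alone, the layer coned to cluster centres, the layer mapped into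
  segments, and the core sent to \<open>t\<close>. All conditions are closed and overlap along level
  sets, so the regions are compact and volume is subadditive over them.\<close>

definition region :: "nat \<Rightarrow> (real^3) set" where
  "region i = sphere 0 1 \<inter> f -` (if i = 0 then {y. r \<le> dist t y} else if i = 1 then {y. r - \<delta> \<le> dist t y \<and> dist t y \<le> r}
    else if i = 2 then {y. r - 2 * \<delta> \<le> dist t y \<and> dist t y \<le> r - \<delta>} else {y. dist t y \<le> r - 2 * \<delta>})"

section \<open>Area and homotopy estimates, region by region\<close>

lemma f_cont: "continuous_on (sphere 0 1) f" using f by (rule lipschitz_on_continuous_on)

lemma f'_cont: "continuous_on (sphere 0 1) f'" using f'_lipschitz lipschitz_on_continuous_on by blast

lemma compact_region: "compact (region i)"
  unfolding region_def
  by (rule compact_preimage_closed[OF _ f_cont]) (auto intro!: closed_Collect_le closed_Collect_conj continuous_intros)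

lemma region_sub: "region i \<subseteq> sphere 0 1" by (auto simp: region_def)

lemma sphere_regions: "sphere 0 1 = (\<Union>i\<in>{..<4}. region i)"
proof (intro equalityI subsetI)
  fix x :: "real^3" assume x: "x \<in> sphere 0 1"
  consider "r \<le> dist t (f x)" | "r - \<delta> \<le> dist t (f x) \<and> dist t (f x) \<le> r" | "r - 2 * \<delta> \<le> dist t (f x) \<and> dist t (f x) \<le> r - \<delta>"
    | "dist t (f x) \<le> r - 2 * \<delta>" by linarith
  then have "\<exists>i<4. x \<in> region i"
  proof cases
    case 1 then show ?thesis using x by (intro exI[of _ 0]) (auto simp: region_def)
  next
    case 2 then show ?thesis using x by (intro exI[of _ 1]) (auto simp: region_def)
  next
    case 3 then show ?thesis using x by (intro exI[of _ 2]) (auto simp: region_def)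
  next
    case 4 then show ?thesis using x by (intro exI[of _ 3]) (auto simp: region_def)
  qed
  then show "x \<in> (\<Union>i\<in>{..<4}. region i)" by blast
qed (use region_sub in blast)

text \<open>The geodesic from the cluster centre has length at most \<open>l\<close>, and its
  parameter changes at rate 1 / \<delta> in the distance to \<open>t\<close>; all stretching is
  along that distance.\<close>

lemma region1_estimate:
  assumes "x \<in> region 1" "y \<in> region 1" "dist (f x) (f y) \<le> \<eta> / 2"
  shows "dist (f' x) (f' y) \<le> dist (f x) (f y) + l / \<delta> * \<bar>dist t (f x) - dist t (f y)\<bar>"
proof -
  have x: "x \<in> sphere 0 1" "r - \<delta> \<le> dist t (f x)" "dist t (f x) \<le> r" and y: "y \<in> sphere 0 1" "r - \<delta> \<le> dist t (f y)" "dist t (f y) \<le> r"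
    using assms by (auto simp: region_def)
  have sx: "f x \<in> slab" and sy: "f y \<in> slab" using x y \<delta> by (auto intro!: in_slab)
  have zz: "z (f y) = z (f x)" using z_const[OF sx sy] assms(3) \<eta> by simp
  define a where "a u = (u - (r - \<delta>)) / \<delta>" for u
  have ax: "a (dist t (f x)) \<in> {0..1}" and ay: "a (dist t (f y)) \<in> {0..1}" using x y \<delta> by (auto simp: a_def field_simps)
  have "f' x = geod (z (f x)) (f x) (a (dist t (f x)))" "f' y = geod (z (f x)) (f y) (a (dist t (f y)))"
    using x y by (simp_all add: f'_def \<Phi>_def collapse_slab1 a_def zz)
  then have "dist (f' x) (f' y) \<le> dist (f x) (f y) + \<bar>a (dist t (f x)) - a (dist t (f y))\<bar> * dist (z (f x)) (f x)"
    using geod_dist_le'[OF ax ay, of "z (f x)" "f x" "z (f x)" "f y"] by simp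
  also have "\<bar>a (dist t (f x)) - a (dist t (f y))\<bar> * dist (z (f x)) (f x) \<le> \<bar>a (dist t (f x)) - a (dist t (f y))\<bar> * l"
    using z_near[OF sx] by (intro mult_left_mono) (auto simp: dist_commute)
  also have "\<bar>a (dist t (f x)) - a (dist t (f y))\<bar> = \<bar>dist t (f x) - dist t (f y)\<bar> / \<delta>"
    using \<delta> by (simp add: a_def diff_divide_distrib[symmetric])
  finally show ?thesis by (simp add: field_simps)
qed

text \<open>As for the outer layer, with a segment of length at most \<open>r\<close>. Although the
  image is one-dimensional, the bound matters for the volume swept by the homotopy.\<close>

lemma region2_estimate:
  assumes "x \<in> region 2" "y \<in> region 2" "dist (f x) (f y) \<le> \<eta> / 2"
  shows "dist (f' x) (f' y) \<le> dist (f x) (f y) + r / \<delta> * \<bar>dist t (f x) - dist t (f y)\<bar>"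
proof -
  have x: "x \<in> sphere 0 1" "r - 2 * \<delta> \<le> dist t (f x)" "dist t (f x) \<le> r - \<delta>" and y: "y \<in> sphere 0 1" "r - 2 * \<delta> \<le> dist t (f y)" "dist t (f y) \<le> r - \<delta>"
    using assms by (auto simp: region_def)
  have sx: "f x \<in> slab" and sy: "f y \<in> slab" using x y \<delta> by (auto intro!: in_slab)
  have zz: "z (f y) = z (f x)" using z_const[OF sx sy] assms(3) \<eta> by simp
  define a where "a u = (u - (r - 2 * \<delta>)) / \<delta>" for u
  have ax: "a (dist t (f x)) \<in> {0..1}" and ay: "a (dist t (f y)) \<in> {0..1}" using x y \<delta> by (auto simp: a_def field_simps)
  have "f' x = geod t (z (f x)) (a (dist t (f x)))" "f' y = geod t (z (f x)) (a (dist t (f y)))"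
    using x y by (simp_all add: f'_def \<Phi>_def collapse_slab2 a_def zz)
  then have "dist (f' x) (f' y) = \<bar>a (dist t (f x)) - a (dist t (f y))\<bar> * dist t (z (f x))"
    using dist_geod[OF ax ay, of t "z (f x)"] by simp
  also have "\<dots> \<le> \<bar>a (dist t (f x)) - a (dist t (f y))\<bar> * r"
    using z_dist[OF sx] by (intro mult_left_mono) auto
  also have "\<bar>a (dist t (f x)) - a (dist t (f y))\<bar> = \<bar>dist t (f x) - dist t (f y)\<bar> / \<delta>"
    using \<delta> by (simp add: a_def diff_divide_distrib[symmetric])
  finally have "dist (f' x) (f' y) \<le> r / \<delta> * \<bar>dist t (f x) - dist t (f y)\<bar>" by (simp add: field_simps)
  then show ?thesis using zero_le_dist[of "f x" "f y"] by linarith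
qed

lemma region0_estimate: "x \<in> region 0 \<Longrightarrow> f' x = f x"
  by (auto simp: region_def f'_out)

lemma region3_estimate: "x \<in> region 3 \<Longrightarrow> f' x = t"
  by (auto simp: region_def f'_in)

text \<open>Finitely many cluster centres give finitely many segments from \<open>t\<close>, each of
  area zero.\<close>

lemma region2_null: "hausdorff_outer 2 (f' ` region 2) = 0"
proof -
  have "f' ` region 2 \<subseteq> (\<Union>w\<in>z ` slab. geod t w ` {0..1})"
  proof
    fix u assume "u \<in> f' ` region 2"
    then obtain x where x: "x \<in> region 2" "u = f' x" by blast
    then have b: "x \<in> sphere 0 1" "r - 2 * \<delta> \<le> dist t (f x)" "dist t (f x) \<le> r - \<delta>" by (auto simp: region_def)
    then have "f x \<in> slab" using \<delta> by (auto intro!: in_slab)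
    moreover have "u = geod t (z (f x)) ((dist t (f x) - (r - 2 * \<delta>)) / \<delta>)" using x b by (simp add: f'_def \<Phi>_def collapse_slab2)
    moreover have "(dist t (f x) - (r - 2 * \<delta>)) / \<delta> \<in> {0..1}" using b \<delta> by (auto simp: field_simps)
    ultimately show "u \<in> (\<Union>w\<in>z ` slab. geod t w ` {0..1})" by blast
  qed
  then have "hausdorff_outer 2 (f' ` region 2) \<le> hausdorff_outer 2 (\<Union>w\<in>z ` slab. geod t w ` {0..1})" by (rule hausdorff_outer_mono)
  also have "\<dots> \<le> (\<Sum>w\<in>z ` slab. hausdorff_outer 2 (geod t w ` {0..1}))" by (rule hausdorff_outer_finite_subadditive[OF z_finite]) simp
  also have "\<dots> = 0"
  proof (rule sum.neutral, rule ballI)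
    fix w show "hausdorff_outer 2 (geod t w ` {0..1}) = 0"
      by (rule hausdorff_outer_curve_null[of _ "dist t w"]) (auto simp: dist_geod mult.commute)
  qed
  finally show ?thesis by simp
qed

lemma vol_zero_of_null_image:
  fixes h :: "real^3 \<Rightarrow> 'a"
  assumes "compact D" "continuous_on D h" "hausdorff_outer 2 (h ` D) = 0"
  shows "vol 2 h D = 0"
proof -
  have "vol 2 h D \<le> 0 * vol 2 h D"
  proof (rule vol_le_vol_of_pieces)
    fix P assume "P \<subseteq> D"
    then have "hausdorff_outer 2 (h ` P) \<le> hausdorff_outer 2 (h ` D)" by (intro hausdorff_outer_mono image_mono)
    then show "hausdorff_outer 2 (h ` P) \<le> 0 * hausdorff_outer 2 (h ` P)" using assms by simp
  qed (use assms in auto)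
  then show ?thesis by simp
qed

lemma area_f':
  "vol 2 f' (sphere 0 1) \<le> vol 2 f (region 0) + ennreal (36 * (l / \<delta> + 1)) * vol 2 f (region 1)"
proof -
  have cont': "continuous_on (region i) f'" for i using f'_cont region_sub by (rule continuous_on_subset)
  have cont: "continuous_on (region i) f" for i using f_cont region_sub by (rule continuous_on_subset)
  have "vol 2 f' (sphere 0 1) \<le> (\<Sum>i\<in>{..<4}. vol 2 f' (region i))"
    unfolding sphere_regions by (intro vol_UN_le compact_region cont') auto
  also have "{..<4} = {0,1,2,3::nat}" by auto
  also have "(\<Sum>i\<in>{0,1,2,3::nat}. vol 2 f' (region i)) = vol 2 f' (region 0) + vol 2 f' (region 1) + vol 2 f' (region 2) + vol 2 f' (region 3)"
    by (simp add: add.assoc)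
  also have "vol 2 f' (region 0) = vol 2 f (region 0)" by (intro vol_cong region0_estimate)
  also have "vol 2 f' (region 2) = 0" by (intro vol_zero_of_null_image compact_region cont' region2_null)
  also have "vol 2 f' (region 3) = 0"
  proof (intro vol_zero_of_null_image compact_region cont')
    have "f' ` region 3 \<subseteq> {t}" using region3_estimate by auto
    then have "hausdorff_outer 2 (f' ` region 3) \<le> hausdorff_outer 2 {t}" by (rule hausdorff_outer_mono)
    then show "hausdorff_outer 2 (f' ` region 3) = 0" by (simp add: hausdorff_outer_singleton)
  qed
  also have "vol 2 f (region 0) + vol 2 f' (region 1) + 0 + 0 \<le> vol 2 f (region 0) + ennreal (36 * (l / \<delta> + 1)) * vol 2 f (region 1)"
  proof -
    have "vol 2 f' (region 1) \<le> ennreal (36 * (l / \<delta> + 1)) * vol 2 f (region 1)"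
    proof (rule vol_le_vol_of_pieces[OF _ compact_region cont cont'])
      fix P assume P: "P \<subseteq> region 1"
      have K: "0 \<le> l / \<delta>" using l \<delta> by simp
      show "hausdorff_outer 2 (f' ` P) \<le> ennreal (36 * (l / \<delta> + 1)) * hausdorff_outer 2 (f ` P)"
      proof (rule hausdorff_outer_stretch[where v = "\<lambda>x. l / \<delta> * dist t (f x)" and \<eta> = "\<eta> / 2", OF _ K])
        fix x y assume xy: "x \<in> P" "y \<in> P" "dist (f x) (f y) \<le> \<eta> / 2"
        have v: "\<bar>l / \<delta> * dist t (f x) - l / \<delta> * dist t (f y)\<bar> = l / \<delta> * \<bar>dist t (f x) - dist t (f y)\<bar>"
          using K by (simp only: right_diff_distrib[symmetric] abs_mult abs_of_nonneg)
        have dd: "\<bar>dist t (f x) - dist t (f y)\<bar> \<le> dist (f x) (f y)"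
          using dist_triangle[of t "f x" "f y"] dist_triangle[of t "f y" "f x"] dist_commute[of "f x" "f y"] by linarith
        show "dist (f' x) (f' y) \<le> 2 * dist (f x) (f y) + \<bar>l / \<delta> * dist t (f x) - l / \<delta> * dist t (f y)\<bar>"
          unfolding v using region1_estimate[of x y] xy P zero_le_dist[of "f x" "f y"] by (smt (verit) subsetD)
        show "\<bar>l / \<delta> * dist t (f x) - l / \<delta> * dist t (f y)\<bar> \<le> l / \<delta> * dist (f x) (f y)"
          unfolding v using dd K by (rule mult_left_mono)
      qed (use \<eta> in auto)
    qed simp
    then show ?thesis by (simp add: add_left_mono)
  qed
  finally show ?thesis .
qed

text \<open>Each point sweeps a geodesic of length at most \<open>T\<close>, and between
  neighbouring points the homotopy stretches, with factor \<open>K\<close>, only along the distance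
  to \<open>t\<close>.\<close>

lemma homotopy_piece:
  assumes K: "0 \<le> K" and T: "0 < T" and D: "D \<subseteq> sphere 0 1"
    and est: "\<And>x y. x \<in> D \<Longrightarrow> y \<in> D \<Longrightarrow> dist (f x) (f y) \<le> \<eta> / 2 \<Longrightarrow>
       dist (f' x) (f' y) \<le> dist (f x) (f y) + K * \<bar>dist t (f x) - dist t (f y)\<bar>"
    and disp: "\<And>x. x \<in> D \<Longrightarrow> dist (f x) (f' x) \<le> T"
    and P: "P \<subseteq> D" and ab: "0 \<le> a" "a < b" "b \<le> (1::real)"
  shows "hausdorff_outer 3 ((\<lambda>(s, x). geod (f x) (f' x) s) ` ({a..b} \<times> P)) \<le> ennreal (cylinder_const * (K + 1) * T * (b - a)) * hausdorff_outer 2 (f ` P)"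
proof -
  have "hausdorff_outer 3 ((\<lambda>(s, x). geod (f x) (f' x) s) ` ({a..b} \<times> P)) \<le> ennreal (cylinder_const * (K + 1) * T * (b - a)) * hausdorff_outer 2 ((\<lambda>p. f (snd p)) ` ({a..b} \<times> P))"
  proof (rule hausdorff_outer_stretch_cylinder[where v = "\<lambda>p. K * dist t (f (snd p))" and s = fst and \<eta> = "\<eta> / 2"])
    fix p q assume "p \<in> {a..b} \<times> P" "q \<in> {a..b} \<times> P" and d: "dist (f (snd p)) (f (snd q)) \<le> \<eta> / 2"
    obtain s x where p: "p = (s, x)" by fastforce
    obtain s' y where q: "q = (s', y)" by fastforce
    have pq: "p = (s, x)" "q = (s', y)" "s \<in> {a..b}" "s' \<in> {a..b}" "x \<in> D" "y \<in> D"
      using p q \<open>p \<in> {a..b} \<times> P\<close> \<open>q \<in> {a..b} \<times> P\<close> P by auto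
    have v: "\<bar>K * dist t (f x) - K * dist t (f y)\<bar> = K * \<bar>dist t (f x) - dist t (f y)\<bar>"
      using K by (simp only: right_diff_distrib[symmetric] abs_mult abs_of_nonneg)
    have dd: "\<bar>dist t (f x) - dist t (f y)\<bar> \<le> dist (f x) (f y)"
      using dist_triangle[of t "f x" "f y"] dist_triangle[of t "f y" "f x"] dist_commute[of "f x" "f y"] by linarith
    have "dist (geod (f x) (f' x) s) (geod (f y) (f' y) s') \<le> dist (f x) (f y) + dist (f' x) (f' y) + \<bar>s - s'\<bar> * dist (f x) (f' x)"
      by (rule geod_dist_le') (use pq ab in auto)
    also have "\<bar>s - s'\<bar> * dist (f x) (f' x) \<le> \<bar>s - s'\<bar> * T" using disp pq by (intro mult_left_mono) auto
    also have "dist (f x) (f y) + dist (f' x) (f' y) + \<bar>s - s'\<bar> * T \<le> 2 * dist (f x) (f y) + K * \<bar>dist t (f x) - dist t (f y)\<bar> + T * \<bar>s - s'\<bar>"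
      using est[of x y] pq d by (simp add: mult.commute)
    finally show "dist ((\<lambda>(s, x). geod (f x) (f' x) s) p) ((\<lambda>(s, x). geod (f x) (f' x) s) q) \<le> 2 * dist (f (snd p)) (f (snd q)) + \<bar>K * dist t (f (snd p)) - K * dist t (f (snd q))\<bar> + T * \<bar>fst p - fst q\<bar>"
      by (simp add: pq v)
    show "\<bar>K * dist t (f (snd p)) - K * dist t (f (snd q))\<bar> \<le> K * dist (f (snd p)) (f (snd q))"
      using mult_left_mono[OF dd K] by (simp add: pq v)
  qed (use \<eta> K T ab in auto)
  also have "(\<lambda>p. f (snd p)) ` ({a..b} \<times> P) = f ` P" using ab by (force simp: image_iff)
  finally show ?thesis .
qed

text \<open>On region 0 the homotopy is stationary, but the cylinder estimate wants a positive
  length, so an arbitrarily small \<zeta> stands for its cost. On region 3 the new map is constant,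
  hence \<open>K = 0\<close>. On regions 1 and 2 the factors l / \<delta> and r / \<delta> remain,
  to be offset by the small area of the slab.\<close>

lemma fillable_f':
  assumes fill: "fillable f' V" and \<zeta>: "0 < \<zeta>"
  shows "fillable f (V + (ennreal \<zeta> * vol 2 f (region 0) + ennreal (cylinder_const * (l / \<delta> + 1) * (2 * r)) * vol 2 f (region 1) +
    ennreal (cylinder_const * (r / \<delta> + 1) * (2 * r)) * vol 2 f (region 2) + ennreal (cylinder_const * (2 * r)) * vol 2 f (region 3)))"
proof -
  define q where "q i = (if i = 0 then \<zeta> else if i = 1 then cylinder_const * (l / \<delta> + 1) * (2 * r)
    else if i = 2 then cylinder_const * (r / \<delta> + 1) * (2 * r) else cylinder_const * (2 * r))" for i :: nat
  obtain L' where L': "L'-lipschitz_on (sphere 0 1) f'" using f'_lipschitz by blast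
  have L0: "0 \<le> L" "0 \<le> L'" using f L' lipschitz_on_nonneg by blast+
  have c: "0 < cylinder_const" by (rule cylinder_const_pos)
  have "fillable f (V + (\<Sum>i\<in>{..<4}. ennreal (q i) * vol 2 f (region i)))"
  proof (rule fillable_homotopy[where H = "\<lambda>s x. geod (f x) (f' x) s" and M = "L + L' + 2 * r" and f' = f'])
    fix s s' :: real and x y :: "real^3" assume s: "s \<in> {0..1}" "s' \<in> {0..1}" and x: "x \<in> sphere 0 1" and y: "y \<in> sphere 0 1"
    have "dist (geod (f x) (f' x) s) (geod (f y) (f' y) s') \<le> dist (f x) (f y) + dist (f' x) (f' y) + \<bar>s - s'\<bar> * dist (f x) (f' x)"
      by (rule geod_dist_le') (use s in auto)
    also have "\<dots> \<le> L * dist x y + L' * dist x y + \<bar>s - s'\<bar> * (2 * r)"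
      by (intro add_mono mult_left_mono lipschitz_onD[OF f] lipschitz_onD[OF L'] displacement x y) auto
    also have "\<dots> \<le> (L + L' + 2 * r) * (\<bar>s - s'\<bar> + dist x y)"
    proof -
      have "0 \<le> (L + L') * \<bar>s - s'\<bar>" "0 \<le> 2 * r * dist x y" using L0 r_pos by auto
      then show ?thesis by (simp add: algebra_simps)
    qed
    finally show "dist (geod (f x) (f' x) s) (geod (f y) (f' y) s') \<le> (L + L' + 2 * r) * (\<bar>s - s'\<bar> + dist x y)" .
  next
    show "sphere 0 1 = (\<Union>i\<in>{..<4}. region i)" by (rule sphere_regions)
    show "0 \<le> q i" for i using c \<zeta> l \<delta> r_pos by (auto simp: q_def)
    fix i P a b assume i: "i \<in> {..<4::nat}" and P: "P \<subseteq> region i" and ab: "0 \<le> a" "a < b" "b \<le> (1::real)"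
    consider "i = 0" | "i = 1" | "i = 2" | "i = 3" using i by fastforce
    then show "hausdorff_outer 3 ((\<lambda>(s, x). geod (f x) (f' x) s) ` ({a..b} \<times> P)) \<le> ennreal (q i * (b - a)) * hausdorff_outer 2 (f ` P)"
    proof cases
      case 1
      have "hausdorff_outer 3 ((\<lambda>(s, x). geod (f x) (f' x) s) ` ({a..b} \<times> P)) \<le> ennreal (cylinder_const * (0 + 1) * (\<zeta> / cylinder_const) * (b - a)) * hausdorff_outer 2 (f ` P)"
        by (rule homotopy_piece[OF _ _ region_sub[of 0] _ _ _ ab]) (use P 1 c \<zeta> region0_estimate in \<open>auto intro: less_imp_le\<close>)
      then show ?thesis using 1 c by (simp add: q_def)
    next
      case 2
      have "hausdorff_outer 3 ((\<lambda>(s, x). geod (f x) (f' x) s) ` ({a..b} \<times> P)) \<le> ennreal (cylinder_const * (l / \<delta> + 1) * (2 * r) * (b - a)) * hausdorff_outer 2 (f ` P)"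
        by (rule homotopy_piece[OF _ _ region_sub[of 1] region1_estimate displacement[OF subsetD[OF region_sub]] _ ab]) (use P 2 l \<delta> r_pos in auto)
      then show ?thesis using 2 by (simp add: q_def)
    next
      case 3
      have "hausdorff_outer 3 ((\<lambda>(s, x). geod (f x) (f' x) s) ` ({a..b} \<times> P)) \<le> ennreal (cylinder_const * (r / \<delta> + 1) * (2 * r) * (b - a)) * hausdorff_outer 2 (f ` P)"
        by (rule homotopy_piece[OF _ _ region_sub[of 2] region2_estimate displacement[OF subsetD[OF region_sub]] _ ab]) (use P 3 \<delta> r_pos in auto)
      then show ?thesis using 3 by (simp add: q_def)
    next
      case 4
      have "hausdorff_outer 3 ((\<lambda>(s, x). geod (f x) (f' x) s) ` ({a..b} \<times> P)) \<le> ennreal (cylinder_const * (0 + 1) * (2 * r) * (b - a)) * hausdorff_outer 2 (f ` P)"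
        by (rule homotopy_piece[OF _ _ region_sub[of 3] _ displacement[OF subsetD[OF region_sub]] _ ab]) (use P 4 r_pos region3_estimate in auto)
      then show ?thesis using 4 by (simp add: q_def)
    qed
  qed (use L0 r_pos compact_region fill in auto)
  moreover have "{..<4} = {0,1,2,3::nat}" by auto
  ultimately show ?thesis by (simp add: q_def add.assoc)
qed

end

section \<open>Area decrease on a ball of small density\<close>

text \<open>The first bound makes points of lower density negligible; the second makes 72 * (4 *
  slab_const)^2 times the constant at most 1/2, which is the comparison of areas inside a ball. The
  inner 4 comes from the area bound \<open>4 * density_const * \<rho>^2\<close> on the doubled
  ball.\<close>

definition density_const :: real where
  "density_const = min (hausdorff_const 2 / 2) (1 / (144 * (4 * slab_const)\<^sup>2))"

text \<open>The summands are the homotopy costs over regions 0 to 3, in units of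
  \<open>\<rho>^3\<close>.\<close>

definition ball_const :: real where
  "ball_const = 1 + cylinder_const * (8 * (4 * slab_const)\<^sup>2 + 12 * (4 * slab_const) + 16)"

lemma density_const_pos: "0 < density_const"
  using hausdorff_const_pos[of 2] slab_const_ge by (simp add: density_const_def)

lemma density_const_less: "density_const < hausdorff_const 2"
  using hausdorff_const_pos[of 2] by (simp add: density_const_def min_def)

lemma density_const_bound: "72 * (4 * slab_const)\<^sup>2 * density_const \<le> 1 / 2"
proof -
  have "0 < (4 * slab_const)\<^sup>2" using slab_const_ge by simp
  moreover have "density_const \<le> 1 / (144 * (4 * slab_const)\<^sup>2)" by (simp add: density_const_def)
  ultimately show ?thesis by (simp add: field_simps)
qed

lemma density_const_le_1: "density_const \<le> 1"
proof -
  have "1 \<le> (4 * slab_const)\<^sup>2" using slab_const_ge by (intro one_le_power) simp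
  then have "72 * 1 * density_const \<le> 72 * (4 * slab_const)\<^sup>2 * density_const"
    using density_const_pos by (intro mult_right_mono mult_left_mono) auto
  then show ?thesis using density_const_bound by linarith
qed

lemma ball_const_pos: "0 < ball_const"
  using cylinder_const_pos slab_const_ge by (simp add: ball_const_def add_pos_nonneg)

lemma ennreal_mult_bound: "v \<le> ennreal b \<Longrightarrow> 0 \<le> a \<Longrightarrow> 0 \<le> b \<Longrightarrow> a * b \<le> c \<Longrightarrow> ennreal a * v \<le> ennreal c"
proof -
  assume *: "v \<le> ennreal b" "0 \<le> a" "0 \<le> b" "a * b \<le> c"
  have "ennreal a * v \<le> ennreal a * ennreal b" using * by (intro mult_left_mono) auto
  also have "\<dots> = ennreal (a * b)" using * by (simp add: ennreal_mult)
  also have "\<dots> \<le> ennreal c" using * by (intro ennreal_leI)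
  finally show ?thesis .
qed

context cat0_space
begin

text \<open>Over the outer layer the new area is at most 36 * (l / \<delta> + 1) * (l * \<delta>),
  hence at most 72 * l^2, free of \<delta>. As \<open>l\<close> is proportional to
  \<open>c * \<rho>\<close>, this is quadratic in \<open>c\<close>, against a loss linear in
  \<open>c\<close>. The decrease is stated as a sum because \<open>ennreal\<close> differences
  truncate.\<close>

lemma ball_step:
  fixes f :: "real^3 \<Rightarrow> 'a"
  assumes lip: "L-lipschitz_on (sphere 0 1) f" and \<rho>: "0 < \<rho>"
    and low: "ennreal (density_const * \<rho>\<^sup>2) \<le> vol 2 f (sphere 0 1 \<inter> f -` cball t \<rho>)"
    and up: "vol 2 f (sphere 0 1 \<inter> f -` cball t (2 * \<rho>)) \<le> ennreal (4 * density_const * \<rho>\<^sup>2)"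
  obtains f' L' where "L'-lipschitz_on (sphere 0 1) f'"
    "\<And>x. x \<in> sphere 0 1 \<Longrightarrow> 2 * \<rho> < dist t (f x) \<Longrightarrow> f' x = f x"
    "\<And>x. x \<in> sphere 0 1 \<Longrightarrow> dist t (f x) \<le> 2 * \<rho> \<Longrightarrow> dist t (f' x) \<le> 2 * \<rho>"
    "\<And>p R. f ` sphere 0 1 \<subseteq> cball p R \<Longrightarrow> t \<in> cball p R \<Longrightarrow> f' ` sphere 0 1 \<subseteq> cball p R"
    "vol 2 f' (sphere 0 1) + ennreal (density_const * \<rho>\<^sup>2 / 2) \<le> vol 2 f (sphere 0 1)"
    "\<And>V. fillable f' V \<Longrightarrow> fillable f (V + ennreal (ball_const * \<rho> ^ 3))"
proof -
  define S :: "(real^3) set" where "S = sphere 0 1"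
  define c where "c = density_const"
  define B where "B = 4 * slab_const"
  have c: "0 < c" "c \<le> 1" "72 * B\<^sup>2 * c \<le> 1 / 2"
    using density_const_pos density_const_le_1 density_const_bound by (auto simp: c_def B_def)
  have B: "1 \<le> B" using slab_const_ge by (simp add: B_def)
  have cont: "continuous_on S f" using lip unfolding S_def by (rule lipschitz_on_continuous_on)
  have cS: "compact S" by (simp add: S_def)
  define M where "M = 4 * c * \<rho>\<^sup>2"
  have M: "0 < M" using c \<rho> by (simp add: M_def)
  have up': "vol 2 f (S \<inter> f -` cball t (2 * \<rho>)) \<le> ennreal M" using up by (simp add: S_def M_def c_def)
  have c\<rho>: "0 < c * \<rho>" using c \<rho> by simp
  \<comment> \<open>The bound \<open>\<delta> \<le> c * \<rho>\<close> is requested in order to have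
    \<open>\<delta> \<le> l\<close> in the area estimate.\<close>
  obtain r \<delta> \<C> where slab: "0 < \<delta>" "\<delta> \<le> c * \<rho>" "\<rho> \<le> r - 2 * \<delta>" "r \<le> 2 * \<rho>"
    "vol 2 f (S \<inter> f -` {y. r - 2 * \<delta> \<le> dist t y \<and> dist t y \<le> r}) \<le> ennreal (slab_const * M * \<delta> / \<rho>)"
    and \<C>: "finite \<C>" "\<And>C. C \<in> \<C> \<Longrightarrow> compact C" "\<Union>\<C> = f ` S \<inter> {y. r - 2 * \<delta> \<le> dist t y \<and> dist t y \<le> r}"
    "sum diameter \<C> \<le> slab_const * M / \<rho>"
    by (rule thin_slab_exists[OF cS cont \<rho> c\<rho> M up']) blast
  define l where "l = B * c * \<rho>"
  have l_eq: "slab_const * M / \<rho> = l" "slab_const * M * \<delta> / \<rho> = l * \<delta>"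
    using \<rho> by (simp_all add: l_def M_def B_def power2_eq_square)
  have l0: "0 \<le> l" using B c \<rho> by (simp add: l_def)
  obtain z \<eta> where z: "0 < \<eta>" "\<And>y. y \<in> \<Union>\<C> \<Longrightarrow> z y \<in> \<Union>\<C>" "\<And>y. y \<in> \<Union>\<C> \<Longrightarrow> dist y (z y) \<le> sum diameter \<C>"
    "\<And>y y'. y \<in> \<Union>\<C> \<Longrightarrow> y' \<in> \<Union>\<C> \<Longrightarrow> dist y y' < \<eta> \<Longrightarrow> z y = z y'" "finite (z ` \<Union>\<C>)"
  proof (rule locally_constant_selection[OF \<C>(1,2)])
    fix z \<eta> assume "0 < \<eta>" "\<And>y. y \<in> \<Union>\<C> \<Longrightarrow> z y \<in> \<Union>\<C>" "\<And>y. y \<in> \<Union>\<C> \<Longrightarrow> dist y (z y) \<le> sum diameter \<C>"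
    "\<And>y y'. y \<in> \<Union>\<C> \<Longrightarrow> y' \<in> \<Union>\<C> \<Longrightarrow> dist y y' < \<eta> \<Longrightarrow> z y = z y'" "finite (z ` \<Union>\<C>)"
    then show thesis by (rule that[of \<eta> z])
  qed
  have zl: "dist y (z y) \<le> l" if "y \<in> \<Union>\<C>" for y using z(3)[OF that] \<C>(4) l_eq by linarith
  interpret collapsing dummy f L t r \<delta> \<eta> l z "f ` sphere 0 1 \<inter> {y. r - 2 * \<delta> \<le> dist t y \<and> dist t y \<le> r}"
    apply unfold_locales
    subgoal by (rule lip)
    subgoal by (rule slab(1))
    subgoal using slab \<rho> by linarith
    subgoal by (rule z(1))
    subgoal by (rule l0)
    subgoal using z(2) unfolding \<C>(3) S_def .
    subgoal using zl unfolding \<C>(3) S_def .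
    subgoal using z(4) unfolding \<C>(3) S_def .
    subgoal using z(5) unfolding \<C>(3) S_def .
    subgoal by (rule reflexive)
    done
  have rb: "\<rho> < r" "r \<le> 2 * \<rho>" "0 \<le> r" using slab \<rho> by auto
  have v12: "vol 2 f (region i) \<le> ennreal (l * \<delta>)" if "i = 1 \<or> i = 2" for i
  proof -
    have "region i \<subseteq> S \<inter> f -` {y. r - 2 * \<delta> \<le> dist t y \<and> dist t y \<le> r}"
      using that slab(1) by (auto simp: region_def S_def)
    then have "vol 2 f (region i) \<le> vol 2 f (S \<inter> f -` {y. r - 2 * \<delta> \<le> dist t y \<and> dist t y \<le> r})" by (rule vol_mono)
    also have "\<dots> \<le> ennreal (l * \<delta>)" using slab(5) by (simp add: l_eq(2))
    finally show ?thesis .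
  qed
  have ld0: "0 \<le> l * \<delta>" using l0 slab by simp
  \<comment> \<open>Region 0 avoids the ball of radius \<rho>, so the area of at least
    \<open>c * \<rho>^2\<close> over that ball can be subtracted in full.\<close>
  have low_add: "vol 2 f (region 0) + ennreal (c * \<rho>\<^sup>2) \<le> vol 2 f S"
  proof -
    have "vol 2 f (region 0) + ennreal (c * \<rho>\<^sup>2) \<le> vol 2 f (region 0) + vol 2 f (S \<inter> f -` cball t \<rho>)"
      using low by (intro add_left_mono) (simp add: S_def c_def)
    also have "\<dots> = (\<Sum>b\<in>{True, False}. vol 2 f (if b then region 0 else S \<inter> f -` cball t \<rho>))" by simp
    also have "\<dots> \<le> vol 2 f S"
    proof (rule sum_vol_le)
      show "disjoint_family_on (\<lambda>b. if b then region 0 else S \<inter> f -` cball t \<rho>) {True, False}"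
        using rb by (auto simp: disjoint_family_on_def region_def)
      show "compact (if b then region 0 else S \<inter> f -` cball t \<rho>)" for b
        using compact_region compact_preimage_closed[OF cS cont] by auto
      show "(if b then region 0 else S \<inter> f -` cball t \<rho>) \<subseteq> S" for b using region_sub by (auto simp: S_def)
    qed (use cont in auto)
    finally show ?thesis .
  qed
  have area: "vol 2 f' S \<le> vol 2 f (region 0) + ennreal (c * \<rho>\<^sup>2 / 2)"
  proof -
    have "36 * (l / \<delta> + 1) * (l * \<delta>) = 36 * (l + \<delta>) * l" using slab(1) by (simp add: field_simps)
    also have "\<dots> \<le> 36 * (2 * l) * l"
    proof -
      have "\<delta> \<le> l" using slab(2) mult_right_mono[OF B, of "c * \<rho>"] c\<rho> by (simp add: l_def)
      then show ?thesis using l0 by (intro mult_right_mono mult_left_mono) auto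
    qed
    also have "\<dots> = (72 * B\<^sup>2 * c) * (c * \<rho>\<^sup>2)" by (simp add: l_def power2_eq_square)
    also have "\<dots> \<le> 1 / 2 * (c * \<rho>\<^sup>2)" using c by (intro mult_right_mono) auto
    finally have "ennreal (36 * (l / \<delta> + 1)) * vol 2 f (region 1) \<le> ennreal (c * \<rho>\<^sup>2 / 2)"
      using v12[of 1] ld0 l0 slab(1) by (intro ennreal_mult_bound) auto
    then have "vol 2 f (region 0) + ennreal (36 * (l / \<delta> + 1)) * vol 2 f (region 1) \<le> vol 2 f (region 0) + ennreal (c * \<rho>\<^sup>2 / 2)"
      by (rule add_left_mono)
    with area_f' show ?thesis unfolding S_def by (rule order_trans)
  qed
  define A where "A = enn2real (vol 2 f S)"
  have fin: "vol 2 f S < top" unfolding S_def using lip by (rule vol_lipschitz_sphere_finite)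
  then have A: "vol 2 f S = ennreal A" "0 \<le> A" by (simp_all add: A_def)
  \<comment> \<open>With this choice the stationary part costs at most \<open>\<rho>^3\<close>,
    whatever the total area \<open>A\<close>.\<close>
  define \<zeta> where "\<zeta> = \<rho> ^ 3 / (A + 1)"
  have \<zeta>: "0 < \<zeta>" using A \<rho> by (simp add: \<zeta>_def)
  have cc: "0 < cylinder_const" by (rule cylinder_const_pos)
  have fill: "fillable f (V + ennreal (ball_const * \<rho> ^ 3))" if V: "fillable f' V" for V
  proof -
    have \<delta>\<rho>: "\<delta> \<le> \<rho>" using slab(2) mult_right_mono[OF c(2) less_imp_le[OF \<rho>]] by linarith
    have lB: "l \<le> B * \<rho>" using mult_right_mono[OF c(2), of "B * \<rho>"] B \<rho> by (simp add: l_def mult.assoc mult.left_commute)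
    have B\<rho>: "\<rho> \<le> B * \<rho>" using mult_right_mono[OF B less_imp_le[OF \<rho>]] by linarith
    have \<delta>B: "\<delta> \<le> B * \<rho>" using \<delta>\<rho> B\<rho> by linarith
    have t0: "ennreal \<zeta> * vol 2 f (region 0) \<le> ennreal (\<rho> ^ 3)"
    proof (rule ennreal_mult_bound)
      show "vol 2 f (region 0) \<le> ennreal A" unfolding A(1)[symmetric] S_def by (rule vol_mono[OF region_sub])
      show "\<zeta> * A \<le> \<rho> ^ 3" using A \<rho> by (simp add: \<zeta>_def field_simps)
    qed (use \<zeta> A in auto)
    have t1: "ennreal (cylinder_const * (l / \<delta> + 1) * (2 * r)) * vol 2 f (region 1) \<le> ennreal (cylinder_const * (8 * B\<^sup>2) * \<rho> ^ 3)"
    proof (rule ennreal_mult_bound)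
      have "cylinder_const * (l / \<delta> + 1) * (2 * r) * (l * \<delta>) = cylinder_const * ((l + \<delta>) * (2 * r) * l)"
        using slab(1) by (simp add: field_simps)
      also have "\<dots> \<le> cylinder_const * ((B * \<rho> + B * \<rho>) * (2 * (2 * \<rho>)) * (B * \<rho>))"
        using cc lB \<delta>B rb l0 slab(1) B \<rho> by (intro mult_left_mono mult_mono add_mono) auto
      also have "\<dots> = cylinder_const * (8 * B\<^sup>2) * \<rho> ^ 3" by (simp add: power2_eq_square power3_eq_cube)
      finally show "cylinder_const * (l / \<delta> + 1) * (2 * r) * (l * \<delta>) \<le> cylinder_const * (8 * B\<^sup>2) * \<rho> ^ 3" .
    qed (use v12[of 1] ld0 cc l0 slab(1) rb in auto)
    have t2: "ennreal (cylinder_const * (r / \<delta> + 1) * (2 * r)) * vol 2 f (region 2) \<le> ennreal (cylinder_const * (12 * B) * \<rho> ^ 3)"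
    proof (rule ennreal_mult_bound)
      have "cylinder_const * (r / \<delta> + 1) * (2 * r) * (l * \<delta>) = cylinder_const * ((r + \<delta>) * (2 * r) * l)"
        using slab(1) by (simp add: field_simps)
      also have "\<dots> \<le> cylinder_const * ((2 * \<rho> + \<rho>) * (2 * (2 * \<rho>)) * (B * \<rho>))"
        using cc lB \<delta>\<rho> rb l0 slab(1) B \<rho> by (intro mult_left_mono mult_mono add_mono) auto
      also have "\<dots> = cylinder_const * (12 * B) * \<rho> ^ 3" by (simp add: power3_eq_cube)
      finally show "cylinder_const * (r / \<delta> + 1) * (2 * r) * (l * \<delta>) \<le> cylinder_const * (12 * B) * \<rho> ^ 3" .
    qed (use v12[of 2] ld0 cc l0 slab(1) rb in auto)
    have t3: "ennreal (cylinder_const * (2 * r)) * vol 2 f (region 3) \<le> ennreal (cylinder_const * 16 * \<rho> ^ 3)"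
    proof (rule ennreal_mult_bound)
      have "region 3 \<subseteq> S \<inter> f -` cball t (2 * \<rho>)" using rb slab(1) by (auto simp: region_def S_def)
      then show "vol 2 f (region 3) \<le> ennreal M" using up' by (meson vol_mono order_trans)
      have "cylinder_const * (2 * r) * M = cylinder_const * ((2 * r) * (4 * c * \<rho>\<^sup>2))" by (simp add: M_def)
      also have "\<dots> \<le> cylinder_const * ((2 * (2 * \<rho>)) * (4 * 1 * \<rho>\<^sup>2))"
        using cc rb c \<rho> by (intro mult_left_mono mult_mono) auto
      also have "\<dots> = cylinder_const * 16 * \<rho> ^ 3" by (simp add: power2_eq_square power3_eq_cube)
      finally show "cylinder_const * (2 * r) * M \<le> cylinder_const * 16 * \<rho> ^ 3" .
    qed (use cc rb M in auto)
    have nn: "0 \<le> \<rho> ^ 3" "0 \<le> cylinder_const * (8 * B\<^sup>2) * \<rho> ^ 3" "0 \<le> cylinder_const * (12 * B) * \<rho> ^ 3" "0 \<le> cylinder_const * 16 * \<rho> ^ 3"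
      using \<rho> cc B by auto
    have "ennreal \<zeta> * vol 2 f (region 0) + ennreal (cylinder_const * (l / \<delta> + 1) * (2 * r)) * vol 2 f (region 1) +
      ennreal (cylinder_const * (r / \<delta> + 1) * (2 * r)) * vol 2 f (region 2) + ennreal (cylinder_const * (2 * r)) * vol 2 f (region 3)
      \<le> ennreal (\<rho> ^ 3) + ennreal (cylinder_const * (8 * B\<^sup>2) * \<rho> ^ 3) + ennreal (cylinder_const * (12 * B) * \<rho> ^ 3) + ennreal (cylinder_const * 16 * \<rho> ^ 3)"
      by (intro add_mono t0 t1 t2 t3)
    also have "\<dots> = ennreal (\<rho> ^ 3 + cylinder_const * (8 * B\<^sup>2) * \<rho> ^ 3 + cylinder_const * (12 * B) * \<rho> ^ 3 + cylinder_const * 16 * \<rho> ^ 3)"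
      using nn by (simp add: ennreal_plus[symmetric] del: ennreal_plus)
    also have "\<rho> ^ 3 + cylinder_const * (8 * B\<^sup>2) * \<rho> ^ 3 + cylinder_const * (12 * B) * \<rho> ^ 3 + cylinder_const * 16 * \<rho> ^ 3 = ball_const * \<rho> ^ 3"
      by (simp add: ball_const_def B_def algebra_simps)
    finally show ?thesis using fillable_f'[OF V \<zeta>] by (rule fillable_mono[OF _ add_left_mono, rotated])
  qed
  obtain L' where L': "L'-lipschitz_on (sphere 0 1) f'" using f'_lipschitz by blast
  show ?thesis
  proof (rule that[of L' f'])
    show "L'-lipschitz_on (sphere 0 1) f'" by (rule L')
    show "f' x = f x" if "x \<in> sphere 0 1" "2 * \<rho> < dist t (f x)" for x using that rb by (intro f'_out) auto
    show "dist t (f' x) \<le> 2 * \<rho>" if "x \<in> sphere 0 1" "dist t (f x) \<le> 2 * \<rho>" for x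
      using f'_in_ball[OF that(1)] f'_out[of x] that rb by (cases "dist t (f x) \<le> r") auto
    show "f' ` sphere 0 1 \<subseteq> cball p R" if "f ` sphere 0 1 \<subseteq> cball p R" "t \<in> cball p R" for p R
      using f'_convex[OF _ that] by blast
    have "vol 2 f' S + ennreal (c * \<rho>\<^sup>2 / 2) \<le> vol 2 f (region 0) + (ennreal (c * \<rho>\<^sup>2 / 2) + ennreal (c * \<rho>\<^sup>2 / 2))"
      using add_right_mono[OF area, of "ennreal (c * \<rho>\<^sup>2 / 2)"] by (simp only: add.assoc)
    also have "ennreal (c * \<rho>\<^sup>2 / 2) + ennreal (c * \<rho>\<^sup>2 / 2) = ennreal (c * \<rho>\<^sup>2)"
      using c by (simp add: ennreal_plus[symmetric] del: ennreal_plus)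
    also have "vol 2 f (region 0) + ennreal (c * \<rho>\<^sup>2) \<le> vol 2 f S" by (rule low_add)
    finally show "vol 2 f' (sphere 0 1) + ennreal (density_const * \<rho>\<^sup>2 / 2) \<le> vol 2 f (sphere 0 1)" by (simp add: S_def c_def)
    show "fillable f (V + ennreal (ball_const * \<rho> ^ 3))" if "fillable f' V" for V using that by (rule fill)
  qed
qed

text \<open>A modification inside one doubled ball changes neither the preimages of the other
  doubled balls nor the map on them, so the density hypotheses survive for the remaining
  balls.\<close>

lemma disjoint_balls_step:
  fixes f :: "real^3 \<Rightarrow> 'a" and \<rho> :: "'a \<Rightarrow> real"
  assumes "finite T" "L-lipschitz_on (sphere 0 1) f" "f ` sphere 0 1 \<subseteq> cball p R" "T \<subseteq> cball p R"
    "disjoint_family_on (\<lambda>t. cball t (2 * \<rho> t)) T" "\<And>t. t \<in> T \<Longrightarrow> 0 < \<rho> t"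
    "\<And>t. t \<in> T \<Longrightarrow> ennreal (density_const * (\<rho> t)\<^sup>2) \<le> vol 2 f (sphere 0 1 \<inter> f -` cball t (\<rho> t))"
    "\<And>t. t \<in> T \<Longrightarrow> vol 2 f (sphere 0 1 \<inter> f -` cball t (2 * \<rho> t)) \<le> ennreal (4 * density_const * (\<rho> t)\<^sup>2)"
  shows "\<exists>f' L'. L'-lipschitz_on (sphere 0 1) f' \<and> f' ` sphere 0 1 \<subseteq> cball p R \<and>
    vol 2 f' (sphere 0 1) + ennreal (\<Sum>t\<in>T. density_const * (\<rho> t)\<^sup>2 / 2) \<le> vol 2 f (sphere 0 1) \<and>
    (\<forall>V. fillable f' V \<longrightarrow> fillable f (V + ennreal (\<Sum>t\<in>T. ball_const * \<rho> t ^ 3)))"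
  using assms
proof (induction T arbitrary: f L)
  case empty
  then show ?case by (intro exI[of _ f] exI[of _ L]) auto
next
  case (insert t T)
  have \<rho>t: "0 < \<rho> t" and tR: "t \<in> cball p R" using insert.prems by auto
  from insert.prems(1) \<rho>t insert.prems(6)[OF insertI1] insert.prems(7)[OF insertI1]
  obtain f1 L1 where f1: "L1-lipschitz_on (sphere 0 1) f1"
    "\<And>x. x \<in> sphere 0 1 \<Longrightarrow> 2 * \<rho> t < dist t (f x) \<Longrightarrow> f1 x = f x"
    "\<And>x. x \<in> sphere 0 1 \<Longrightarrow> dist t (f x) \<le> 2 * \<rho> t \<Longrightarrow> dist t (f1 x) \<le> 2 * \<rho> t"
    "\<And>p R. f ` sphere 0 1 \<subseteq> cball p R \<Longrightarrow> t \<in> cball p R \<Longrightarrow> f1 ` sphere 0 1 \<subseteq> cball p R"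
    "vol 2 f1 (sphere 0 1) + ennreal (density_const * (\<rho> t)\<^sup>2 / 2) \<le> vol 2 f (sphere 0 1)"
    "\<And>V. fillable f1 V \<Longrightarrow> fillable f (V + ennreal (ball_const * \<rho> t ^ 3))"
    by (rule ball_step) blast
  have same: "vol 2 f1 (sphere 0 1 \<inter> f1 -` cball s b) = vol 2 f (sphere 0 1 \<inter> f -` cball s b)" if s: "s \<in> T" and b: "b \<le> 2 * \<rho> s" for s b
  proof -
    have "cball t (2 * \<rho> t) \<inter> cball s (2 * \<rho> s) = {}"
      using insert.prems(4) insert.hyps(2) s unfolding disjoint_family_on_def by (metis insertCI)
    then have dj: "\<not> (dist t y \<le> 2 * \<rho> t \<and> dist s y \<le> b)" for y using b by fastforce
    have "sphere 0 1 \<inter> f1 -` cball s b = sphere 0 1 \<inter> f -` cball s b"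
    proof (intro equalityI subsetI)
      fix x assume x: "x \<in> sphere 0 1 \<inter> f1 -` cball s b"
      then have "\<not> dist t (f x) \<le> 2 * \<rho> t" using f1(3)[of x] dj[of "f1 x"] by auto
      then show "x \<in> sphere 0 1 \<inter> f -` cball s b" using x f1(2)[of x] by auto
    next
      fix x assume x: "x \<in> sphere 0 1 \<inter> f -` cball s b"
      then have "\<not> dist t (f x) \<le> 2 * \<rho> t" using dj[of "f x"] by auto
      then show "x \<in> sphere 0 1 \<inter> f1 -` cball s b" using x f1(2)[of x] by auto
    qed
    moreover have "f1 x = f x" if x: "x \<in> sphere 0 1 \<inter> f -` cball s b" for x
      using x dj[of "f x"] by (intro f1(2)) auto
    ultimately show ?thesis using vol_cong[of "sphere 0 1 \<inter> f -` cball s b" f1 f 2] by metis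
  qed
  have "\<exists>f' L'. L'-lipschitz_on (sphere 0 1) f' \<and> f' ` sphere 0 1 \<subseteq> cball p R \<and>
    vol 2 f' (sphere 0 1) + ennreal (\<Sum>t\<in>T. density_const * (\<rho> t)\<^sup>2 / 2) \<le> vol 2 f1 (sphere 0 1) \<and>
    (\<forall>V. fillable f' V \<longrightarrow> fillable f1 (V + ennreal (\<Sum>t\<in>T. ball_const * \<rho> t ^ 3)))"
  proof (rule insert.IH[OF f1(1) f1(4)[OF insert.prems(2) tR]])
    show "T \<subseteq> cball p R" using insert.prems by auto
    show "disjoint_family_on (\<lambda>t. cball t (2 * \<rho> t)) T"
      using insert.prems(4) by (rule disjoint_family_on_mono[rotated]) auto
    fix s assume s: "s \<in> T"
    then show \<rho>s: "0 < \<rho> s" using insert.prems(5) by auto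
    show "ennreal (density_const * (\<rho> s)\<^sup>2) \<le> vol 2 f1 (sphere 0 1 \<inter> f1 -` cball s (\<rho> s))"
      using same[OF s, of "\<rho> s"] insert.prems(6)[of s] s \<rho>s by simp
    show "vol 2 f1 (sphere 0 1 \<inter> f1 -` cball s (2 * \<rho> s)) \<le> ennreal (4 * density_const * (\<rho> s)\<^sup>2)"
      using same[OF s, of "2 * \<rho> s"] insert.prems(7)[of s] s by simp
  qed
  then obtain f' L' where f': "L'-lipschitz_on (sphere 0 1) f'" "f' ` sphere 0 1 \<subseteq> cball p R"
    "vol 2 f' (sphere 0 1) + ennreal (\<Sum>t\<in>T. density_const * (\<rho> t)\<^sup>2 / 2) \<le> vol 2 f1 (sphere 0 1)"
    "\<And>V. fillable f' V \<Longrightarrow> fillable f1 (V + ennreal (\<Sum>t\<in>T. ball_const * \<rho> t ^ 3))" by blast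
  have nn: "0 \<le> (\<Sum>t\<in>T. density_const * (\<rho> t)\<^sup>2 / 2)" "0 \<le> density_const * (\<rho> t)\<^sup>2 / 2"
    using density_const_pos by (auto intro!: sum_nonneg)
  have nn': "0 \<le> (\<Sum>t\<in>T. ball_const * \<rho> t ^ 3)" "0 \<le> ball_const * \<rho> t ^ 3"
    using less_imp_le[OF ball_const_pos] less_imp_le[OF insert.prems(5)] by (auto intro!: sum_nonneg mult_nonneg_nonneg zero_le_power)
  have "vol 2 f' (sphere 0 1) + ennreal (\<Sum>t\<in>insert t T. density_const * (\<rho> t)\<^sup>2 / 2) =
    (vol 2 f' (sphere 0 1) + ennreal (\<Sum>t\<in>T. density_const * (\<rho> t)\<^sup>2 / 2)) + ennreal (density_const * (\<rho> t)\<^sup>2 / 2)"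
    unfolding sum.insert[OF insert.hyps] ennreal_plus[OF nn(2,1)] by (simp only: ac_simps)
  also have "\<dots> \<le> vol 2 f1 (sphere 0 1) + ennreal (density_const * (\<rho> t)\<^sup>2 / 2)" using f'(3) by (rule add_right_mono)
  also have "\<dots> \<le> vol 2 f (sphere 0 1)" by (rule f1(5))
  finally have 1: "vol 2 f' (sphere 0 1) + ennreal (\<Sum>t\<in>insert t T. density_const * (\<rho> t)\<^sup>2 / 2) \<le> vol 2 f (sphere 0 1)" .
  have "fillable f (V + ennreal (\<Sum>t\<in>insert t T. ball_const * \<rho> t ^ 3))" if "fillable f' V" for V
    using f1(6)[OF f'(4)[OF that]] unfolding sum.insert[OF insert.hyps] ennreal_plus[OF nn'(2,1)] by (simp only: ac_simps)
  then show ?case using f'(1,2) 1 by blast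
qed

end

section \<open>Covering by balls of critical density\<close>

text \<open>A covering set that meets the exceptional set at \<open>y\<close> lies in the ball about
  \<open>y\<close> whose radius is its diameter, and this ball carries area below c * diameter^2.
  Summed over a near-optimal cover, the measure of the exceptional set would be strictly less than
  itself. The radius is the full diameter, which is why the threshold is
  \<open>hausdorff_const 2\<close> and not \<open>omega 2\<close>.\<close>

lemma low_density_null:
  fixes f :: "'b::euclidean_space \<Rightarrow> 'a::metric_space"
  assumes S: "compact S" "continuous_on S f" and fin: "vol 2 f S < top" and c: "0 < c" "c < hausdorff_const 2"
  shows "hausdorff_outer 2 {y \<in> f ` S. \<forall>r>0. vol 2 f (S \<inter> f -` cball y r) < ennreal (c * r\<^sup>2)} = 0"
proof (rule ccontr)
  define E where "E = {y \<in> f ` S. \<forall>r>0. vol 2 f (S \<inter> f -` cball y r) < ennreal (c * r\<^sup>2)}"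
  assume "\<not> ?thesis"
  then have ne: "hausdorff_outer 2 E \<noteq> 0" by (simp add: E_def)
  define \<kappa> where "\<kappa> = hausdorff_const 2"
  have \<kappa>: "0 < \<kappa>" "c < \<kappa>" using c hausdorff_const_pos by (auto simp: \<kappa>_def)
  have "hausdorff_outer 2 E \<le> hausdorff_outer 2 (f ` S)" by (intro hausdorff_outer_mono) (auto simp: E_def)
  also have "\<dots> \<le> vol 2 f S" by (intro hausdorff_outer_image_le_vol S) simp
  finally have "hausdorff_outer 2 E < top" using fin by (rule le_less_trans)
  then obtain h where h: "hausdorff_outer 2 E = ennreal h" "0 \<le> h" by (cases "hausdorff_outer 2 E") auto
  have h0: "0 < h" using ne h by (cases "h = 0") auto
  have "hausdorff_pre 2 1 E \<le> ennreal h" using hausdorff_pre_le_outer[of 1 2 E] h by simp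
  \<comment> \<open>The slack \<kappa> / c > 1 allowed to the cover is exactly compensated by the
    factor c / \<kappa> of the density bound.\<close>
  also have "\<dots> < ennreal (h * (\<kappa> / c))"
  proof (rule ennreal_lessI)
    have "1 < \<kappa> / c" using \<kappa> c by (simp add: field_simps)
    then show "h < h * (\<kappa> / c)" using mult_strict_left_mono[of 1 "\<kappa> / c" h] h0 by (simp only: mult_1_right)
    then show "0 < h * (\<kappa> / c)" using h0 by linarith
  qed
  finally obtain C :: "nat \<Rightarrow> 'a set" where C: "E \<subseteq> (\<Union>i. C i)" "\<And>i. bounded (C i)"
      "(\<Sum>i. ennreal (\<kappa> * diameter (C i) ^ 2)) < ennreal (h * (\<kappa> / c))"
    unfolding \<kappa>_def by (rule hausdorff_pre_approx) blast
  have piece: "hausdorff_outer 2 (E \<inter> C i) \<le> ennreal (c * (diameter (C i))\<^sup>2)" for i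
  proof (cases "E \<inter> C i = {}")
    case True then show ?thesis by (simp add: hausdorff_outer_empty)
  next
    case False
    then obtain y where y: "y \<in> E" "y \<in> C i" by blast
    have d: "dist y w \<le> diameter (C i)" if "w \<in> C i" for w using y that C(2) by (intro diameter_bounded_bound)
    show ?thesis
    proof (cases "diameter (C i) = 0")
      case True
      then have "E \<inter> C i \<subseteq> {y}" using d by auto
      then have "hausdorff_outer 2 (E \<inter> C i) \<le> hausdorff_outer 2 {y}" by (rule hausdorff_outer_mono)
      then show ?thesis by (simp add: hausdorff_outer_singleton)
    next
      case False
      then have dp: "0 < diameter (C i)" using diameter_ge_0[OF C(2), of i] by linarith
      have "E \<inter> C i \<subseteq> f ` (S \<inter> f -` cball y (diameter (C i)))" using d by (auto simp: E_def)
      then have "hausdorff_outer 2 (E \<inter> C i) \<le> hausdorff_outer 2 (f ` (S \<inter> f -` cball y (diameter (C i))))" by (rule hausdorff_outer_mono)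
      also have "\<dots> \<le> vol 2 f (S \<inter> f -` cball y (diameter (C i)))"
        by (intro hausdorff_outer_image_le_vol compact_preimage_closed S continuous_on_subset[OF S(2)]) auto
      also have "\<dots> \<le> ennreal (c * (diameter (C i))\<^sup>2)" using y dp by (auto simp: E_def intro: less_imp_le)
      finally show ?thesis .
    qed
  qed
  have "hausdorff_outer 2 E \<le> hausdorff_outer 2 (\<Union>i. E \<inter> C i)" using C(1) by (intro hausdorff_outer_mono) auto
  also have "\<dots> \<le> (\<Sum>i. hausdorff_outer 2 (E \<inter> C i))" by (rule hausdorff_outer_countable_subadditive)
  also have "\<dots> \<le> (\<Sum>i. ennreal (c * (diameter (C i))\<^sup>2))" by (intro suminf_le piece summableI)
  also have "\<dots> = (\<Sum>i. ennreal (c / \<kappa>) * ennreal (\<kappa> * (diameter (C i))\<^sup>2))"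
  proof (intro suminf_cong)
    fix i
    have "c * (diameter (C i))\<^sup>2 = c / \<kappa> * (\<kappa> * (diameter (C i))\<^sup>2)" using \<kappa> by simp
    then show "ennreal (c * (diameter (C i))\<^sup>2) = ennreal (c / \<kappa>) * ennreal (\<kappa> * (diameter (C i))\<^sup>2)"
      using \<kappa> c by (subst ennreal_mult[symmetric]) auto
  qed
  also have "\<dots> = ennreal (c / \<kappa>) * (\<Sum>i. ennreal (\<kappa> * (diameter (C i))\<^sup>2))" by simp
  also have "\<dots> < ennreal (c / \<kappa>) * ennreal (h * (\<kappa> / c))"
    by (rule ennreal_mult_strict_left_mono[OF C(3)]) (use \<kappa> c in auto)
  also have "\<dots> = ennreal h" using \<kappa> c h by (subst ennreal_mult[symmetric]) auto
  finally show False using h by simp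
qed

text \<open>Radii lie between \<rho>0 and \<open>R\<close>, so finitely many dyadic thresholds are
  passed, from large radii to small. At each, the family is extended to one of maximal cardinality,
  which exists by the bound \<open>N\<close>. A doubled ball left out meets a chosen one of at least
  half its radius, whence 2 * 2 + 2 = 6.\<close>

lemma finite_vitali:
  fixes S :: "'a::metric_space set" and \<rho> :: "'a \<Rightarrow> real"
  assumes \<rho>: "\<And>y. y \<in> S \<Longrightarrow> \<rho>0 < \<rho> y" "\<And>y. y \<in> S \<Longrightarrow> \<rho> y \<le> R" and "0 < \<rho>0"
    and N: "\<And>T. finite T \<Longrightarrow> T \<subseteq> S \<Longrightarrow> disjoint_family_on (\<lambda>y. cball y (2 * \<rho> y)) T \<Longrightarrow> card T \<le> N"
  shows "\<exists>T. finite T \<and> T \<subseteq> S \<and> disjoint_family_on (\<lambda>y. cball y (2 * \<rho> y)) T \<and> (\<forall>y\<in>S. \<exists>t\<in>T. dist t y \<le> 6 * \<rho> t)"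
proof -
  have claim: "\<exists>T. finite T \<and> T \<subseteq> {y \<in> S. R / 2 ^ j < \<rho> y} \<and> disjoint_family_on (\<lambda>y. cball y (2 * \<rho> y)) T \<and>
    (\<forall>y\<in>S. R / 2 ^ j < \<rho> y \<longrightarrow> (\<exists>t\<in>T. dist t y \<le> 6 * \<rho> t))" for j :: nat
  proof (induction j)
    case 0
    show ?case using \<rho>(2) by (intro exI[of _ "{}"]) (auto simp: disjoint_family_on_def not_le[symmetric])
  next
    case (Suc j)
    then obtain T where T: "finite T" "T \<subseteq> {y \<in> S. R / 2 ^ j < \<rho> y}" "disjoint_family_on (\<lambda>y. cball y (2 * \<rho> y)) T"
      "\<And>y. y \<in> S \<Longrightarrow> R / 2 ^ j < \<rho> y \<Longrightarrow> \<exists>t\<in>T. dist t y \<le> 6 * \<rho> t" by blast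
    define P where "P T' \<longleftrightarrow> finite T' \<and> T \<subseteq> T' \<and> T' \<subseteq> {y \<in> S. R / 2 ^ Suc j < \<rho> y} \<and> disjoint_family_on (\<lambda>y. cball y (2 * \<rho> y)) T'" for T'
    have "P T"
    proof -
      have "R / 2 ^ Suc j < \<rho> y" if "y \<in> T" for y
      proof -
        have "\<rho>0 < \<rho> y" "R / 2 ^ j < \<rho> y" using that T(2) \<rho>(1) by auto
        then show ?thesis using \<open>0 < \<rho>0\<close> by simp
      qed
      then show ?thesis using T by (auto simp: P_def)
    qed
    moreover have "\<forall>T'. P T' \<longrightarrow> card T' < Suc N" using N by (auto simp: P_def less_Suc_eq_le)
    ultimately obtain T' where T': "P T'" "\<And>T''. P T'' \<Longrightarrow> card T'' \<le> card T'"
      using ex_has_greatest_nat[of P T card "Suc N"] by blast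
    show ?case
    proof (intro exI[of _ T'] conjI ballI impI)
      fix y assume y: "y \<in> S" "R / 2 ^ Suc j < \<rho> y"
      show "\<exists>t\<in>T'. dist t y \<le> 6 * \<rho> t"
      proof (cases "R / 2 ^ j < \<rho> y")
        case True
        then show ?thesis using T(4)[OF y(1)] T'(1) by (auto simp: P_def)
      next
        case False
        show ?thesis
        proof (cases "y \<in> T'")
          case True
          then show ?thesis using \<rho>(1)[OF y(1)] \<open>0 < \<rho>0\<close> by (intro bexI[of _ y]) auto
        next
          case nT: False
          have "\<not> P (insert y T')"
          proof
            assume "P (insert y T')"
            then have "card (insert y T') \<le> card T'" by (rule T'(2))
            then show False using nT T'(1) by (simp add: P_def)
          qed
          then have "\<not> disjoint_family_on (\<lambda>y. cball y (2 * \<rho> y)) (insert y T')" using T'(1) y by (auto simp: P_def)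
          then have "\<exists>t\<in>T'. cball y (2 * \<rho> y) \<inter> cball t (2 * \<rho> t) \<noteq> {}"
            using T'(1) nT unfolding P_def by (simp add: disjoint_family_on_insert) blast
          then obtain t w where t: "t \<in> T'" "dist y w \<le> 2 * \<rho> y" "dist t w \<le> 2 * \<rho> t" by auto
          have "R / 2 ^ Suc j < \<rho> t" using t T'(1) by (auto simp: P_def)
          then have "\<rho> y \<le> 2 * \<rho> t" using False by simp
          then have "dist t y \<le> 6 * \<rho> t" using t dist_triangle2[of t y w] by linarith
          then show ?thesis using t by blast
        qed
      qed
    qed (use T'(1) in \<open>auto simp: P_def\<close>)
  qed
  obtain j :: nat where j: "R / \<rho>0 < 2 ^ j" using real_arch_pow[of 2 "R / \<rho>0"] by auto
  have "R / 2 ^ j < \<rho> y" if "y \<in> S" for y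
  proof -
    have "R / 2 ^ j < \<rho>0" using j \<open>0 < \<rho>0\<close> by (simp add: field_simps)
    then show ?thesis using \<rho>(1)[OF that] by linarith
  qed
  then show ?thesis using claim[of j] by (metis (no_types, lifting) mem_Collect_eq subset_iff)
qed

text \<open>4 and 64 are the squares of 2 and 8: the density is at least \<open>c\<close> at radius
  \<rho>, and at most \<open>c\<close> both at 2 * \<rho>, where the collapse takes place, and at 8
  * \<rho>, where the Vitali enlargement is measured.\<close>

definition critical_ball :: "('b \<Rightarrow> 'a::metric_space) \<Rightarrow> 'b set \<Rightarrow> real \<Rightarrow> 'a \<Rightarrow> real \<Rightarrow> bool" where
  "critical_ball f S c y \<rho> \<longleftrightarrow> 0 < \<rho> \<and> ennreal (c * \<rho>\<^sup>2) \<le> vol 2 f (S \<inter> f -` cball y \<rho>) \<and>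
     vol 2 f (S \<inter> f -` cball y (2 * \<rho>)) \<le> ennreal (4 * c * \<rho>\<^sup>2) \<and> vol 2 f (S \<inter> f -` cball y (8 * \<rho>)) \<le> ennreal (64 * c * \<rho>\<^sup>2)"

text \<open>The radius is the largest multiple of \<open>r\<close> by a power of 2 at which the
  density is still at least \<open>c\<close>; it exists because the total area is finite. All larger
  such multiples have smaller density. The enlargement 8 is the first power of 2 beyond the Vitali
  factor 6.\<close>

lemma critical_ball_exists:
  assumes A: "vol 2 f S \<le> ennreal A" "0 \<le> A" and c: "0 < c" and r: "0 < r" "ennreal (c * r\<^sup>2) \<le> vol 2 f (S \<inter> f -` cball y r)"
  shows "\<exists>\<rho>. critical_ball f S c y \<rho>"
proof -
  define P where "P n \<longleftrightarrow> ennreal (c * (2 ^ n * r)\<^sup>2) \<le> vol 2 f (S \<inter> f -` cball y (2 ^ n * r))" for n :: nat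
  have "P 0" using r by (simp add: P_def)
  have bound: "n \<le> nat \<lceil>A / (c * r\<^sup>2)\<rceil>" if "P n" for n
  proof -
    have "ennreal (c * (2 ^ n * r)\<^sup>2) \<le> vol 2 f S" using that unfolding P_def by (rule order_trans) (intro vol_mono, auto)
    then have "ennreal (c * (2 ^ n * r)\<^sup>2) \<le> ennreal A" using A(1) by (rule order_trans)
    then have 1: "c * (2 ^ n * r)\<^sup>2 \<le> A" using A by (simp add: ennreal_le_iff)
    have "real n \<le> 2 ^ n" using of_nat_less_two_power[of n] by (simp add: less_imp_le)
    also have "\<dots> \<le> (2 ^ n)\<^sup>2" by (simp add: self_le_power)
    finally have "real n * (c * r\<^sup>2) \<le> (2 ^ n)\<^sup>2 * (c * r\<^sup>2)" using c by (intro mult_right_mono) auto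
    also have "\<dots> = c * (2 ^ n * r)\<^sup>2" by (simp add: power_mult_distrib)
    finally have "real n * (c * r\<^sup>2) \<le> A" using 1 by linarith
    then have "real n \<le> A / (c * r\<^sup>2)" using c r by (simp add: field_simps)
    then show ?thesis by linarith
  qed
  define n where "n = Greatest P"
  have n: "P n" unfolding n_def using \<open>P 0\<close> bound by (rule GreatestI_nat)
  have above: "vol 2 f (S \<inter> f -` cball y (2 ^ (n + k) * r)) \<le> ennreal (c * (2 ^ (n + k) * r)\<^sup>2)" if "0 < k" for k
  proof -
    have "\<not> P (n + k)"
    proof
      assume "P (n + k)"
      then have "n + k \<le> n" unfolding n_def using bound by (rule Greatest_le_nat)
      then show False using that by simp
    qed
    then show ?thesis by (simp add: P_def not_le less_imp_le)
  qed
  have "critical_ball f S c y (2 ^ n * r)"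
    unfolding critical_ball_def
  proof (intro conjI)
    show "0 < 2 ^ n * r" using r by simp
    show "ennreal (c * (2 ^ n * r)\<^sup>2) \<le> vol 2 f (S \<inter> f -` cball y (2 ^ n * r))" using n by (simp add: P_def)
    have e: "2 ^ (n + 1) * r = 2 * (2 ^ n * r)" "2 ^ (n + 3) * r = 8 * (2 ^ n * r)" by (simp_all add: power_add)
    show "vol 2 f (S \<inter> f -` cball y (2 * (2 ^ n * r))) \<le> ennreal (4 * c * (2 ^ n * r)\<^sup>2)"
      using above[of 1] unfolding e by (simp add: power_mult_distrib mult_ac)
    show "vol 2 f (S \<inter> f -` cball y (8 * (2 ^ n * r))) \<le> ennreal (64 * c * (2 ^ n * r)\<^sup>2)"
      using above[of 3] unfolding e by (simp add: power_mult_distrib mult_ac)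
  qed
  then show ?thesis by blast
qed

lemma critical_balls_cover:
  fixes f :: "'b::euclidean_space \<Rightarrow> 'a::metric_space"
  assumes S: "compact S" "continuous_on S f" and A: "vol 2 f S = ennreal A" "0 < A" and c: "0 < c" "c < hausdorff_const 2"
  obtains T \<rho> where "finite T" "T \<subseteq> f ` S" "disjoint_family_on (\<lambda>t. cball t (2 * \<rho> t)) T" "\<And>t. t \<in> T \<Longrightarrow> critical_ball f S c t (\<rho> t)"
    "A / 128 \<le> (\<Sum>t\<in>T. c * (\<rho> t)\<^sup>2)"
proof -
  define \<mu> where "\<mu> = area_measure f S"
  have em: "emeasure \<mu> B = vol 2 f (S \<inter> f -` B)" if "B \<in> sets borel" for B
    unfolding \<mu>_def using S that by (rule emeasure_area_measure)
  have sets: "sets \<mu> = sets borel" and space: "space \<mu> = UNIV" by (simp_all add: \<mu>_def)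
  have tot: "emeasure \<mu> UNIV = ennreal A" using em[of UNIV] A by simp
  define G where "G n = {y \<in> f ` S. \<exists>\<rho>>1 / real (Suc n). critical_ball f S c y \<rho>}" for n :: nat
  define rad where "rad n y = (SOME \<rho>. \<rho> > 1 / real (Suc n) \<and> critical_ball f S c y \<rho>)" for n y
  have rad: "1 / real (Suc n) < rad n y" "critical_ball f S c y (rad n y)" if "y \<in> G n" for n y
  proof -
    have "\<exists>\<rho>. \<rho> > 1 / real (Suc n) \<and> critical_ball f S c y \<rho>" using that by (auto simp: G_def)
    from someI_ex[OF this] show "1 / real (Suc n) < rad n y" "critical_ball f S c y (rad n y)" by (auto simp: rad_def)
  qed
  have mass: "c * (rad n y)\<^sup>2 \<le> measure \<mu> (cball y (rad n y))" if "y \<in> G n" for n y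
  proof -
    have "ennreal (c * (rad n y)\<^sup>2) \<le> emeasure \<mu> (cball y (rad n y))"
      using rad(2)[OF that] by (simp add: critical_ball_def em)
    moreover have "emeasure \<mu> (cball y (rad n y)) < top"
    proof -
      have "emeasure \<mu> (cball y (rad n y)) \<le> emeasure \<mu> UNIV" by (intro emeasure_mono) (simp_all add: sets)
      then show ?thesis using tot by (simp add: le_less_trans)
    qed
    ultimately show ?thesis by (simp add: emeasure_eq_ennreal_measure less_top)
  qed
  interpret finite_measure \<mu> by standard (simp add: space tot)
  have totm: "measure \<mu> UNIV = A" using tot A by (simp add: measure_def)
  have sum_le: "(\<Sum>t\<in>T. c * (rad n t)\<^sup>2) \<le> A" if T: "finite T" "T \<subseteq> G n" "disjoint_family_on (\<lambda>y. cball y (2 * rad n y)) T" for T n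
  proof -
    have pos: "0 < rad n t" if "t \<in> T" for t using rad(2)[of t n] T that by (auto simp: critical_ball_def)
    have "(\<Sum>t\<in>T. c * (rad n t)\<^sup>2) \<le> (\<Sum>t\<in>T. measure \<mu> (cball t (rad n t)))"
      using T by (intro sum_mono mass) auto
    also have "\<dots> = measure \<mu> (\<Union>t\<in>T. cball t (rad n t))"
    proof (rule finite_measure_finite_Union[symmetric])
      show "disjoint_family_on (\<lambda>t. cball t (rad n t)) T"
        unfolding disjoint_family_on_def
      proof (intro ballI impI)
        fix s t assume st: "s \<in> T" "t \<in> T" "s \<noteq> t"
        then have "cball s (2 * rad n s) \<inter> cball t (2 * rad n t) = {}" using T(3) by (auto simp: disjoint_family_on_def)
        moreover have "cball s (rad n s) \<subseteq> cball s (2 * rad n s)" "cball t (rad n t) \<subseteq> cball t (2 * rad n t)"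
          using pos[OF st(1)] pos[OF st(2)] by (auto intro!: subset_cball)
        ultimately show "cball s (rad n s) \<inter> cball t (rad n t) = {}" by blast
      qed
    qed (use T in \<open>auto simp: sets\<close>)
    also have "\<dots> \<le> measure \<mu> UNIV" by (intro finite_measure_mono) (auto simp: sets)
    finally show ?thesis by (simp add: totm)
  qed
  have "\<exists>T. finite T \<and> T \<subseteq> G n \<and> disjoint_family_on (\<lambda>y. cball y (2 * rad n y)) T \<and> (\<forall>y\<in>G n. \<exists>t\<in>T. dist t y \<le> 6 * rad n t)" for n
  proof (rule finite_vitali)
    show "1 / real (Suc n) < rad n y" if "y \<in> G n" for y using rad(1)[OF that] .
    show "0 < 1 / real (Suc n)" by simp
    show "rad n y \<le> sqrt (A / c)" if "y \<in> G n" for y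
    proof -
      have "c * (rad n y)\<^sup>2 \<le> A" using sum_le[of "{y}" n] that by (simp add: disjoint_family_on_def)
      then have "(rad n y)\<^sup>2 \<le> A / c" using c by (simp add: field_simps)
      then show ?thesis by (rule real_le_rsqrt)
    qed
    fix T assume T: "finite T" "T \<subseteq> G n" "disjoint_family_on (\<lambda>y. cball y (2 * rad n y)) T"
    have "(\<Sum>t\<in>T. c * (1 / real (Suc n))\<^sup>2) \<le> (\<Sum>t\<in>T. c * (rad n t)\<^sup>2)"
      using T rad(1) c by (intro sum_mono mult_left_mono power_mono) (auto intro: less_imp_le)
    also have "\<dots> \<le> A" by (rule sum_le[OF T])
    finally have "real (card T) * (c * (1 / real (Suc n))\<^sup>2) \<le> A" by simp
    then have "real (card T) \<le> A / (c * (1 / real (Suc n))\<^sup>2)" using c by (simp add: field_simps)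
    then show "card T \<le> nat \<lceil>A / (c * (1 / real (Suc n))\<^sup>2)\<rceil>" by linarith
  qed
  then obtain T where T: "\<And>n. finite (T n)" "\<And>n. T n \<subseteq> G n" "\<And>n. disjoint_family_on (\<lambda>y. cball y (2 * rad n y)) (T n)"
    "\<And>n y. y \<in> G n \<Longrightarrow> \<exists>t\<in>T n. dist t y \<le> 6 * rad n t" by metis
  define U where "U n = (\<Union>t\<in>T n. cball t (8 * rad n t))" for n
  have Ucl: "closed (U n)" for n unfolding U_def using T by auto
  have GU: "G n \<subseteq> U n" for n
  proof
    fix y assume y: "y \<in> G n"
    then obtain t where t: "t \<in> T n" "dist t y \<le> 6 * rad n t" using T(4) by blast
    have "0 < rad n t" using rad(2)[of t n] T(2) t by (auto simp: critical_ball_def)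
    then show "y \<in> U n" using t by (auto simp: U_def intro!: bexI[of _ t])
  qed
  have "\<exists>n. A / 2 \<le> measure \<mu> (U n)"
  proof (rule ccontr)
    assume "\<not> ?thesis"
    then have small: "measure \<mu> (U n) < A / 2" for n by (auto simp: not_le)
    have compl: "A / 2 \<le> measure \<mu> (- U n)" for n
    proof -
      have "measure \<mu> (- U n) = measure \<mu> UNIV - measure \<mu> (U n)"
        using finite_measure_compl[of "U n"] Ucl[of n] by (simp add: sets space Compl_eq_Diff_UNIV)
      then show ?thesis using small[of n] totm by linarith
    qed
    \<comment> \<open>The tail unions decrease to the limit superior of the complements, so
      continuity from above applies in the finite measure \<mu>.\<close>
    define W where "W n = (\<Union>m\<in>{n..}. - U m)" for n
    have Wop: "open (W n)" for n unfolding W_def using Ucl by auto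
    have "decseq W" unfolding decseq_def W_def by force
    then have "(\<lambda>n. measure \<mu> (W n)) \<longlonglongrightarrow> measure \<mu> (\<Inter>n. W n)"
      by (intro finite_Lim_measure_decseq) (auto simp: sets Wop)
    moreover have "A / 2 \<le> measure \<mu> (W n)" for n
    proof -
      have "measure \<mu> (- U n) \<le> measure \<mu> (W n)"
        using Wop[of n] by (intro finite_measure_mono) (auto simp: sets W_def[of n])
      then show ?thesis using compl[of n] by linarith
    qed
    ultimately have big: "A / 2 \<le> measure \<mu> (\<Inter>n. W n)" by (intro LIMSEQ_le_const) auto
    define B where "B = (\<Inter>n. W n)"
    have vfin: "vol 2 f S < top" using A(1) by simp
    have Bb: "B \<in> sets borel" unfolding B_def using Wop by auto
    have fSb: "f ` S \<in> sets borel" using S by (intro borel_closed compact_imp_closed compact_continuous_image)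
    have "B \<inter> f ` S \<subseteq> {y \<in> f ` S. \<forall>r>0. vol 2 f (S \<inter> f -` cball y r) < ennreal (c * r\<^sup>2)}"
    proof
      fix y assume y: "y \<in> B \<inter> f ` S"
      have "vol 2 f (S \<inter> f -` cball y r) < ennreal (c * r\<^sup>2)" if "0 < r" for r
      proof (rule ccontr)
        assume "\<not> ?thesis"
        then have "ennreal (c * r\<^sup>2) \<le> vol 2 f (S \<inter> f -` cball y r)" by (simp add: not_less)
        then obtain \<rho> where \<rho>: "critical_ball f S c y \<rho>"
          using critical_ball_exists[of f S A c r y] A c \<open>0 < r\<close> by auto
        then have "0 < \<rho>" by (simp add: critical_ball_def)
        then obtain n where n: "1 / real (Suc n) < \<rho>" using nat_approx_posE by blast
        obtain m where m: "n \<le> m" "y \<notin> U m" using y by (auto simp: B_def W_def)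
        have "1 / real (Suc m) \<le> 1 / real (Suc n)" using m by (intro divide_left_mono) auto
        then have "y \<in> G m" using n \<rho> y by (auto simp: G_def intro!: exI[of _ \<rho>])
        then show False using GU m by blast
      qed
      then show "y \<in> {y \<in> f ` S. \<forall>r>0. vol 2 f (S \<inter> f -` cball y r) < ennreal (c * r\<^sup>2)}" using y by auto
    qed
    then have "hausdorff_outer 2 (B \<inter> f ` S) \<le> 0"
      unfolding low_density_null[OF S vfin c, symmetric] by (rule hausdorff_outer_mono)
    then have "B \<inter> f ` S \<in> null_sets (hausdorff_measure 2)"
      using Bb fSb by (auto simp: null_sets_def emeasure_hausdorff_measure)
    then have "(\<integral>\<^sup>+ y \<in> B \<inter> f ` S. mult f S y \<partial>hausdorff_measure 2) = 0" by (rule nn_integral_null_set)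
    moreover have "mult f S y * indicator (B \<inter> f ` S) y = mult f (S \<inter> f -` B) y" for y
      unfolding mult_Int_vimage using mult_eq_0[of y f S] by (auto simp: indicator_def)
    ultimately have "emeasure \<mu> B = 0" unfolding em[OF Bb] vol_def by simp
    then have "measure \<mu> B = 0" by (simp add: measure_def)
    then show False using big A by (simp add: B_def)
  qed
  then obtain n where n: "A / 2 \<le> measure \<mu> (U n)" by blast
  have "A / 2 \<le> (\<Sum>t\<in>T n. measure \<mu> (cball t (8 * rad n t)))"
    using n unfolding U_def
    by (rule order_trans) (intro finite_measure_subadditive_finite, use T in \<open>auto simp: sets\<close>)
  also have "\<dots> \<le> (\<Sum>t\<in>T n. 64 * (c * (rad n t)\<^sup>2))"
  proof (intro sum_mono)
    fix t assume "t \<in> T n"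
    then have "critical_ball f S c t (rad n t)" using rad T by blast
    then have "emeasure \<mu> (cball t (8 * rad n t)) \<le> ennreal (64 * c * (rad n t)\<^sup>2)" by (simp add: critical_ball_def em)
    then have "measure \<mu> (cball t (8 * rad n t)) \<le> 64 * c * (rad n t)\<^sup>2"
      using c by (simp add: emeasure_eq_measure ennreal_le_iff)
    then show "measure \<mu> (cball t (8 * rad n t)) \<le> 64 * (c * (rad n t)\<^sup>2)" by simp
  qed
  also have "\<dots> = 64 * (\<Sum>t\<in>T n. c * (rad n t)\<^sup>2)" by (simp add: sum_distrib_left)
  finally have "A / 128 \<le> (\<Sum>t\<in>T n. c * (rad n t)\<^sup>2)" by simp
  moreover have "critical_ball f S c t (rad n t)" if "t \<in> T n" for t using rad T that by blast
  moreover have "T n \<subseteq> f ` S" using T(2)[of n] by (auto simp: G_def)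
  ultimately show ?thesis using that[of "T n" "rad n"] T by blast
qed

section \<open>The isoperimetric inequality\<close>

text \<open>Each \<open>\<rho>^3\<close> is at most \<open>\<rho>^2\<close> times sqrt (A / c), a
  bound for all critical radii, and the sum of the \<open>c * \<rho>^2\<close> is at most
  \<open>2 * A\<close>.\<close>

definition step_const :: real where
  "step_const = 2 * ball_const / (density_const * sqrt density_const)"

lemma step_const_pos: "0 < step_const"
  using ball_const_pos density_const_pos by (simp add: step_const_def)

context cat0_space
begin

text \<open>The chosen balls have a sum of \<open>c * \<rho>^2\<close> of at least
  \<open>A / 128\<close>, and half of this sum is removed, hence 255 / 256.\<close>

lemma area_decrease_step:
  fixes f :: "real^3 \<Rightarrow> 'a"
  assumes lip: "L-lipschitz_on (sphere 0 1) f" and R: "f ` sphere 0 1 \<subseteq> cball p R"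
    and A: "vol 2 f (sphere 0 1) = ennreal A" "0 < A"
  shows "\<exists>f' L'. L'-lipschitz_on (sphere 0 1) f' \<and> f' ` sphere 0 1 \<subseteq> cball p R \<and>
    vol 2 f' (sphere 0 1) \<le> ennreal (255 / 256 * A) \<and>
    (\<forall>V. fillable f' V \<longrightarrow> fillable f (V + ennreal (step_const * (A * sqrt A))))"
proof -
  define c where "c = density_const"
  have c: "0 < c" "c < hausdorff_const 2" using density_const_pos density_const_less by (auto simp: c_def)
  have cont: "continuous_on (sphere 0 1) f" using lip by (rule lipschitz_on_continuous_on)
  obtain T \<rho> where T: "finite T" "T \<subseteq> f ` sphere 0 1" "disjoint_family_on (\<lambda>t. cball t (2 * \<rho> t)) T"
    "\<And>t. t \<in> T \<Longrightarrow> critical_ball f (sphere 0 1) c t (\<rho> t)" "A / 128 \<le> (\<Sum>t\<in>T. c * (\<rho> t)\<^sup>2)"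
  proof (rule critical_balls_cover[OF _ cont A c])
    show "compact (sphere 0 1 :: (real^3) set)" by simp
  qed blast
  have "\<exists>f' L'. L'-lipschitz_on (sphere 0 1) f' \<and> f' ` sphere 0 1 \<subseteq> cball p R \<and>
    vol 2 f' (sphere 0 1) + ennreal (\<Sum>t\<in>T. density_const * (\<rho> t)\<^sup>2 / 2) \<le> vol 2 f (sphere 0 1) \<and>
    (\<forall>V. fillable f' V \<longrightarrow> fillable f (V + ennreal (\<Sum>t\<in>T. ball_const * \<rho> t ^ 3)))"
    by (rule disjoint_balls_step[OF T(1) lip R _ T(3)]) (use T(2,4) R in \<open>auto simp: critical_ball_def c_def\<close>)
  then obtain f' L' where f': "L'-lipschitz_on (sphere 0 1) f'" "f' ` sphere 0 1 \<subseteq> cball p R"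
    "vol 2 f' (sphere 0 1) + ennreal (\<Sum>t\<in>T. c * (\<rho> t)\<^sup>2 / 2) \<le> ennreal A"
    "\<And>V. fillable f' V \<Longrightarrow> fillable f (V + ennreal (\<Sum>t\<in>T. ball_const * \<rho> t ^ 3))"
    unfolding c_def A(1) by blast
  define s where "s = (\<Sum>t\<in>T. c * (\<rho> t)\<^sup>2)"
  have s: "(\<Sum>t\<in>T. c * (\<rho> t)\<^sup>2 / 2) = s / 2" by (simp add: s_def sum_divide_distrib)
  have s0: "0 \<le> s" unfolding s_def using c by (intro sum_nonneg) auto
  \<comment> \<open>The removed area cannot exceed \<open>A\<close>, so the step itself bounds the
    sum of the \<open>c * \<rho>^2\<close>, with no further packing argument.\<close>
  have "ennreal (s / 2) \<le> ennreal A" using f'(3) unfolding s by (metis add_increasing zero_le order_trans le_iff_add add.commute)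
  then have sA: "s \<le> 2 * A" using A by (simp add: ennreal_le_iff)
  have "vol 2 f' (sphere 0 1) < top" using f'(1) by (rule vol_lipschitz_sphere_finite)
  then obtain a where a: "vol 2 f' (sphere 0 1) = ennreal a" "0 \<le> a" by (cases "vol 2 f' (sphere 0 1)") auto
  have "ennreal (a + s / 2) \<le> ennreal A" using f'(3) a s0 unfolding s by (simp add: ennreal_plus)
  then have "a + s / 2 \<le> A" using A by (simp add: ennreal_le_iff)
  then have aA: "a \<le> 255 / 256 * A" using T(5) by (simp add: s_def)
  have \<rho>pos: "0 < \<rho> t" if "t \<in> T" for t using T(4)[OF that] by (simp add: critical_ball_def)
  have \<rho>A: "\<rho> t \<le> sqrt (A / c)" if "t \<in> T" for t
  proof -
    have "ennreal (c * (\<rho> t)\<^sup>2) \<le> vol 2 f (sphere 0 1 \<inter> f -` cball t (\<rho> t))" using T(4)[OF that] by (simp add: critical_ball_def)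
    also have "\<dots> \<le> ennreal A" unfolding A(1)[symmetric] by (rule vol_mono) auto
    finally have "c * (\<rho> t)\<^sup>2 \<le> A" using A by (simp add: ennreal_le_iff)
    then have "(\<rho> t)\<^sup>2 \<le> A / c" using c by (simp add: field_simps)
    then show ?thesis by (rule real_le_rsqrt)
  qed
  have "(\<Sum>t\<in>T. ball_const * \<rho> t ^ 3) \<le> (\<Sum>t\<in>T. ball_const * (sqrt (A / c) / c) * (c * (\<rho> t)\<^sup>2))"
  proof (intro sum_mono)
    fix t assume t: "t \<in> T"
    have "ball_const * \<rho> t ^ 3 = ball_const * (\<rho> t * (\<rho> t)\<^sup>2)" by (simp add: power2_eq_square power3_eq_cube)
    also have "\<dots> \<le> ball_const * (sqrt (A / c) * (\<rho> t)\<^sup>2)"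
      using ball_const_pos \<rho>A[OF t] by (intro mult_left_mono mult_right_mono) auto
    also have "\<dots> = ball_const * (sqrt (A / c) / c) * (c * (\<rho> t)\<^sup>2)" using c by simp
    finally show "ball_const * \<rho> t ^ 3 \<le> ball_const * (sqrt (A / c) / c) * (c * (\<rho> t)\<^sup>2)" .
  qed
  also have "\<dots> = ball_const * (sqrt (A / c) / c) * s" by (simp add: s_def sum_distrib_left)
  also have "\<dots> \<le> ball_const * (sqrt (A / c) / c) * (2 * A)"
    using sA ball_const_pos c A by (intro mult_left_mono) auto
  also have "\<dots> = step_const * (A * sqrt A)"
    using c by (simp add: step_const_def c_def real_sqrt_divide mult_ac)
  finally have vol: "ennreal (\<Sum>t\<in>T. ball_const * \<rho> t ^ 3) \<le> ennreal (step_const * (A * sqrt A))" by (rule ennreal_leI)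
  have "fillable f (V + ennreal (step_const * (A * sqrt A)))" if "fillable f' V" for V
    using f'(4)[OF that] add_left_mono[OF vol] by (rule fillable_mono)
  moreover have "vol 2 f' (sphere 0 1) \<le> ennreal (255 / 256 * A)" unfolding a(1) using aA by (rule ennreal_leI)
  ultimately show ?thesis using f'(1,2) by blast
qed

text \<open>The cone is the geodesic homotopy to the constant map at \<open>p\<close>: there is no
  stretch, \<open>K = 0\<close>, and the geodesics have length at most \<open>R\<close>.\<close>

lemma fillable_cone:
  fixes f :: "real^3 \<Rightarrow> 'a"
  assumes lip: "L-lipschitz_on (sphere 0 1) f" and R: "f ` sphere 0 1 \<subseteq> cball p R" "0 < R"
  shows "fillable f (ennreal (cylinder_const * R) * vol 2 f (sphere 0 1))"
proof -
  have L0: "0 \<le> L" using lip by (rule lipschitz_on_nonneg)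
  have dp: "dist (f x) p \<le> R" if "x \<in> sphere 0 1" for x
    using subsetD[OF R(1) imageI[OF that]] by (simp add: dist_commute)
  have est: "dist (geod (f x) p s) (geod (f y) p s') \<le> dist (f x) (f y) + \<bar>s - s'\<bar> * R"
    if "s \<in> {0..1}" "s' \<in> {0..1}" "x \<in> sphere 0 1" for s s' x y
  proof -
    have "dist (geod (f x) p s) (geod (f y) p s') \<le> dist (f x) (f y) + dist p p + \<bar>s - s'\<bar> * dist (f x) p"
      by (rule geod_dist_le') (use that in auto)
    moreover have "\<bar>s - s'\<bar> * dist (f x) p \<le> \<bar>s - s'\<bar> * R" using dp[OF that(3)] by (intro mult_left_mono) auto
    ultimately show ?thesis by simp
  qed
  have "fillable f (0 + (\<Sum>i\<in>{()}. ennreal (cylinder_const * R) * vol 2 f (sphere 0 1)))"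
  proof (rule fillable_homotopy[where H = "\<lambda>s x. geod (f x) p s" and M = "L + R" and f' = "\<lambda>_. p"])
    fix s s' :: real and x y :: "real^3" assume *: "s \<in> {0..1}" "s' \<in> {0..1}" "x \<in> sphere 0 1" "y \<in> sphere 0 1"
    have "dist (geod (f x) p s) (geod (f y) p s') \<le> L * dist x y + \<bar>s - s'\<bar> * R"
      using est[OF *(1,2,3), of y] lipschitz_onD[OF lip *(3,4)] by linarith
    also have "\<dots> \<le> (L + R) * (\<bar>s - s'\<bar> + dist x y)"
    proof -
      have "0 \<le> L * \<bar>s - s'\<bar>" "0 \<le> R * dist x y" using L0 R by auto
      then show ?thesis by (simp add: algebra_simps)
    qed
    finally show "dist (geod (f x) p s) (geod (f y) p s') \<le> (L + R) * (\<bar>s - s'\<bar> + dist x y)" .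
  next
    show "fillable (\<lambda>_. p) 0" by (rule fillable_const)
    fix P :: "(real^3) set" and a b :: real assume P: "P \<subseteq> sphere 0 1" and ab: "0 \<le> a" "a < b" "b \<le> 1"
    have "hausdorff_outer 3 ((\<lambda>(s, x). geod (f x) p s) ` ({a..b} \<times> P)) \<le> ennreal (cylinder_const * (0 + 1) * R * (b - a)) * hausdorff_outer 2 ((\<lambda>q. f (snd q)) ` ({a..b} \<times> P))"
    proof (rule hausdorff_outer_stretch_cylinder[where v = "\<lambda>_. 0" and s = fst and \<eta> = 1])
      fix q q' assume "q \<in> {a..b} \<times> P" "q' \<in> {a..b} \<times> P"
      moreover obtain s x where q: "q = (s, x)" by fastforce
      moreover obtain s' y where q': "q' = (s', y)" by fastforce
      ultimately have "dist (geod (f x) p s) (geod (f y) p s') \<le> dist (f x) (f y) + \<bar>s - s'\<bar> * R"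
        using ab P by (intro est) auto
      then have "dist (geod (f x) p s) (geod (f y) p s') \<le> 2 * dist (f x) (f y) + R * \<bar>s - s'\<bar>"
        using zero_le_dist[of "f x" "f y"] mult.commute[of R "\<bar>s - s'\<bar>"] by linarith
      then show "dist ((\<lambda>(s, x). geod (f x) p s) q) ((\<lambda>(s, x). geod (f x) p s) q') \<le> 2 * dist (f (snd q)) (f (snd q')) + \<bar>0 - 0\<bar> + R * \<bar>fst q - fst q'\<bar>"
        by (simp add: q q')
    qed (use ab R in auto)
    also have "(\<lambda>q. f (snd q)) ` ({a..b} \<times> P) = f ` P" using ab by (force simp: image_iff)
    finally show "hausdorff_outer 3 ((\<lambda>(s, x). geod (f x) p s) ` ({a..b} \<times> P)) \<le> ennreal (cylinder_const * R * (b - a)) * hausdorff_outer 2 (f ` P)" by simp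
  qed (use L0 R cylinder_const_pos in auto)
  then show ?thesis by simp
qed

text \<open>\<open>A\<close> is an upper bound and not the area itself, so that the induction can
  pass to 255 / 256 * A. The square root is bounded by its first value, so the costs form a
  geometric series with the same ratio; the last summand is the cone after \<open>n\<close>
  rounds.\<close>

lemma fillable_iterate:
  fixes f :: "real^3 \<Rightarrow> 'a"
  assumes "L-lipschitz_on (sphere 0 1) f" "f ` sphere 0 1 \<subseteq> cball p R" "0 < R" "vol 2 f (sphere 0 1) \<le> ennreal A" "0 \<le> A"
  shows "fillable f (ennreal (step_const * (A * sqrt A) * (\<Sum>i<n. (255 / 256) ^ i) + cylinder_const * R * ((255 / 256) ^ n * A)))"
  using assms
proof (induction n arbitrary: f L A)
  case 0
  have "ennreal (cylinder_const * R) * vol 2 f (sphere 0 1) \<le> ennreal (cylinder_const * R * A)"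
    by (rule ennreal_mult_bound[OF 0(4)]) (use 0 cylinder_const_pos in auto)
  then show ?case using fillable_mono[OF fillable_cone[OF 0(1-3)]] by simp
next
  case (Suc n)
  define \<theta> :: real where "\<theta> = 255 / 256"
  have \<theta>: "0 < \<theta>" "\<theta> \<le> 1" by (auto simp: \<theta>_def)
  have sum0: "0 \<le> (\<Sum>i<m. \<theta> ^ i)" for m using \<theta> by (intro sum_nonneg) auto
  show ?case
  \<comment> \<open>\<open>area_decrease_step\<close> asks for positive area; for area 0 the cone
    already has volume 0.\<close>
  proof (cases "vol 2 f (sphere 0 1) = 0")
    case True
    have "fillable f 0" using fillable_cone[OF Suc.prems(1-3)] True by simp
    then show ?thesis by (rule fillable_mono) simp
  next
    case False
    have "vol 2 f (sphere 0 1) < top" using Suc.prems(4) by (rule le_less_trans) simp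
    then obtain A' where A': "vol 2 f (sphere 0 1) = ennreal A'" "0 \<le> A'" by (cases "vol 2 f (sphere 0 1)") auto
    have A'0: "0 < A'" using A' False by (cases "A' = 0") auto
    have AA: "A' \<le> A" using Suc.prems(4,5) A' by (simp add: ennreal_le_iff)
    obtain f' L' where f': "L'-lipschitz_on (sphere 0 1) f'" "f' ` sphere 0 1 \<subseteq> cball p R"
      "vol 2 f' (sphere 0 1) \<le> ennreal (\<theta> * A')" "\<And>V. fillable f' V \<Longrightarrow> fillable f (V + ennreal (step_const * (A' * sqrt A')))"
      using area_decrease_step[OF Suc.prems(1,2) A'(1) A'0] unfolding \<theta>_def by blast
    have "vol 2 f' (sphere 0 1) \<le> ennreal (\<theta> * A)" using f'(3) by (rule order_trans) (use AA \<theta> in \<open>auto intro!: ennreal_leI\<close>)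
    then have "fillable f' (ennreal (step_const * ((\<theta> * A) * sqrt (\<theta> * A)) * (\<Sum>i<n. \<theta> ^ i) + cylinder_const * R * (\<theta> ^ n * (\<theta> * A))))"
      unfolding \<theta>_def using Suc.prems(3,5) by (intro Suc.IH[OF f'(1,2)]) auto
    from f'(4)[OF this] show ?thesis
    proof (rule fillable_mono)
      have nn: "0 \<le> step_const * ((\<theta> * A) * sqrt (\<theta> * A)) * (\<Sum>i<n. \<theta> ^ i) + cylinder_const * R * (\<theta> ^ n * (\<theta> * A))"
        "0 \<le> step_const * (A' * sqrt A')"
        using step_const_pos cylinder_const_pos \<theta> Suc.prems(3,5) sum0 A' by auto
      have 1: "step_const * (A' * sqrt A') \<le> step_const * (A * sqrt A)"
        using AA A' step_const_pos by (intro mult_left_mono mult_mono) auto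
      have "\<theta> * A \<le> A" using \<theta> Suc.prems(5) by (simp add: mult_left_le_one_le)
      then have "(\<theta> * A) * sqrt (\<theta> * A) \<le> (\<theta> * A) * sqrt A" using \<theta> Suc.prems(5) by (intro mult_left_mono) auto
      then have "step_const * ((\<theta> * A) * sqrt (\<theta> * A)) * (\<Sum>i<n. \<theta> ^ i) \<le> step_const * ((\<theta> * A) * sqrt A) * (\<Sum>i<n. \<theta> ^ i)"
        using step_const_pos by (intro mult_right_mono[OF mult_left_mono] sum0) auto
      also have "\<dots> = step_const * (A * sqrt A) * (\<Sum>i<n. \<theta> ^ Suc i)" by (simp add: sum_distrib_left mult_ac)
      finally have 2: "step_const * ((\<theta> * A) * sqrt (\<theta> * A)) * (\<Sum>i<n. \<theta> ^ i) \<le> step_const * (A * sqrt A) * (\<Sum>i<n. \<theta> ^ Suc i)" .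
      have 3: "(\<Sum>i<Suc n. \<theta> ^ i) = 1 + (\<Sum>i<n. \<theta> ^ Suc i)" by (simp only: sum.lessThan_Suc_shift power_0)
      have "step_const * ((\<theta> * A) * sqrt (\<theta> * A)) * (\<Sum>i<n. \<theta> ^ i) + cylinder_const * R * (\<theta> ^ n * (\<theta> * A)) + step_const * (A' * sqrt A')
        \<le> step_const * (A * sqrt A) * (\<Sum>i<n. \<theta> ^ Suc i) + cylinder_const * R * (\<theta> ^ n * (\<theta> * A)) + step_const * (A * sqrt A)"
        using 1 2 by linarith
      also have "\<dots> = step_const * (A * sqrt A) * (\<Sum>i<Suc n. \<theta> ^ i) + cylinder_const * R * (\<theta> ^ Suc n * A)"
        unfolding 3 by (simp add: algebra_simps)
      finally show "ennreal (step_const * ((\<theta> * A) * sqrt (\<theta> * A)) * (\<Sum>i<n. \<theta> ^ i) + cylinder_const * R * (\<theta> ^ n * (\<theta> * A))) + ennreal (step_const * (A' * sqrt A'))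
        \<le> ennreal (step_const * (A * sqrt A) * (\<Sum>i<Suc n. (255 / 256) ^ i) + cylinder_const * R * ((255 / 256) ^ Suc n * A))"
        unfolding \<theta>_def[symmetric] ennreal_plus[OF nn, symmetric] by (rule ennreal_leI)
    qed
  qed
qed

text \<open>Coning alone costs a multiple of \<open>R\<close> times the area, and long thin
  tentacles make \<open>R\<close> large at small area. The number \<open>n\<close> of rounds is
  therefore chosen after \<open>R\<close>, so that the final cone costs less than
  \<open>A * sqrt A\<close>; this is the summand 1 in the constant, and 256 bounds the geometric
  series.\<close>

lemma fillable_isoperimetric:
  fixes f :: "real^3 \<Rightarrow> 'a"
  assumes lip: "L-lipschitz_on (sphere 0 1) f"
  shows "fillable f (ennreal ((256 * step_const + 1) * enn2real (vol 2 f (sphere 0 1)) powr (3/2)))"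
proof -
  define A where "A = enn2real (vol 2 f (sphere 0 1))"
  have "vol 2 f (sphere 0 1) < top" using lip by (rule vol_lipschitz_sphere_finite)
  then have A: "vol 2 f (sphere 0 1) = ennreal A" "0 \<le> A" by (simp_all add: A_def)
  have "compact (f ` sphere 0 1)" using lip by (intro compact_continuous_image lipschitz_on_continuous_on) auto
  then obtain p R0 where R0: "f ` sphere 0 1 \<subseteq> cball p R0" using compact_imp_bounded bounded_subset_cball by metis
  define R where "R = max R0 1"
  have R: "f ` sphere 0 1 \<subseteq> cball p R" "0 < R" using R0 by (auto simp: R_def)
  show ?thesis
  proof (cases "A = 0")
    case True
    have "fillable f 0" using fillable_cone[OF lip R] A True by simp
    then show ?thesis by (rule fillable_mono) simp
  next
    case False
    then have A0: "0 < A" using A by simp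
    have "(\<lambda>n. cylinder_const * R * ((255 / 256) ^ n * A)) \<longlonglongrightarrow> cylinder_const * R * (0 * A)"
      by (intro tendsto_intros LIMSEQ_power_zero) simp
    then have "(\<lambda>n. cylinder_const * R * ((255 / 256) ^ n * A)) \<longlonglongrightarrow> 0" by simp
    then have "eventually (\<lambda>n. cylinder_const * R * ((255 / 256) ^ n * A) < A * sqrt A) sequentially"
      using A0 by (intro order_tendstoD(2)) auto
    then obtain n where n: "cylinder_const * R * ((255 / 256) ^ n * A) < A * sqrt A"
      using eventually_happens' sequentially_bot by blast
    have powr: "A powr (3/2) = A * sqrt A"
    proof -
      have "A powr (3/2) = A powr (1 + 1/2)" by simp
      also have "\<dots> = A * sqrt A" using A0 by (simp only: powr_add powr_half_sqrt powr_one)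
      finally show ?thesis .
    qed
    have "(\<Sum>i<n. (255 / 256 :: real) ^ i) = (1 - (255 / 256) ^ n) * 256" by (simp add: sum_gp_strict)
    also have "\<dots> \<le> 256" by simp
    finally have "step_const * (A * sqrt A) * (\<Sum>i<n. (255 / 256) ^ i) \<le> step_const * (A * sqrt A) * 256"
      using step_const_pos A by (intro mult_left_mono) auto
    then have "step_const * (A * sqrt A) * (\<Sum>i<n. (255 / 256) ^ i) + cylinder_const * R * ((255 / 256) ^ n * A)
      \<le> (256 * step_const + 1) * (A * sqrt A)" using n by (simp add: algebra_simps)
    then have "ennreal (step_const * (A * sqrt A) * (\<Sum>i<n. (255 / 256) ^ i) + cylinder_const * R * ((255 / 256) ^ n * A))
      \<le> ennreal ((256 * step_const + 1) * A powr (3/2))" unfolding powr by (rule ennreal_leI)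
    with fillable_iterate[OF lip R, of A n] A show ?thesis unfolding A_def[symmetric] by (auto intro: fillable_mono)
  qed
qed

end

theorem theoremC:
  assumes "CAT0 TYPE('a::metric_space)"
  shows "\<exists>C>0. \<forall>f :: real^3 \<Rightarrow> 'a. lipschitz (sphere 0 1) f \<longrightarrow>
           (\<exists>g :: real^3 \<Rightarrow> 'a. lipschitz (cball 0 1) g \<and> (\<forall>x\<in>sphere 0 1. g x = f x) \<and>
              vol 3 g (cball 0 1) \<le> ennreal (C * enn2real (vol 2 f (sphere 0 1)) powr (3/2)))"
proof -
  interpret cat0_space "TYPE('a)" by unfold_locales (rule assms)
  have "fillable f (ennreal ((256 * step_const + 1) * enn2real (vol 2 f (sphere 0 1)) powr (3/2)))"
    if "lipschitz (sphere 0 1) f" for f :: "real^3 \<Rightarrow> 'a"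
    using that fillable_isoperimetric unfolding lipschitz_def by blast
  then show ?thesis
    using step_const_pos unfolding fillable_def by (intro exI[of _ "256 * step_const + 1"]) auto
qed

end
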